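(* For all integers $M\ge 3$, $$A(M) = \frac{\pi^2M^2}{3\log^2M} + O\left( \frac{M^2\log\log M}{\log^3M} \right),$$ where the implied constant is absolute.
   Context: For a positive integer $n$, let $R(n)$ denote the number of ordered pairs $(p,q)$ of odd primes satisfying $p+q=n$. For a positive integer $m$, define $a(m) = \sum_{d\mid m} R(d)$, the sum being over positive divisors $d$ of $m$. For a positive integer $M$, define $A(M) = \sum_{m=1}^M a(2m) = \sum_{m=1}^{2M} a(m)$ (the two sums agree because $R(n)=0$ for odd $n$). Here $\log$ is the natural logarithm and $\log^k x = (\log x)^k$. *)

theory Defs
  imports Complex_Main "HOL-Computational_Algebra.Primes"
begin

definition goldbach_reps :: "nat \<Rightarrow> nat" where
  "goldbach_reps n = card {(p, q). prime p \<and> odd p \<and> prime q \<and> odd q \<and> p + q = n}"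

definition goldbach_divisor_sum :: "nat \<Rightarrow> nat" where
  "goldbach_divisor_sum m = (\<Sum>d | d dvd m. goldbach_reps d)"

definition goldbach_summatory :: "nat \<Rightarrow> nat" where
  "goldbach_summatory M = (\<Sum>m = 1..M. goldbach_divisor_sum (2 * m))"

lemma goldbach_reps_odd: "odd n \<Longrightarrow> goldbach_reps n = 0"
proof -
  assume "odd n"
  then have "{(p, q). prime p \<and> odd p \<and> prime q \<and> odd q \<and> p + q = n} = {}"
    by auto
  then show ?thesis
    by (simp only: goldbach_reps_def card.empty)
qed

lemma goldbach_divisor_sum_odd: "odd m \<Longrightarrow> goldbach_divisor_sum m = 0"
  unfolding goldbach_divisor_sum_def
  by (rule sum.neutral) (auto intro: goldbach_reps_odd dvd_trans)

lemma goldbach_summatory_altdef: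
  "goldbach_summatory M = (\<Sum>m = 1..2 * M. goldbach_divisor_sum m)"
  by (induction M) (simp_all add: goldbach_summatory_def goldbach_divisor_sum_odd)

end

theory Submission
  imports Defs "HOL-Complex_Analysis.Complex_Analysis" "HOL-Number_Theory.Prime_Powers"
    "HOL-Real_Asymp.Real_Asymp"
begin

text \<open>
  Interchanging summations, \<open>A(M) = (\<Sum>k\<le>2M. S(\<lfloor>2M/k\<rfloor>))\<close>, where \<open>S(N)\<close> counts pairs of odd primes with
  sum at most \<open>N\<close>. With \<open>S(N) = N\<^sup>2/(2 log\<^sup>2 N) + O(N\<^sup>2 log log N / log\<^sup>3 N)\<close> the terms with
  \<open>k \<le> log\<^sup>3 M\<close> give the main term via \<open>\<zeta>(2) = \<pi>\<^sup>2/6\<close>, and \<open>S(N) \<le> N\<^sup>2\<close> disposes of the others.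
  The asymptotics of \<open>S\<close> follow from \<open>\<psi>(N) = N + O(N / log N)\<close> by convolving \<open>\<Lambda>\<close> with \<open>\<psi>\<close> and removing
  the weights; the primes below \<open>N / log\<^sup>3 N\<close> are estimated trivially, which causes the
  \<open>log log\<close> in the error term.

  This form of the prime number theorem comes from Newman's contour argument made quantitative.
  The function \<open>(s - 1) \<zeta>(s)\<close> has growth exponent \<open>21/20\<close> near the line \<open>Re s = 1\<close>, so the 3-4-1
  inequality yields a zero-free region of width \<open>\<epsilon> \<bar>t\<bar> powr (-1/4)\<close>, with a corresponding bound for
  the logarithmic derivative. A contour of height \<open>R = log\<^sup>2 N\<close> then gives an error \<open>O(1/log\<^sup>2 N)\<close>
  for the integral of \<open>(\<psi>(x) - x)/x\<^sup>2\<close> up to \<open>N\<close>, and monotonicity of \<open>\<psi>\<close> turns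
  this into the pointwise error \<open>O(N / log N)\<close>.
\<close>

section \<open>The regularised zeta function \<open>(s - 1) \<zeta>(s)\<close>\<close>

text \<open>The exponents hang together. If \<open>(s - 1) \<zeta>(s)\<close> grows like
  \<open>u powr (1 + \<eta>)\<close>, where \<open>u = |t| + 2\<close>, then at distance
  \<open>\<delta>\<close> to the right of the line the 3-4-1 inequality bounds its fourth power
  below by a multiple of \<open>\<delta>^3 * u powr (4 - \<eta>)\<close>. That survives a walk of
  length \<open>2 * \<delta>\<close> to the left, with derivative of size
  \<open>u powr (1 + \<eta>)\<close>, once \<open>\<delta>\<close> is a small multiple of
  \<open>u powr (- 5 * \<eta>)\<close>; \<open>\<eta> = 1/20\<close> gives the width exponent -1/4.
  With \<open>U = log N\<close> and height \<open>U\<^sup>2\<close>, the left edge contributes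
  powers of \<open>U\<close> times \<open>exp (- U * \<delta>)\<close>, where
  \<open>U * \<delta>\<close> is about \<open>U powr (1 - 10 * \<eta>)\<close>. A polynomial growth
  bound thus suffices if \<open>\<eta>\<close> is below 1/10. The height is dictated by the passage
  from means to points: a window of length \<open>k\<close> next to \<open>N\<close> turns a mean
  error \<open>e\<close> into a pointwise error of order \<open>k + e * N^2 / k\<close>. With
  \<open>e = 1 / log^2 N\<close> the balance is at \<open>k = N / log N\<close>, which is then also
  the error. Its relative size \<open>1 / log N\<close> is what the error term of the theorem can
  absorb.\<close>

lemma of_real_derivative_bound:
  fixes f f' :: "complex \<Rightarrow> complex" and a b :: real
  assumes "\<And>x. a \<le> x \<Longrightarrow> x \<le> b \<Longrightarrow> (f has_field_derivative f' (of_real x)) (at (of_real x))"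
    and "\<And>x. a \<le> x \<Longrightarrow> x \<le> b \<Longrightarrow> cmod (f' (of_real x)) \<le> B" and "a \<le> b"
  shows "cmod (f (of_real b) - f (of_real a)) \<le> B * (b - a)"
proof -
  let ?S = "closed_segment (complex_of_real a) (of_real b)"
  have S: "?S = of_real ` {a..b}"
    using assms(3) by (simp add: closed_segment_of_real closed_segment_eq_real_ivl)
  have "cmod (f (of_real b) - f (of_real a)) \<le> B * cmod (of_real b - of_real a)"
  proof (rule field_differentiable_bound[where S = ?S])
    show "(f has_field_derivative f' z) (at z within ?S)" if "z \<in> ?S" for z
      using that assms(1) unfolding S by (auto intro: has_field_derivative_at_within)
    show "cmod (f' z) \<le> B" if "z \<in> ?S" for z
      using that assms(2) unfolding S by auto
  qed auto
  also have "cmod (of_real b - of_real a) = b - a"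
    using assms(3) by (metis abs_of_nonneg diff_ge_0_iff_ge norm_of_real of_real_diff)
  finally show ?thesis .
qed

lemma norm_of_real_powr: "x > 0 \<Longrightarrow> cmod (of_real x powr s) = x powr Re s"
  by (simp add: norm_powr_real_powr)

lemma norm_of_nat_powr: "n > 0 \<Longrightarrow> cmod (of_nat n powr s) = real n powr Re s"
  by (simp add: norm_powr_real_powr)

lemma powr_minus_diff_bound:
  fixes a x :: real
  assumes "a > 0" "a \<le> x" "x \<le> a + 1" "Re s \<ge> 0"
  shows "cmod (of_real x powr (-s) - of_real a powr (-s)) \<le> cmod s * a powr (- Re s - 1)"
proof -
  have "cmod (of_real x powr (-s) - of_real a powr (-s)) \<le> (cmod s * a powr (- Re s - 1)) * (x - a)"
  proof (rule of_real_derivative_bound[where f = "\<lambda>w. w powr (-s)" and f' = "\<lambda>w. (-s) * w powr (-s - 1)"])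
    fix y assume y: "a \<le> y" "y \<le> x"
    have "complex_of_real y \<notin> \<real>\<^sub>\<le>\<^sub>0" using y assms(1) by auto
    then show "((\<lambda>w. w powr (-s)) has_field_derivative (-s) * of_real y powr (-s - 1)) (at (of_real y))"
      by (rule has_field_derivative_powr)
    have "y powr (- Re s - 1) \<le> a powr (- Re s - 1)"
      using y assms by (intro powr_mono2') auto
    then show "cmod ((-s) * of_real y powr (-s - 1)) \<le> cmod s * a powr (- Re s - 1)"
      using y assms(1) by (simp add: norm_mult norm_of_real_powr mult_left_mono)
  qed (use assms in auto)
  also have "\<dots> \<le> (cmod s * a powr (- Re s - 1)) * 1"
    using assms by (intro mult_left_mono) auto
  finally show ?thesis by simp
qed

text \<open>With \<open>a = n + 1\<close>, this is \<open>s - 1\<close> times the difference between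
  \<open>a powr (-s)\<close> and the integral of \<open>x powr (-s)\<close> over
  \<open>[a, a + 1]\<close>. Multiplying by \<open>s - 1\<close> avoids a division that is singular
  at \<open>s = 1\<close>.\<close>

definition zterm :: "nat \<Rightarrow> complex \<Rightarrow> complex" where
  "zterm n s = (s - 1) * of_nat (Suc n) powr (-s) - of_nat (Suc n) powr (1 - s)
     + of_nat (Suc (Suc n)) powr (1 - s)"

definition zreg :: "complex \<Rightarrow> complex" where
  "zreg s = 1 + (\<Sum>n. zterm n s)"

text \<open>\<open>zterm n s\<close> is the increment over a unit interval of a function with
  derivative \<open>(1 - s) * (x powr (-s) - a powr (-s))\<close>. The bound on the difference of
  powers is left open because two are inserted below: one gains a factor \<open>1 / a\<close>, the
  other avoids the factor \<open>|s|\<close>.\<close>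

lemma zterm_bound_aux:
  assumes "\<And>x. real (Suc n) \<le> x \<Longrightarrow> x \<le> real (Suc n) + 1 \<Longrightarrow>
    cmod (of_real x powr (-s) - of_real (real (Suc n)) powr (-s)) \<le> B"
  shows "cmod (zterm n s) \<le> cmod (s - 1) * B"
proof -
  define a where "a = real (Suc n)"
  have a: "a > 0" by (simp add: a_def)
  define f where "f = (\<lambda>w. (s - 1) * of_real a powr (-s) * (w - of_real a) + w powr (1 - s))"
  define f' where "f' = (\<lambda>w. (s - 1) * of_real a powr (-s) + (1 - s) * w powr (-s))"
  have "cmod (f (of_real (a + 1)) - f (of_real a)) \<le> (cmod (s - 1) * B) * (a + 1 - a)"
  proof (rule of_real_derivative_bound[where f' = f'])
    fix y assume y: "a \<le> y" "y \<le> a + 1"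
    have "complex_of_real y \<notin> \<real>\<^sub>\<le>\<^sub>0" using y a by auto
    then have "((\<lambda>z. z powr (1 - s)) has_field_derivative (1 - s) * of_real y powr (1 - s - 1)) (at (of_real y))"
      by (rule has_field_derivative_powr)
    moreover have "1 - s - 1 = -s" by simp
    ultimately have "((\<lambda>z. z powr (1 - s)) has_field_derivative (1 - s) * of_real y powr (-s)) (at (of_real y))"
      by metis
    moreover have "y > 0" using y a by linarith
    ultimately show "(f has_field_derivative f' (of_real y)) (at (of_real y))"
      unfolding f_def f'_def by (auto intro!: derivative_eq_intros simp del: of_nat_Suc)
    have "f' (of_real y) = (1 - s) * (of_real y powr (-s) - of_real a powr (-s))"
      by (simp add: f'_def algebra_simps)
    then have "cmod (f' (of_real y)) = cmod (s - 1) * cmod (of_real y powr (-s) - of_real a powr (-s))"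
      by (simp add: norm_mult norm_minus_commute)
    also have "\<dots> \<le> cmod (s - 1) * B"
      using assms[of y] y by (intro mult_left_mono) (auto simp: a_def)
    finally show "cmod (f' (of_real y)) \<le> cmod (s - 1) * B" .
  qed auto
  moreover have "f (of_real (a + 1)) - f (of_real a) = zterm n s"
    by (simp add: f_def zterm_def a_def algebra_simps)
  ultimately show ?thesis by simp
qed

lemma zterm_bound1:
  assumes "Re s \<ge> 0"
  shows "cmod (zterm n s) \<le> cmod (s - 1) * (cmod s * real (Suc n) powr (- Re s - 1))"
  by (rule zterm_bound_aux) (use assms in \<open>intro powr_minus_diff_bound, auto\<close>)

lemma zterm_bound2:
  assumes "Re s \<ge> 0"
  shows "cmod (zterm n s) \<le> cmod (s - 1) * (2 * real (Suc n) powr (- Re s))"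
proof (rule zterm_bound_aux)
  fix x assume x: "real (Suc n) \<le> x" "x \<le> real (Suc n) + 1"
  have "cmod (of_real x powr (-s) - of_real (real (Suc n)) powr (-s))
     \<le> x powr (- Re s) + real (Suc n) powr (- Re s)"
    using x by (intro order.trans[OF norm_triangle_ineq4])
      (simp add: norm_of_real_powr norm_of_nat_powr del: of_nat_Suc)
  also have "x powr (- Re s) \<le> real (Suc n) powr (- Re s)"
    using x assms by (intro powr_mono2') auto
  finally show "cmod (of_real x powr (-s) - of_real (real (Suc n)) powr (-s)) \<le> 2 * real (Suc n) powr (- Re s)"
    by simp
qed

text \<open>Interpolates between the two previous bounds: up to a constant they differ by the factor
  \<open>|s| / a\<close>, and the smaller of 1 and \<open>|s| / a\<close> is at most
  \<open>(|s| / a) powr (1/20)\<close>. The price is a small power of \<open>|s|\<close>; the gain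
  \<open>a powr (-1/20)\<close> keeps the series convergent down to
  \<open>Re s = 1 - 1/40\<close>.\<close>

lemma zterm_bound:
  assumes "Re s \<ge> 1 - 1/40"
  shows "cmod (zterm n s) \<le> 2 * cmod (s - 1) * cmod s powr (1/20) * real (Suc n) powr (-1 - 1/40)"
proof -
  define a where "a = real (Suc n)"
  have a: "a \<ge> 1" by (simp add: a_def)
  have s: "cmod s > 0" using assms by auto
  have "cmod (zterm n s) \<le> cmod (s - 1) * (2 * a powr (- Re s) * (cmod s / a) powr (1/20))"
  proof (cases "cmod s \<le> a")
    case True
    have "cmod (zterm n s) \<le> cmod (s - 1) * (cmod s * a powr (- Re s - 1))"
      using zterm_bound1[of s n] assms by (simp add: a_def)
    also have "cmod s * a powr (- Re s - 1) = a powr (- Re s) * (cmod s / a)"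
      using a by (simp add: powr_diff)
    also have "cmod s / a \<le> (cmod s / a) powr (1/20)"
      using powr_mono'[of "1/20" 1 "cmod s / a"] s a True by simp
    also have "a powr (- Re s) * (cmod s / a) powr (1/20) \<le> 2 * a powr (- Re s) * (cmod s / a) powr (1/20)"
      by simp
    finally show ?thesis by (simp add: mult_left_mono)
  next
    case False
    have "cmod (zterm n s) \<le> cmod (s - 1) * (2 * a powr (- Re s) * 1)"
      using zterm_bound2[of s n] assms by (simp add: a_def)
    also have "1 \<le> (cmod s / a) powr (1/20)"
      using a False by (intro ge_one_powr_ge_zero) auto
    finally show ?thesis by (simp add: mult_left_mono)
  qed
  also have "a powr (- Re s) * (cmod s / a) powr (1/20) = cmod s powr (1/20) * a powr (- Re s - 1/20)"
    using a s by (simp add: powr_divide powr_diff)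
  then have "cmod (s - 1) * (2 * a powr (- Re s) * (cmod s / a) powr (1/20))
      = 2 * cmod (s - 1) * cmod s powr (1/20) * a powr (- Re s - 1/20)"
    by (simp add: algebra_simps)
  also have "a powr (- Re s - 1/20) \<le> a powr (-1 - 1/40)"
    using a assms by (intro powr_mono) auto
  finally show ?thesis by (simp add: a_def mult_left_mono)
qed

lemma summable_powr_Suc: "e < -1 \<Longrightarrow> summable (\<lambda>n. real (Suc n) powr e)"
  using summable_Suc_iff[of "\<lambda>n. real n powr e"] summable_real_powr_iff[of e] by simp

abbreviation zdom :: "complex set" where "zdom \<equiv> {s. Re s > 1 - 1/40}"

lemma open_zdom: "open zdom"
  by (rule open_halfspace_Re_gt)

lemma zterm_holomorphic: "zterm n holomorphic_on A"
  unfolding zterm_def by (intro holomorphic_intros) (auto simp del: of_nat_Suc)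

lemma zreg_bound: "\<exists>C>0. \<forall>s. Re s \<ge> 1 - 1/40 \<longrightarrow>
    summable (\<lambda>n. zterm n s) \<and> cmod (zreg s) \<le> 1 + C * (cmod (s - 1) * cmod s powr (1/20))"
proof -
  define S where "S = (\<Sum>n. real (Suc n) powr (-1 - 1/40))"
  have sm: "summable (\<lambda>n. real (Suc n) powr (-1 - 1/40))"
    by (rule summable_powr_Suc) simp
  have S: "S \<ge> 0" unfolding S_def by (intro suminf_nonneg sm) simp
  have "summable (\<lambda>n. zterm n s) \<and> cmod (zreg s) \<le> 1 + (2 * S + 1) * (cmod (s - 1) * cmod s powr (1/20))"
    if "Re s \<ge> 1 - 1/40" for s
  proof -
    define K where "K = 2 * cmod (s - 1) * cmod s powr (1/20)"
    have smK: "summable (\<lambda>n. K * real (Suc n) powr (-1 - 1/40))"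
      by (intro summable_mult sm)
    have le: "cmod (zterm n s) \<le> K * real (Suc n) powr (-1 - 1/40)" for n
      using zterm_bound[OF that] by (simp add: K_def)
    have sz: "summable (\<lambda>n. cmod (zterm n s))"
      by (rule summable_comparison_test[OF _ smK]) (use le in auto)
    have "cmod (\<Sum>n. zterm n s) \<le> (\<Sum>n. K * real (Suc n) powr (-1 - 1/40))"
      by (rule order.trans[OF summable_norm[OF sz] suminf_le[OF le sz smK]])
    also have "\<dots> = K * S" unfolding S_def by (rule suminf_mult[OF sm])
    finally have "cmod (zreg s) \<le> 1 + K * S"
      unfolding zreg_def by (intro order.trans[OF norm_triangle_ineq]) simp
    also have "K * S \<le> (2 * S + 1) * (cmod (s - 1) * cmod s powr (1/20))"
      by (simp add: K_def algebra_simps)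
    finally show ?thesis using summable_norm_cancel[OF sz] by simp
  qed
  then show ?thesis using S by (intro exI[of _ "2 * S + 1"]) auto
qed

lemma zterm_summable: "Re s \<ge> 1 - 1/40 \<Longrightarrow> summable (\<lambda>n. zterm n s)"
  using zreg_bound by blast

lemma zreg_holomorphic: "zreg holomorphic_on zdom"
proof -
  have "(\<lambda>s. \<Sum>n. zterm n s) holomorphic_on zdom"
  proof (rule holomorphic_uniform_sequence[OF open_zdom])
    show "(\<lambda>s. \<Sum>n<N. zterm n s) holomorphic_on zdom" for N
      by (intro holomorphic_intros zterm_holomorphic)
    fix z assume "z \<in> zdom"
    then obtain d where d: "d > 0" "cball z d \<subseteq> zdom"
      using open_zdom open_contains_cball by blast
    have "uniform_limit (cball z d) (\<lambda>N s. \<Sum>n<N. zterm n s) (\<lambda>s. \<Sum>n. zterm n s) sequentially"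
    proof (rule Weierstrass_m_test)
      let ?K = "2 * (cmod z + d + 1) * (cmod z + d) powr (1/20)"
      fix n s assume s: "s \<in> cball z d"
      have cs: "cmod s \<le> cmod z + d"
        using s norm_triangle_ineq[of z "s - z"] by (simp add: dist_norm norm_minus_commute)
      have cs1: "cmod (s - 1) \<le> cmod z + d + 1"
        using cs norm_triangle_ineq4[of s 1] by simp
      have "cmod (zterm n s) \<le> 2 * cmod (s - 1) * cmod s powr (1/20) * real (Suc n) powr (-1 - 1/40)"
        using s d by (intro zterm_bound) auto
      also have "\<dots> \<le> ?K * real (Suc n) powr (-1 - 1/40)"
        using cs cs1 d by (intro mult_right_mono mult_mono powr_mono2) auto
      finally show "cmod (zterm n s) \<le> ?K * real (Suc n) powr (-1 - 1/40)" .
    next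
      show "summable (\<lambda>n. 2 * (cmod z + d + 1) * (cmod z + d) powr (1/20) * real (Suc n) powr (-1 - 1/40))"
        by (intro summable_mult summable_powr_Suc) simp
    qed
    then show "\<exists>d>0. cball z d \<subseteq> zdom \<and>
        uniform_limit (cball z d) (\<lambda>N s. \<Sum>n<N. zterm n s) (\<lambda>s. \<Sum>n. zterm n s) sequentially"
      using d by blast
  qed
  then show ?thesis unfolding zreg_def by (intro holomorphic_intros)
qed

lemma zreg_1: "zreg 1 = 1"
proof -
  have "of_nat (Suc n) powr (0::complex) = 1" for n
    by (simp add: powr_def del: of_nat_Suc)
  then have "zterm n 1 = 0" for n
    by (simp only: zterm_def diff_self) simp
  then show ?thesis by (simp add: zreg_def)
qed

lemma sum_zterm:
  "(\<Sum>n<N. zterm n s) = (s - 1) * (\<Sum>n<N. of_nat (Suc n) powr (-s)) - 1 + of_nat (Suc N) powr (1 - s)"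
  by (induction N) (simp_all add: zterm_def algebra_simps)

text \<open>Ties \<open>zreg\<close> to the zeta function: the second and third terms of
  \<open>zterm\<close> telescope, and the boundary term they leave tends to 0 because
  \<open>Re s > 1\<close>.\<close>

lemma zeta_sums:
  assumes "Re s > 1"
  shows "(\<lambda>n. of_nat (Suc n) powr (-s)) sums (zreg s / (s - 1))"
proof -
  have s1: "s \<noteq> 1" using assms by auto
  have "(\<lambda>N. \<Sum>n<N. zterm n s) \<longlonglongrightarrow> (\<Sum>n. zterm n s)"
    using assms by (intro summable_LIMSEQ zterm_summable) auto
  moreover have "(\<lambda>N. of_nat (Suc N) powr (1 - s)) \<longlonglongrightarrow> 0"
  proof (rule tendsto_norm_zero_cancel)
    have "(\<lambda>N. real (Suc N) powr (1 - Re s)) \<longlonglongrightarrow> 0"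
      using assms by real_asymp
    then show "(\<lambda>N. cmod (of_nat (Suc N) powr (1 - s))) \<longlonglongrightarrow> 0"
      by (simp add: norm_of_nat_powr del: of_nat_Suc)
  qed
  ultimately have "(\<lambda>N. ((\<Sum>n<N. zterm n s) + 1 - of_nat (Suc N) powr (1 - s)) / (s - 1))
      \<longlonglongrightarrow> ((\<Sum>n. zterm n s) + 1 - 0) / (s - 1)"
    using s1 by (intro tendsto_intros) auto
  moreover have "((\<Sum>n<N. zterm n s) + 1 - of_nat (Suc N) powr (1 - s)) / (s - 1) 
     = (\<Sum>n<N. of_nat (Suc n) powr (-s))" for N
    using s1 by (simp add: sum_zterm)
  ultimately show ?thesis unfolding sums_def zreg_def by (simp add: add.commute)
qed

lemma zreg_growth: "\<exists>C>0. \<forall>s. Re s \<ge> 1 - 1/40 \<and> Re s \<le> 4 \<longrightarrow> 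
    cmod (zreg s) \<le> C * (\<bar>Im s\<bar> + 2) powr (21/20)"
proof -
  obtain C where C: "C > 0" "\<And>s. Re s \<ge> 1 - 1/40 \<Longrightarrow>
      cmod (zreg s) \<le> 1 + C * (cmod (s - 1) * cmod s powr (1/20))"
    using zreg_bound by blast
  have "cmod (zreg s) \<le> (1 + 9 * C) * (\<bar>Im s\<bar> + 2) powr (21/20)" if s: "Re s \<ge> 1 - 1/40" "Re s \<le> 4" for s
  proof -
    define u where "u = \<bar>Im s\<bar> + 2"
    have u: "u \<ge> 2" by (simp add: u_def)
    have 1: "cmod s \<le> 3 * u" using s cmod_le[of s] by (simp add: u_def)
    have 2: "cmod (s - 1) \<le> 3 * u" using s cmod_le[of "s - 1"] by (simp add: u_def)
    have "cmod s powr (1/20) \<le> (3 * u) powr (1/20)"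
      using 1 by (intro powr_mono2) auto
    also have "\<dots> = 3 powr (1/20) * u powr (1/20)" using u by (simp add: powr_mult)
    also have "3 powr (1/20) \<le> (3::real) powr 1" by (intro powr_mono) auto
    finally have 3: "cmod s powr (1/20) \<le> 3 * u powr (1/20)" by (simp add: mult_right_mono)
    have "cmod (s - 1) * cmod s powr (1/20) \<le> (3 * u) * (3 * u powr (1/20))"
      using 2 3 u by (intro mult_mono) auto
    also have "\<dots> = 9 * u powr (1 + 1/20)" using u by (simp only: powr_add) simp
    finally have 4: "cmod (s - 1) * cmod s powr (1/20) \<le> 9 * u powr (21/20)" by simp
    have "1 \<le> u powr (21/20)" using u by (intro ge_one_powr_ge_zero) auto
    moreover have "cmod (zreg s) \<le> 1 + C * (9 * u powr (21/20))"
      using C(2)[OF s(1)] mult_left_mono[OF 4, of C] C(1) by linarith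
    ultimately show ?thesis by (simp add: u_def algebra_simps)
  qed
  then show ?thesis using C(1) by (intro exI[of _ "1 + 9 * C"]) auto
qed

text \<open>Cauchy's inequality on discs of radius 1/100. A disc centred at
  \<open>Re s \<ge> 1 - 1/100\<close> reaches at most to \<open>1 - 1/50\<close>, which is still
  inside the half-plane where \<open>zreg_growth\<close> holds, and across it
  \<open>|Im s| + 2\<close> changes by less than a factor 2.\<close>

lemma zreg_deriv_growth: "\<exists>C>0. \<forall>s. Re s \<ge> 1 - 1/100 \<and> Re s \<le> 3 \<longrightarrow> 
    cmod (deriv zreg s) \<le> C * (\<bar>Im s\<bar> + 2) powr (21/20)"
proof -
  obtain C where C: "C > 0" "\<And>s. Re s \<ge> 1 - 1/40 \<Longrightarrow> Re s \<le> 4 \<Longrightarrow>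
      cmod (zreg s) \<le> C * (\<bar>Im s\<bar> + 2) powr (21/20)"
    using zreg_growth by blast
  have "cmod (deriv zreg s) \<le> 400 * C * (\<bar>Im s\<bar> + 2) powr (21/20)" 
    if s: "Re s \<ge> 1 - 1/100" "Re s \<le> 3" for s
  proof -
    define u where "u = \<bar>Im s\<bar> + 2"
    have u: "u \<ge> 2" by (simp add: u_def)
    have re: "\<bar>Re w - Re s\<bar> \<le> 1/100" "\<bar>Im w - Im s\<bar> \<le> 1/100" if "w \<in> cball s (1/100)" for w
      using that abs_Re_le_cmod[of "w - s"] abs_Im_le_cmod[of "w - s"]
      by (simp_all add: dist_norm norm_minus_commute)
    have sub: "cball s (1/100) \<subseteq> zdom" 
    proof
      fix w assume "w \<in> cball s (1/100)"
      from re(1)[OF this] s have "Re w > 1 - 1/40" by linarith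
      then show "w \<in> zdom" by simp
    qed
    have "cmod ((deriv ^^ 1) zreg s) \<le> fact 1 * (C * (2 * u) powr (21/20)) / (1/100) ^ 1"
    proof (rule Cauchy_inequality)
      show "zreg holomorphic_on ball s (1/100)"
        using sub ball_subset_cball by (intro holomorphic_on_subset[OF zreg_holomorphic]) blast
      show "continuous_on (cball s (1/100)) zreg"
        by (rule continuous_on_subset[OF holomorphic_on_imp_continuous_on[OF zreg_holomorphic] sub])
      fix w assume "cmod (s - w) = 1/100"
      then have w: "w \<in> cball s (1/100)" by (simp add: dist_norm)
      have "cmod (zreg w) \<le> C * (\<bar>Im w\<bar> + 2) powr (21/20)"
        using re(1)[OF w] s by (intro C(2)) linarith+
      also have "\<dots> \<le> C * (2 * u) powr (21/20)"
        using re(2)[OF w] C(1) by (intro mult_left_mono powr_mono2) (auto simp: u_def abs_if split: if_splits)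
      finally show "cmod (zreg w) \<le> C * (2 * u) powr (21/20)" .
    qed simp
    also have "(2 * u) powr (21/20) = 2 powr (21/20) * u powr (21/20)" using u by (simp add: powr_mult)
    finally have "cmod (deriv zreg s) \<le> 100 * C * 2 powr (21/20) * u powr (21/20)" by (simp add: mult_ac)
    moreover have "(2::real) powr (21/20) \<le> 2 powr 2" by (intro powr_mono) auto
    then have "100 * C * 2 powr (21/20) * u powr (21/20) \<le> 100 * C * 4 * u powr (21/20)"
      using C(1) by (intro mult_right_mono mult_left_mono) auto
    ultimately show ?thesis by (simp add: u_def)
  qed
  then show ?thesis using C(1) by (intro exI[of _ "400 * C"]) auto
qed

section \<open>The von Mangoldt Dirichlet series and the 3-4-1 inequality\<close>

text \<open>The zeta function on the half-plane \<open>Re s > 1\<close>, by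
  \<open>zeta_sums\<close>.\<close>

definition zt :: "complex \<Rightarrow> complex" where "zt s = zreg s / (s - 1)"

text \<open>The negative logarithmic derivative of zeta, which
  \<open>zt_has_field_derivative\<close> confirms.\<close>

definition lser :: "complex \<Rightarrow> complex" where
  "lser s = (\<Sum>n. mangoldt (Suc n) * of_nat (Suc n) powr (-s))"

lemma norm_powr_summable:
  assumes "Re s > 1"
  shows "summable (\<lambda>n. cmod (of_nat (Suc n) powr (-s)))"
  using summable_powr_Suc[of "- Re s"] assms by (simp add: norm_of_nat_powr del: of_nat_Suc)

lemma norm_mangoldt_powr_summable:
  assumes "Re s > 1"
  shows "summable (\<lambda>n. cmod (mangoldt (Suc n) * of_nat (Suc n) powr (-s)))"
proof -
  define e where "e = (Re s - 1) / 2"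
  have e: "e > 0" using assms by (simp add: e_def)
  show ?thesis
  proof (rule summable_comparison_test)
    show "summable (\<lambda>n. (1/e) * real (Suc n) powr (e - Re s))"
      by (intro summable_mult summable_powr_Suc) (use assms in \<open>auto simp: e_def field_simps\<close>)
    have "norm (cmod (mangoldt (Suc n) * of_nat (Suc n) powr (-s))) \<le> (1/e) * real (Suc n) powr (e - Re s)" for n
    proof -
      have "mangoldt (Suc n) \<le> ln (real (Suc n))" by (rule mangoldt_le) simp
      also have "\<dots> \<le> real (Suc n) powr e / e"
        using e by (intro ln_powr_bound) auto
      finally have "mangoldt (Suc n) * real (Suc n) powr (- Re s) \<le> real (Suc n) powr e / e * real (Suc n) powr (- Re s)"
        by (rule mult_right_mono) simp
      also have "\<dots> = (1/e) * (real (Suc n) powr e * real (Suc n) powr (- Re s))" by simp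
      also have "real (Suc n) powr e * real (Suc n) powr (- Re s) = real (Suc n) powr (e - Re s)"
        by (simp only: powr_add[symmetric]) simp
      finally show ?thesis
        by (simp add: norm_mult norm_of_nat_powr abs_mult mangoldt_nonneg del: of_nat_Suc)
    qed
    then show "\<exists>N. \<forall>n\<ge>N. norm (cmod (mangoldt (Suc n) * of_nat (Suc n) powr (-s))) \<le> (1/e) * real (Suc n) powr (e - Re s)"
      by blast
  qed
qed

lemma lser_sums:
  assumes "Re s > 1"
  shows "(\<lambda>n. mangoldt (Suc n) * of_nat (Suc n) powr (-s)) sums lser s"
  unfolding lser_def using summable_norm_cancel[OF norm_mangoldt_powr_summable[OF assms]] by (rule summable_sums)

lemma has_sum_Suc_iff: "((\<lambda>n. f (Suc n)) has_sum S) UNIV \<longleftrightarrow> (f has_sum S) {0<..}"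
  by (rule has_sum_reindex_bij_betw) (auto simp: bij_betw_def image_iff gr0_conv_Suc)

lemma summable_on_greater_0:
  fixes f :: "nat \<Rightarrow> 'a :: banach"
  assumes "summable (\<lambda>n. norm (f (Suc n)))"
  shows "(\<lambda>n. norm (f n)) summable_on {0<..}"
proof -
  have "((\<lambda>n. norm (f (Suc n))) has_sum (\<Sum>n. norm (f (Suc n)))) UNIV"
    using assms by (intro sums_nonneg_imp_has_sum summable_sums) auto
  then have "((\<lambda>n. norm (f n)) has_sum (\<Sum>n. norm (f (Suc n)))) {0<..}"
    by (simp only: has_sum_Suc_iff[of "\<lambda>n. norm (f n)"])
  then show ?thesis by (rule has_sum_imp_summable)
qed

lemma powr_mult_nat:
  "of_nat (m * n) powr (s::complex) = of_nat m powr s * of_nat n powr s"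
proof -
  have "(complex_of_real (real m) * complex_of_real (real n)) powr s = complex_of_real (real m) powr s * complex_of_real (real n) powr s"
    by (rule powr_times_real) auto
  then show ?thesis by simp
qed

text \<open>The convolution identity behind it is that the von Mangoldt function sums to
  \<open>ln n\<close> over the divisors of \<open>n\<close>. Both series converge absolutely, so
  their product is an unordered sum over pairs of factors, which may be regrouped as pairs of a
  product \<open>n\<close> and a divisor \<open>d\<close> of it.\<close>

lemma ln_powr_sums:
  assumes s: "Re s > 1"
  shows "(\<lambda>n. of_real (ln (real (Suc n))) * of_nat (Suc n) powr (-s)) sums (lser s * zt s)"
proof -
  define f where "f = (\<lambda>n::nat. mangoldt n * of_nat n powr (-s))"
  define g where "g = (\<lambda>n::nat. of_nat n powr (-s) :: complex)"
  have f: "(f has_sum lser s) {0<..}"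
    using norm_summable_imp_has_sum[OF norm_mangoldt_powr_summable lser_sums, OF s s]
    unfolding f_def by (simp only: has_sum_Suc_iff[of "\<lambda>n. mangoldt n * of_nat n powr (-s)"])
  have g: "(g has_sum zt s) {0<..}"
    using norm_summable_imp_has_sum[OF norm_powr_summable zeta_sums, OF s s]
    unfolding g_def zt_def by (simp only: has_sum_Suc_iff[of "\<lambda>n. of_nat n powr (-s)"])
  have fa: "(\<lambda>n. norm (f n)) summable_on {0<..}"
    by (rule summable_on_greater_0) (use norm_mangoldt_powr_summable[OF s] in \<open>simp only: f_def\<close>)
  have ga: "(\<lambda>n. norm (g n)) summable_on {0<..}"
    by (rule summable_on_greater_0) (use norm_powr_summable[OF s] in \<open>simp only: g_def\<close>)
  have "(\<lambda>(m,n). norm (f m) * norm (g n)) summable_on {0<..} \<times> {0<..}"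
  proof (rule summable_on_SigmaI)
    show "((\<lambda>n. case (m, n) of (m, n) \<Rightarrow> norm (f m) * norm (g n)) has_sum (norm (f m) * (\<Sum>\<^sub>\<infinity>n\<in>{0<..}. norm (g n)))) {0<..}" for m
      using has_sum_cmult_right[OF has_sum_infsum[OF ga]] by simp
    show "(\<lambda>m. norm (f m) * (\<Sum>\<^sub>\<infinity>n\<in>{0<..}. norm (g n))) summable_on {0<..}"
      by (rule summable_on_cmult_left[OF fa])
  qed auto
  then have "(\<lambda>(m,n). f m * g n) summable_on {0<..} \<times> {0<..}"
    by - (rule abs_summable_summable, simp add: case_prod_unfold norm_mult)
  then have fg: "((\<lambda>(m,n). f m * g n) has_sum (lser s * zt s)) ({0<..} \<times> {0<..})"
  proof (rule has_sum_SigmaI[rotated 2])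
    show "((\<lambda>n. case (m, n) of (m, n) \<Rightarrow> f m * g n) has_sum (f m * zt s)) {0<..}" for m
      using has_sum_cmult_right[OF g] by simp
    show "((\<lambda>m. f m * zt s) has_sum (lser s * zt s)) {0<..}"
      by (rule has_sum_cmult_left[OF f])
  qed
  have "((\<lambda>(n,d). f d * g (n div d)) has_sum (lser s * zt s)) (Sigma {0<..} (\<lambda>n. {d. d dvd n})) \<longleftrightarrow>
      ((\<lambda>(m,n). f m * g n) has_sum (lser s * zt s)) ({0<..} \<times> {0<..})"
    by (rule has_sum_reindex_bij_witness[where i = "\<lambda>(m,n). (m * n, m)" and j = "\<lambda>(n,d). (d, n div d)"])
       (auto simp: div_greater_zero_iff dest: dvd_imp_le intro: dvd_pos_nat)
  with fg have "((\<lambda>(n,d). f d * g (n div d)) has_sum (lser s * zt s)) (Sigma {0<..} (\<lambda>n. {d. d dvd n}))"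
    by simp
  then have "((\<lambda>n. of_real (ln (real n)) * of_nat n powr (-s)) has_sum (lser s * zt s)) {0<..}"
  proof (rule has_sum_SigmaD)
    fix n :: nat assume "n \<in> {0<..}"
    then have n: "n > 0" by simp
    have "(\<Sum>d | d dvd n. f d * g (n div d)) = (\<Sum>d | d dvd n. mangoldt d * of_nat n powr (-s))"
    proof (rule sum.cong)
      fix d assume "d \<in> {d. d dvd n}"
      then have "n = d * (n div d)" by simp
      then have "of_nat n powr (-s) = of_nat d powr (-s) * (of_nat (n div d) powr (-s) :: complex)"
        using powr_mult_nat by metis
      then show "f d * g (n div d) = mangoldt d * of_nat n powr (-s)"
        by (simp add: f_def g_def mult.assoc)
    qed auto
    also have "\<dots> = of_real (ln (real n)) * of_nat n powr (-s)"
      using mangoldt_sum[of n, where ?'a = complex] n by (simp add: sum_distrib_right[symmetric])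
    finally show "((\<lambda>d. case (n, d) of (n, d) \<Rightarrow> f d * g (n div d)) has_sum
        (of_real (ln (real n)) * of_nat n powr (-s))) {d. d dvd n}"
      using n by (intro has_sum_finiteI) auto
  qed
  then show ?thesis
    by (intro has_sum_imp_sums) (simp only: has_sum_Suc_iff[of "\<lambda>n. of_real (ln (real n)) * of_nat n powr (-s)"])
qed

text \<open>Termwise differentiation gives the negative of the series in
  \<open>ln_powr_sums\<close>. Writing the result as a multiple of \<open>zt s\<close>, not as a
  quotient, makes it available before zeros are excluded.\<close>

lemma zt_has_field_derivative:
  assumes s: "Re s > 1"
  shows "(zt has_field_derivative (- lser s * zt s)) (at s)"
proof -
  let ?S = "{s. Re s > 1}"
  have op: "open ?S" by (rule open_halfspace_Re_gt)
  have "\<exists>g g'. \<forall>x\<in>?S. ((\<lambda>n. of_nat (Suc n) powr (-x)) sums g x) \<and>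
      ((\<lambda>n. - of_real (ln (real (Suc n))) * of_nat (Suc n) powr (-x)) sums g' x) \<and> (g has_field_derivative g' x) (at x)"
  proof (rule series_and_derivative_comparison_local[OF op])
    fix n and x :: complex
    have "complex_of_nat (Suc n) \<noteq> 0" by (simp del: of_nat_Suc)
    moreover have "Ln (complex_of_nat (Suc n)) = of_real (ln (real (Suc n)))"
      using Ln_of_real[of "real (Suc n)"] by (simp del: of_nat_Suc)
    ultimately have "((\<lambda>x. exp (- x * of_real (ln (real (Suc n))))) has_field_derivative - of_real (ln (real (Suc n))) * of_nat (Suc n) powr (-x)) (at x)"
      by (auto intro!: derivative_eq_intros simp: powr_def simp del: of_nat_Suc)
    with \<open>Ln _ = _\<close> \<open>_ \<noteq> 0\<close> show "((\<lambda>x. of_nat (Suc n) powr (-x)) has_field_derivative - of_real (ln (real (Suc n))) * of_nat (Suc n) powr (-x)) (at x)"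
      by (simp add: powr_def del: of_nat_Suc)
  next
    fix x assume "x \<in> ?S"
    then have x: "Re x > 1" by simp
    define d where "d = (Re x - 1) / 2"
    have d: "d > 0" using x by (simp add: d_def)
    have "cmod (of_nat (Suc n) powr (-y)) \<le> real (Suc n) powr (-1 - d)" if "y \<in> ball x d" for y n
    proof -
      have "\<bar>Re x - Re y\<bar> < d"
        using that abs_Re_le_cmod[of "x - y"] by (simp add: dist_norm)
      then have "- Re y \<le> -1 - d" unfolding d_def by argo
      then show ?thesis
        by (simp add: norm_of_nat_powr del: of_nat_Suc) (intro powr_mono, auto)
    qed
    moreover have "summable (\<lambda>n. real (Suc n) powr (-1 - d))"
      by (intro summable_powr_Suc) (use d in simp)
    ultimately show "\<exists>d h. 0 < d \<and> summable h \<and> (\<forall>\<^sub>F n in sequentially. \<forall>y\<in>ball x d \<inter> ?S. cmod (of_nat (Suc n) powr (-y)) \<le> h n)"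
      using d by (intro exI[of _ d] exI[of _ "\<lambda>n. real (Suc n) powr (-1 - d)"]) auto
  qed
  then obtain g g' where g: "\<And>x. x \<in> ?S \<Longrightarrow> (\<lambda>n. of_nat (Suc n) powr (-x)) sums g x"
      "\<And>x. x \<in> ?S \<Longrightarrow> (\<lambda>n. - of_real (ln (real (Suc n))) * of_nat (Suc n) powr (-x)) sums g' x"
      "\<And>x. x \<in> ?S \<Longrightarrow> (g has_field_derivative g' x) (at x)"
    by blast
  have eq: "g x = zt x" if "x \<in> ?S" for x
    using g(1)[OF that] zeta_sums[of x] that sums_unique2 by (auto simp: zt_def)
  have "g' s = - (lser s * zt s)"
    using sums_unique2[OF g(2)[of s]] s sums_minus[OF ln_powr_sums[OF s]] by (simp del: of_nat_Suc)
  then have "(g has_field_derivative (- lser s * zt s)) (at s)"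
    using g(3)[of s] s by simp
  then show ?thesis
    by (rule has_field_derivative_transform_within_open[OF _ op]) (use s eq in auto)
qed

lemma Re_of_nat_powr:
  assumes "n > 0"
  shows "Re (of_nat n powr (-s)) = real n powr (- Re s) * cos (Im s * ln (real n))"
proof -
  have "Ln (of_nat n) = of_real (ln (real n))"
    using Ln_of_real[of "real n"] assms by simp
  then have "of_nat n powr (-s) = exp (-s * of_real (ln (real n)))"
    using assms by (simp add: powr_def)
  then show ?thesis using assms by (simp add: Re_exp powr_def)
qed

lemma lser_341:
  assumes "\<sigma> > 1"
  shows "Re (3 * lser (of_real \<sigma>) + 4 * lser (of_real \<sigma> + \<i> * of_real t) + lser (of_real \<sigma> + 2 * \<i> * of_real t)) \<ge> 0"
proof -
  define u where "u = (\<lambda>(s::complex) n. mangoldt (Suc n) * of_nat (Suc n) powr (-s))"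
  have sm: "u (of_real \<sigma>) sums lser (of_real \<sigma>)"
    "u (of_real \<sigma> + \<i> * of_real t) sums lser (of_real \<sigma> + \<i> * of_real t)"
    "u (of_real \<sigma> + 2 * \<i> * of_real t) sums lser (of_real \<sigma> + 2 * \<i> * of_real t)"
    unfolding u_def by (rule lser_sums, use assms in simp)+
  have "(\<lambda>n. 3 * u (of_real \<sigma>) n + 4 * u (of_real \<sigma> + \<i> * of_real t) n + u (of_real \<sigma> + 2 * \<i> * of_real t) n) sums
     (3 * lser (of_real \<sigma>) + 4 * lser (of_real \<sigma> + \<i> * of_real t) + lser (of_real \<sigma> + 2 * \<i> * of_real t))"
    by (intro sums_add sums_mult sm)
  then have "(\<lambda>n. Re (3 * u (of_real \<sigma>) n + 4 * u (of_real \<sigma> + \<i> * of_real t) n + u (of_real \<sigma> + 2 * \<i> * of_real t) n)) sums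
     Re (3 * lser (of_real \<sigma>) + 4 * lser (of_real \<sigma> + \<i> * of_real t) + lser (of_real \<sigma> + 2 * \<i> * of_real t))"
    by (rule sums_Re)
  moreover have "Re (3 * u (of_real \<sigma>) n + 4 * u (of_real \<sigma> + \<i> * of_real t) n + u (of_real \<sigma> + 2 * \<i> * of_real t) n) \<ge> 0" for n
  proof -
    define \<theta> where "\<theta> = t * ln (real (Suc n))"
    have u: "Re (u s n) = mangoldt (Suc n) * (real (Suc n) powr (- Re s) * cos (Im s * ln (real (Suc n))))" for s
      unfolding u_def using Re_of_nat_powr[of "Suc n" s] by (simp del: of_nat_Suc)
    have "Re (3 * u (of_real \<sigma>) n + 4 * u (of_real \<sigma> + \<i> * of_real t) n + u (of_real \<sigma> + 2 * \<i> * of_real t) n)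
       = mangoldt (Suc n) * real (Suc n) powr (- \<sigma>) * (3 + 4 * cos \<theta> + cos (2 * \<theta>))"
      by (simp add: u \<theta>_def algebra_simps)
    also have "3 + 4 * cos \<theta> + cos (2 * \<theta>) = 2 * (1 + cos \<theta>)\<^sup>2"
      using cos_double_cos[of \<theta>] by (simp add: power2_eq_square algebra_simps)
    finally show ?thesis by (simp add: mangoldt_nonneg)
  qed
  ultimately show ?thesis by (rule sums_le[OF _ sums_zero, rotated]) 
qed

text \<open>An anchor to which the 3-4-1 product can be compared. For \<open>n \<ge> 2\<close> a
  term is at most half of \<open>1 / n\<^sup>2\<close>, so the terms after the first sum to at most
  \<open>(pi\<^sup>2 / 6 - 1) / 2\<close>, which \<open>pi < 4\<close> bounds by 5/6.\<close>

lemma zt_3_lower: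
  assumes "Re s \<ge> 3"
  shows "cmod (zt s) \<ge> 1/6"
proof -
  have "(\<lambda>n. of_nat (Suc n) powr (-s)) sums zt s"
    using zeta_sums[of s] assms by (simp add: zt_def)
  then have 1: "(\<lambda>n. of_nat (Suc (Suc n)) powr (-s)) sums (zt s - 1)"
    by (subst sums_Suc_iff) simp
  have 2: "(\<lambda>n. 1 / real (Suc (Suc n)) ^ 2) sums (pi\<^sup>2 / 6 - 1)"
    using inverse_squares_sums by (subst sums_Suc_iff) (simp add: add.commute)
  have le: "cmod (of_nat (Suc (Suc n)) powr (-s)) \<le> (1/2) * (1 / real (Suc (Suc n)) ^ 2)" for n
  proof -
    have "cmod (of_nat (Suc (Suc n)) powr (-s)) = real (Suc (Suc n)) powr (- Re s)"
      by (subst norm_of_nat_powr) auto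
    also have "\<dots> \<le> real (Suc (Suc n)) powr (-3)"
      using assms by (intro powr_mono) auto
    also have "\<dots> = 1 / real (Suc (Suc n)) ^ 3"
      by (subst powr_minus_divide) (simp add: powr_numeral)
    also have "\<dots> = (1 / real (Suc (Suc n))) * (1 / real (Suc (Suc n)) ^ 2)"
      by (simp add: power_numeral_reduce)
    also have "\<dots> \<le> (1/2) * (1 / real (Suc (Suc n)) ^ 2)"
      by (intro mult_right_mono) (auto simp: field_simps)
    finally show ?thesis .
  qed
  have "cmod (zt s - 1) \<le> (1/2) * (pi\<^sup>2 / 6 - 1)"
    using norm_sums_le[OF 1 sums_mult[OF 2, of "1/2"] le] .
  moreover have "pi\<^sup>2 \<le> 4\<^sup>2" using pi_less_4 pi_gt_zero by (intro power_mono) auto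
  ultimately have "cmod (zt s - 1) \<le> 5/6" by simp
  then show ?thesis using norm_triangle_ineq2[of 1 "1 - zt s"] by (simp add: norm_minus_commute)
qed

lemma has_field_derivative_341:
  fixes f g h :: "complex \<Rightarrow> complex"
  assumes "(f has_field_derivative - a * f w) (at w)" "(g has_field_derivative - b * g w) (at w)"
    "(h has_field_derivative - c * h w) (at w)"
  shows "((\<lambda>w. f w ^ 3 * g w ^ 4 * h w) has_field_derivative - (3 * a + 4 * b + c) * (f w ^ 3 * g w ^ 4 * h w)) (at w)"
proof -
  have "((\<lambda>w. f w ^ 3 * g w ^ 4 * h w) has_field_derivative
    (3 * f w ^ 2 * (- a * f w) * g w ^ 4 + 4 * g w ^ 3 * (- b * g w) * f w ^ 3) * h w + - c * h w * (f w ^ 3 * g w ^ 4)) (at w)"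
    by (rule derivative_eq_intros assms refl)+ simp
  also have "(3 * f w ^ 2 * (- a * f w) * g w ^ 4 + 4 * g w ^ 3 * (- b * g w) * f w ^ 3) * h w + - c * h w * (f w ^ 3 * g w ^ 4)
     = - (3 * a + 4 * b + c) * (f w ^ 3 * g w ^ 4 * h w)"
    by algebra
  finally show ?thesis .
qed

text \<open>No logarithm of zeta is taken. The product \<open>P\<close> satisfies
  \<open>P' = - Q * P\<close>, where \<open>Re Q \<ge> 0\<close> on the real axis by
  \<open>lser_341\<close>; its squared modulus \<open>h\<close> has derivative
  \<open>- 2 * Re Q * h\<close> and so does not increase from \<sigma> to 3, even if
  \<open>P\<close> had zeros. Hence \<open>|P|\<close> at \<sigma> is at least its value at 3, where
  all eight factors are at least 1/6.\<close>

lemma zt_341: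
  assumes "\<sigma> > 1" "\<sigma> \<le> 3"
  shows "cmod (zt (of_real \<sigma>)) ^ 3 * cmod (zt (of_real \<sigma> + \<i> * of_real t)) ^ 4
          * cmod (zt (of_real \<sigma> + 2 * \<i> * of_real t)) \<ge> (1/6) ^ 8"
proof -
  define P where "P = (\<lambda>w. zt w ^ 3 * zt (w + \<i> * of_real t) ^ 4 * zt (w + 2 * \<i> * of_real t))"
  define Q where "Q = (\<lambda>w. 3 * lser w + 4 * lser (w + \<i> * of_real t) + lser (w + 2 * \<i> * of_real t))"
  have dz: "((\<lambda>w. zt (w + c)) has_field_derivative - lser (w + c) * zt (w + c)) (at w)" if "Re (w + c) > 1" for w c
    using DERIV_shift[of zt "- lser (w + c) * zt (w + c)" w c] zt_has_field_derivative[OF that] by simp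
  have dP: "(P has_field_derivative - Q w * P w) (at w)" if "Re w > 1" for w
    unfolding P_def Q_def
    by (rule has_field_derivative_341) (use that in \<open>auto intro!: zt_has_field_derivative[simplified] dz[simplified]\<close>)
  define h where "h = (\<lambda>x::real. (Re (P (of_real x)))\<^sup>2 + (Im (P (of_real x)))\<^sup>2)"
  have "h 3 \<le> h \<sigma>"
  proof (rule DERIV_nonpos_imp_nonincreasing[OF assms(2)])
    fix x assume "\<sigma> \<le> x" "x \<le> 3"
    then have x: "x > 1" using assms by simp
    have v: "((\<lambda>x. P (of_real x)) has_vector_derivative (- Q (of_real x) * P (of_real x))) (at x)"
      by (rule has_vector_derivative_real_field[OF dP]) (use x in simp)
    have r: "((\<lambda>x. Re (P (of_real x))) has_real_derivative Re (- Q (of_real x) * P (of_real x))) (at x)"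
      and i: "((\<lambda>x. Im (P (of_real x))) has_real_derivative Im (- Q (of_real x) * P (of_real x))) (at x)"
      using bounded_linear.has_vector_derivative[OF bounded_linear_Re v]
            bounded_linear.has_vector_derivative[OF bounded_linear_Im v]
      by (simp_all add: has_real_derivative_iff_has_vector_derivative)
    have "(h has_real_derivative (- 2 * Re (Q (of_real x)) * h x)) (at x)"
      unfolding h_def by (rule derivative_eq_intros r i refl)+ (simp add: power2_eq_square algebra_simps)
    moreover have "Re (Q (of_real x)) \<ge> 0" unfolding Q_def using lser_341[OF x] .
    then have "- 2 * Re (Q (of_real x)) * h x \<le> 0"
      by (simp add: h_def)
    ultimately show "\<exists>y. (h has_real_derivative y) (at x) \<and> y \<le> 0" by blast
  qed
  then have "cmod (P 3) \<le> cmod (P (of_real \<sigma>))"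
    unfolding h_def cmod_def by simp
  moreover have "cmod (P 3) = cmod (zt 3) ^ 3 * cmod (zt (3 + \<i> * of_real t)) ^ 4 * cmod (zt (3 + 2 * \<i> * of_real t))"
    by (simp add: P_def norm_mult norm_power)
  moreover have "\<dots> \<ge> (1/6) ^ 3 * (1/6) ^ 4 * (1/6)"
    by (intro mult_mono power_mono zt_3_lower) auto
  moreover have "(1/6) ^ 3 * (1/6) ^ 4 * (1/6) = (1/6 :: real) ^ 8" by (simp add: power_numeral_reduce)
  ultimately show ?thesis by (simp add: P_def norm_mult norm_power)
qed

section \<open>A zero-free region\<close>

text \<open>A zero with \<open>Re s < 3\<close> would make the middle factor of the 3-4-1 product
  vanish, against its positive lower bound.\<close>

lemma zreg_nonzero:
  assumes "Re s > 1"
  shows "zreg s \<noteq> 0"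
proof
  assume z: "zreg s = 0"
  show False
  proof (cases "Re s \<ge> 3")
    case True
    then show False using zt_3_lower[of s] z by (simp add: zt_def)
  next
    case False
    then have "(1/6) ^ 8 \<le> cmod (zt (of_real (Re s))) ^ 3 * cmod (zt (of_real (Re s) + \<i> * of_real (Im s))) ^ 4
        * cmod (zt (of_real (Re s) + 2 * \<i> * of_real (Im s)))"
      using assms by (intro zt_341) auto
    moreover have "zt (of_real (Re s) + \<i> * of_real (Im s)) = 0"
      using z by (simp add: zt_def complex_eq[symmetric])
    ultimately show False by simp
  qed
qed

lemma zreg_field_derivative: "s \<in> zdom \<Longrightarrow> (zreg has_field_derivative deriv zreg s) (at s)"
  using holomorphic_derivI[OF zreg_holomorphic open_zdom] by auto

lemma zreg_segment_bound:
  assumes "1 - 1/100 \<le> a" "a \<le> b" "b \<le> 3"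
    and "\<And>x. a \<le> x \<Longrightarrow> x \<le> b \<Longrightarrow> cmod (deriv zreg (Complex x t)) \<le> B"
  shows "cmod (zreg (Complex b t) - zreg (Complex a t)) \<le> B * (b - a)"
proof -
  have c: "of_real x + \<i> * of_real t = Complex x t" for x by (simp add: Complex_eq)
  have "cmod ((\<lambda>w. zreg (w + \<i> * of_real t)) (of_real b) - (\<lambda>w. zreg (w + \<i> * of_real t)) (of_real a)) \<le> B * (b - a)"
  proof (rule of_real_derivative_bound[where f' = "\<lambda>w. deriv zreg (w + \<i> * of_real t)"])
    fix x assume x: "a \<le> x" "x \<le> b"
    show "((\<lambda>w. zreg (w + \<i> * of_real t)) has_field_derivative deriv zreg (of_real x + \<i> * of_real t)) (at (of_real x))"
      using DERIV_shift[of zreg "deriv zreg (of_real x + \<i> * of_real t)" "of_real x" "\<i> * of_real t"]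
        zreg_field_derivative[of "of_real x + \<i> * of_real t"] x assms(1) by simp
    show "cmod (deriv zreg (of_real x + \<i> * of_real t)) \<le> B"
      using assms(4)[OF x] by (simp add: c)
  qed fact
  then show ?thesis by (simp add: c)
qed

text \<open>Combining the 3-4-1 inequality with the growth bound, at distance
  \<open>\<epsilon> (\<bar>t\<bar> + 2) powr (-1/4)\<close> to the right of the line \<open>Re s = 1\<close>, bounds \<open>zreg\<close> below by more
  than the derivative bound can destroy on the way to the left of the line.\<close>
lemma zreg_lower_right:
  assumes r: "r > 0" "r \<le> 1" and C: "C \<ge> 1"
    and gr: "\<And>s. Re s \<ge> 1 - 1/40 \<Longrightarrow> Re s \<le> 4 \<Longrightarrow> cmod (zreg s) \<le> C * (\<bar>Im s\<bar> + 2) powr (21/20)"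
  shows "\<exists>\<epsilon>>0. \<forall>e t. 0 < e \<longrightarrow> e \<le> \<epsilon> \<longrightarrow> r / 2 \<le> \<bar>t\<bar> \<longrightarrow>
     cmod (zreg (Complex (1 + e * (\<bar>t\<bar> + 2) powr (-1/4)) t)) \<ge> 4 * C * (e * (\<bar>t\<bar> + 2) powr (-1/4)) * (\<bar>t\<bar> + 2) powr (21/20)"
proof -
  define \<rho> where "\<rho> = r / 8"
  have \<rho>: "\<rho> > 0" using r by (simp add: \<rho>_def)
  \<comment> \<open>What remains of \<open>(1/6) ^ 8\<close> after inserting the bounds for the
    three factors: \<open>128 * C ^ 4\<close> is \<open>(4 * C) ^ 3 * (2 * C)\<close>, and the five
    powers of \<open>\<rho>\<close> come from dividing by \<open>s - 1\<close> in the fourth power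
    and in the last factor.\<close>
  define c1 where "c1 = (1/6) ^ 8 * \<rho> ^ 5 / (128 * C ^ 4)"
  have c1: "c1 > 0" using \<rho> C by (simp add: c1_def)
  define \<epsilon> where "\<epsilon> = min 1 (c1 / (256 * C ^ 4))"
  have "cmod (zreg (Complex (1 + e * (\<bar>t\<bar> + 2) powr (-1/4)) t)) \<ge> 4 * C * (e * (\<bar>t\<bar> + 2) powr (-1/4)) * (\<bar>t\<bar> + 2) powr (21/20)"
    if e: "0 < e" "e \<le> \<epsilon>" and t: "r / 2 \<le> \<bar>t\<bar>" for e t
  proof -
    define u where "u = \<bar>t\<bar> + 2"
    have u: "u \<ge> 2" by (simp add: u_def)
    define \<delta> where "\<delta> = e * u powr (-1/4)"
    have "u powr (-1/4) \<le> u powr 0" using u by (intro powr_mono) auto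
    then have "\<delta> \<le> e * 1" unfolding \<delta>_def using e u by (intro mult_left_mono) auto
    moreover have "0 < \<delta>" "e \<le> 1" using e u by (auto simp: \<delta>_def \<epsilon>_def)
    ultimately have \<delta>: "0 < \<delta>" "\<delta> \<le> 1" by linarith+
    \<comment> \<open>Away from the pole \<open>|s - 1|\<close> is at least a multiple of
      \<open>u\<close>, so passing from \<open>zreg\<close> to \<open>zt\<close> gains a full factor
      \<open>u\<close>.\<close>
    have tu: "\<bar>t\<bar> \<ge> \<rho> * u"
    proof -
      have "r * \<bar>t\<bar> \<le> 1 * \<bar>t\<bar>" using r by (intro mult_right_mono) auto
      then show ?thesis using t by (simp add: \<rho>_def u_def algebra_simps)
    qed
    have u_pos: "\<rho> * u > 0" using \<rho> u by simp
    define X where "X = cmod (zreg (Complex (1 + \<delta>) t))"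
    define a where "a = cmod (zt (of_real (1 + \<delta>)))"
    define b where "b = cmod (zt (of_real (1 + \<delta>) + \<i> * of_real t))"
    define c where "c = cmod (zt (of_real (1 + \<delta>) + 2 * \<i> * of_real t))"
    have abc: "(1/6) ^ 8 \<le> a ^ 3 * b ^ 4 * c"
      unfolding a_def b_def c_def using \<delta> by (intro zt_341) auto
    have a: "a \<le> 4 * C / \<delta>"
    proof -
      have "cmod (zreg (of_real (1 + \<delta>))) \<le> C * 2 powr (21/20)"
        using gr[of "of_real (1 + \<delta>)"] \<delta> by simp
      also have "(2::real) powr (21/20) \<le> 2 powr 2" by (intro powr_mono) auto
      finally have "cmod (zreg (of_real (1 + \<delta>))) \<le> C * 4" using C by simp
      then show ?thesis using \<delta> by (simp add: a_def zt_def norm_divide divide_right_mono mult.commute)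
    qed
    have b: "b \<le> X / (\<rho> * u)"
    proof -
      have "\<rho> * u \<le> cmod (of_real \<delta> + \<i> * of_real t)"
        using abs_Im_le_cmod[of "of_real \<delta> + \<i> * of_real t"] tu by simp
      moreover have "b = X / cmod (of_real \<delta> + \<i> * of_real t)"
        by (simp add: b_def X_def zt_def norm_divide Complex_eq)
      ultimately show ?thesis using u_pos by (auto intro!: divide_left_mono mult_pos_pos simp: X_def)
    qed
    have c: "c \<le> 2 * C * u powr (21/20) / (\<rho> * u)"
    proof -
      have "2 * (\<rho> * u) \<le> cmod (of_real \<delta> + 2 * \<i> * of_real t)"
        using abs_Im_le_cmod[of "of_real \<delta> + 2 * \<i> * of_real t"] tu by (simp add: abs_mult)
      moreover have c_eq: "c = cmod (zreg (of_real (1 + \<delta>) + 2 * \<i> * of_real t)) / cmod (of_real \<delta> + 2 * \<i> * of_real t)"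
        by (simp add: c_def zt_def norm_divide)
      moreover have "cmod (zreg (of_real (1 + \<delta>) + 2 * \<i> * of_real t)) \<le> C * (\<bar>2 * t\<bar> + 2) powr (21/20)"
        using gr[of "of_real (1 + \<delta>) + 2 * \<i> * of_real t"] \<delta> by simp
      moreover have "(\<bar>2 * t\<bar> + 2) powr (21/20) \<le> (2 * u) powr (21/20)"
        by (intro powr_mono2) (auto simp: u_def)
      moreover have "(2 * u) powr (21/20) = 2 powr (21/20) * u powr (21/20)" using u by (simp add: powr_mult)
      moreover have "(2::real) powr (21/20) \<le> 2 powr 2" by (intro powr_mono) auto
      then have "2 powr (21/20) * u powr (21/20) \<le> 4 * u powr (21/20)" by (intro mult_right_mono) auto
      ultimately have "cmod (zreg (of_real (1 + \<delta>) + 2 * \<i> * of_real t)) \<le> C * (4 * u powr (21/20))"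
        using C mult_left_mono[of _ _ C] by (smt (verit, best))
      then have "c \<le> C * (4 * u powr (21/20)) / (2 * (\<rho> * u))"
        unfolding c_eq by (rule frac_le[rotated]) (use \<open>2 * (\<rho> * u) \<le> _\<close> u_pos C in auto)
      then show ?thesis by simp
    qed
    note abc
    also have "a ^ 3 * b ^ 4 * c \<le> (4 * C / \<delta>) ^ 3 * (X / (\<rho> * u)) ^ 4 * (2 * C * u powr (21/20) / (\<rho> * u))"
    proof (intro mult_mono power_mono a b c)
      show "0 \<le> (4 * C / \<delta>) ^ 3" using C \<delta> by simp
      then show "0 \<le> (4 * C / \<delta>) ^ 3 * (X / (\<rho> * u)) ^ 4" by (intro mult_nonneg_nonneg) auto
    qed (auto simp: a_def b_def c_def)
    also have "\<dots> = 128 * C ^ 4 / (\<rho> ^ 5) * (X ^ 4 * (u powr (21/20) / u ^ 5) / \<delta> ^ 3)"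
      by (simp add: power_divide power_mult_distrib power_numeral_reduce divide_simps)
    also have "u powr (21/20) / u ^ 5 = u powr (21/20 - 5)"
      using u by (simp only: powr_diff) simp
    finally have "\<rho> ^ 5 / (128 * C ^ 4) * (1/6) ^ 8
        \<le> \<rho> ^ 5 / (128 * C ^ 4) * (128 * C ^ 4 / (\<rho> ^ 5) * (X ^ 4 * u powr (21/20 - 5) / \<delta> ^ 3))"
      using \<rho> C by (intro mult_left_mono) auto
    also have "\<dots> = X ^ 4 * u powr (21/20 - 5) / \<delta> ^ 3"
      using \<rho> C by simp
    finally have "c1 \<le> X ^ 4 * u powr (21/20 - 5) / \<delta> ^ 3"
      by (simp add: c1_def mult.commute)
    then have *: "c1 * \<delta> ^ 3 \<le> X ^ 4 * u powr (21/20 - 5)"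
      using \<delta> by (simp add: field_simps)
    have "256 * C ^ 4 * e \<le> c1"
      using e C by (simp add: \<epsilon>_def field_simps)
    have alg: "(4 * C * \<delta> * P) ^ 4 * W = 256 * C ^ 4 * \<delta> * \<delta> ^ 3 * (P ^ 4 * W)" for P W
      by algebra
    \<comment> \<open>The claim, raised to the fourth power. The exponents of \<open>u\<close> add
      up to \<open>84/20 + 21/20 - 5 = 1/4\<close>, and one of the four factors
      \<open>\<delta>\<close> supplies the \<open>u powr (-1/4)\<close> that cancels this. The width
      of the zero-free region is chosen for this cancellation, and \<epsilon> so that the remaining
      constant \<open>256 * C ^ 4 * e\<close> is at most \<open>c1\<close>.\<close>
    have "(4 * C * \<delta> * u powr (21/20)) ^ 4 * u powr (21/20 - 5)
       = 256 * C ^ 4 * \<delta> * \<delta> ^ 3 * ((u powr (21/20)) ^ 4 * u powr (21/20 - 5))"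
      by (rule alg)
    also have "(u powr (21/20)) ^ 4 = u powr (84/20)"
      using u by (simp add: powr_powr flip: powr_realpow)
    also have "u powr (84/20) * u powr (21/20 - 5) = u powr (1/4)"
      by (simp flip: powr_add)
    also have "256 * C ^ 4 * \<delta> * \<delta> ^ 3 * u powr (1/4) = 256 * C ^ 4 * e * \<delta> ^ 3 * (u powr (-1/4) * u powr (1/4))"
      by (simp add: \<delta>_def)
    also have "u powr (-1/4) * u powr (1/4) = 1" using u by (simp flip: powr_add)
    also have "256 * C ^ 4 * e * \<delta> ^ 3 * 1 \<le> c1 * \<delta> ^ 3"
      using \<open>256 * C ^ 4 * e \<le> c1\<close> \<delta> by simp
    also note *
    finally have "(4 * C * \<delta> * u powr (21/20)) ^ 4 \<le> X ^ 4"
      using u by simp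
    then have "4 * C * \<delta> * u powr (21/20) \<le> X"
      by (rule power_mono_iff[THEN iffD1, rotated -1]) (use C \<delta> in \<open>auto simp: X_def\<close>)
    then show ?thesis by (simp add: X_def u_def \<delta>_def)
  qed
  then show ?thesis using c1 C by (intro exI[of _ \<epsilon>]) (auto simp: \<epsilon>_def)
qed

text \<open>At \<open>1 + \<delta> + \<i>t\<close> the modulus of \<open>zreg\<close> is at least
  \<open>4 * D\<close>, where \<open>D\<close> is \<delta> times the derivative bound. Moving left
  to \<open>Re s \<ge> 1 - \<delta>\<close> covers at most \<open>2 * \<delta>\<close> and loses at
  most \<open>2 * D\<close>, so \<open>2 * D\<close> remains; dividing the derivative bound by
  \<open>D\<close> gives \<open>1 / \<delta>\<close>, whence the growth \<open>u powr (1/4)\<close>.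
  Near \<open>s = 1\<close> the 3-4-1 bound says nothing, and continuity with
  \<open>zreg 1 = 1\<close> takes its place.\<close>

lemma zero_free_region:
  "\<exists>\<epsilon>>0. \<exists>K>0. \<epsilon> \<le> 1/100 \<and> (\<forall>s. Re s \<ge> 1 - \<epsilon> * (\<bar>Im s\<bar> + 2) powr (-1/4) \<longrightarrow> zreg s \<noteq> 0 \<and>
     (Re s \<le> 1 \<longrightarrow> cmod (deriv zreg s / zreg s) \<le> K * (\<bar>Im s\<bar> + 2) powr (1/4)))"
proof -
  obtain C1 where C1: "C1 > 0" "\<And>s. Re s \<ge> 1 - 1/40 \<Longrightarrow> Re s \<le> 4 \<Longrightarrow> cmod (zreg s) \<le> C1 * (\<bar>Im s\<bar> + 2) powr (21/20)"
    using zreg_growth by blast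
  obtain C2 where C2: "C2 > 0" "\<And>s. Re s \<ge> 1 - 1/100 \<Longrightarrow> Re s \<le> 3 \<Longrightarrow> cmod (deriv zreg s) \<le> C2 * (\<bar>Im s\<bar> + 2) powr (21/20)"
    using zreg_deriv_growth by blast
  define C where "C = 1 + C1 + C2"
  have C: "C \<ge> 1" using C1 C2 by (simp add: C_def)
  have gr: "cmod (zreg s) \<le> C * (\<bar>Im s\<bar> + 2) powr (21/20)" if "Re s \<ge> 1 - 1/40" "Re s \<le> 4" for s
    using C1(2)[OF that] C2(1) by (smt (verit, best) C_def mult_right_mono powr_ge_zero)
  have dgr: "cmod (deriv zreg s) \<le> C * (\<bar>Im s\<bar> + 2) powr (21/20)" if "Re s \<ge> 1 - 1/100" "Re s \<le> 3" for s
    using C2(2)[OF that] C1(1) by (smt (verit, best) C_def mult_right_mono powr_ge_zero)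
  have "isCont zreg 1"
    using zreg_field_derivative[of 1] by (intro DERIV_isCont) auto
  then obtain r0 where r0: "r0 > 0" "\<And>s. dist s 1 < r0 \<Longrightarrow> dist (zreg s) (zreg 1) < 1/2"
    unfolding continuous_at_eps_delta by (metis half_gt_zero_iff zero_less_one)
  define r where "r = min r0 1"
  have r: "r > 0" "r \<le> 1" using r0 by (auto simp: r_def)
  have near1: "cmod (zreg s) \<ge> 1/2" if "cmod (s - 1) < r" for s
    using r0(2)[of s] that norm_triangle_ineq2[of 1 "1 - zreg s"] by (simp add: r_def dist_norm zreg_1 norm_minus_commute)
  obtain \<epsilon>0 where \<epsilon>0: "\<epsilon>0 > 0" "\<And>e t. 0 < e \<Longrightarrow> e \<le> \<epsilon>0 \<Longrightarrow> r / 2 \<le> \<bar>t\<bar> \<Longrightarrow>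
     cmod (zreg (Complex (1 + e * (\<bar>t\<bar> + 2) powr (-1/4)) t)) \<ge> 4 * C * (e * (\<bar>t\<bar> + 2) powr (-1/4)) * (\<bar>t\<bar> + 2) powr (21/20)"
    using zreg_lower_right[OF r C gr] by blast
  \<comment> \<open>At most \<open>r / 4\<close>, so that a point of the region with
    \<open>|Im s| < r / 2\<close> and \<open>Re s \<le> 1\<close> lies within \<open>r\<close> of 1;
    at most 1/100, so that the derivative bound applies.\<close>
  define \<epsilon> where "\<epsilon> = min \<epsilon>0 (min (1/100) (r/4))"
  have \<epsilon>: "\<epsilon> > 0" "\<epsilon> \<le> \<epsilon>0" "\<epsilon> \<le> 1/100" "\<epsilon> \<le> r/4" using \<epsilon>0 r by (auto simp: \<epsilon>_def)
  \<comment> \<open>\<open>1 / \<epsilon>\<close> serves the points away from 1, and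
    \<open>18 * C\<close> the points near 1, where the derivative is at most \<open>9 * C\<close>
    and \<open>zreg\<close> at least 1/2.\<close>
  define K where "K = 1 / \<epsilon> + 18 * C"
  have K: "K > 0" using \<epsilon> C by (simp add: K_def add_pos_pos)
  have "zreg s \<noteq> 0 \<and> (Re s \<le> 1 \<longrightarrow> cmod (deriv zreg s / zreg s) \<le> K * (\<bar>Im s\<bar> + 2) powr (1/4))"
    if s: "Re s \<ge> 1 - \<epsilon> * (\<bar>Im s\<bar> + 2) powr (-1/4)" for s
  proof (cases "Re s > 1")
    case True
    then show ?thesis using zreg_nonzero by auto
  next
    case False
    define u where "u = \<bar>Im s\<bar> + 2"
    have u: "u \<ge> 2" by (simp add: u_def)
    define \<delta> where "\<delta> = \<epsilon> * u powr (-1/4)"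
    have "u powr (-1/4) \<le> u powr 0" using u by (intro powr_mono) auto
    then have "\<delta> \<le> \<epsilon> * 1" unfolding \<delta>_def using \<epsilon> u by (intro mult_left_mono) auto
    moreover have "0 < \<delta>" using \<epsilon> u by (simp add: \<delta>_def)
    ultimately have \<delta>: "0 < \<delta>" "\<delta> \<le> 1/100" "\<delta> \<le> r / 4" using \<epsilon> by linarith+
    have s': "Re s \<ge> 1 - \<delta>" using s by (simp add: \<delta>_def u_def)
    have u4: "u powr (1/4) \<ge> 1" using u by (intro ge_one_powr_ge_zero) auto
    have dg: "cmod (deriv zreg s) \<le> C * u powr (21/20)"
      using dgr[of s] s' False \<delta> by (simp add: u_def)
    show ?thesis
    proof (cases "\<bar>Im s\<bar> < r / 2")
      case True
      have "cmod (s - 1) \<le> \<bar>Re s - 1\<bar> + \<bar>Im s\<bar>" using cmod_le[of "s - 1"] by simp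
      also have "\<dots> < r" using True s' \<delta> False by linarith
      finally have half: "cmod (zreg s) \<ge> 1/2" by (rule near1)
      have "u powr (21/20) \<le> 3 powr (21/20)" using True r by (intro powr_mono2) (auto simp: u_def)
      also have "\<dots> \<le> (3::real) powr 2" by (intro powr_mono) auto
      finally have "u powr (21/20) \<le> 9" by simp
      then have "C * u powr (21/20) \<le> C * 9" using C by (intro mult_left_mono) auto
      with dg have "cmod (deriv zreg s) \<le> 9 * C" by simp
      then have "cmod (deriv zreg s / zreg s) \<le> (9 * C) / (1/2)"
        unfolding norm_divide using half C by (intro frac_le) auto
      also have "\<dots> \<le> K * 1" using \<epsilon> by (simp add: K_def)
      also have "\<dots> \<le> K * u powr (1/4)" using u4 K by (intro mult_left_mono) auto
      finally show ?thesis using half by (auto simp: u_def)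
    next
      case False': False
      define D where "D = \<delta> * (C * u powr (21/20))"
      have D: "D > 0" using \<delta> C u by (simp add: D_def)
      have "4 * D \<le> cmod (zreg (Complex (1 + \<delta>) (Im s)))"
        using \<epsilon>0(2)[of \<epsilon> "Im s"] False' \<epsilon> by (simp add: D_def \<delta>_def u_def mult_ac)
      moreover have "cmod (zreg (Complex (1 + \<delta>) (Im s)) - zreg (Complex (Re s) (Im s))) \<le> (C * u powr (21/20)) * (1 + \<delta> - Re s)"
      proof (rule zreg_segment_bound)
        fix x assume "Re s \<le> x" "x \<le> 1 + \<delta>"
        then show "cmod (deriv zreg (Complex x (Im s))) \<le> C * u powr (21/20)"
          using dgr[of "Complex x (Im s)"] s' \<delta> by (simp add: u_def)
      qed (use s' \<delta> False in auto)
      moreover have "(C * u powr (21/20)) * (1 + \<delta> - Re s) \<le> (C * u powr (21/20)) * (2 * \<delta>)"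
        using s' C by (intro mult_left_mono) auto
      ultimately have low: "2 * D \<le> cmod (zreg s)"
        using norm_triangle_ineq2[of "zreg (Complex (1 + \<delta>) (Im s))" "zreg (Complex (1 + \<delta>) (Im s)) - zreg s"]
        by (simp add: D_def mult_ac)
      have "cmod (deriv zreg s / zreg s) \<le> (C * u powr (21/20)) / D"
        unfolding norm_divide using low dg D C by (intro frac_le) auto
      also have "\<dots> = 1 / \<delta>" using C u by (simp add: D_def)
      also have "\<dots> = 1 / \<epsilon> * u powr (1/4)" by (simp add: \<delta>_def powr_minus_divide)
      also have "\<dots> \<le> K * u powr (1/4)" using C by (intro mult_right_mono) (auto simp: K_def)
      finally show ?thesis using low D by (auto simp: u_def)
    qed
  qed
  then show ?thesis using \<epsilon> K by blast
qed

section \<open>A quantitative form of Newman's contour argument\<close>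

abbreviation seg_integral :: "complex \<Rightarrow> complex \<Rightarrow> (complex \<Rightarrow> complex) \<Rightarrow> complex" where
  "seg_integral a b f \<equiv> contour_integral (linepath a b) f"

lemma horizontal_segment: 
  "z \<in> closed_segment (Complex a y) (Complex b y) \<longleftrightarrow> Im z = y \<and> min a b \<le> Re z \<and> Re z \<le> max a b"
  by (auto simp: closed_segment_same_Im closed_segment_eq_real_ivl)

lemma vertical_segment: 
  "z \<in> closed_segment (Complex x a) (Complex x b) \<longleftrightarrow> Re z = x \<and> min a b \<le> Im z \<and> Im z \<le> max a b"
  by (auto simp: closed_segment_same_Re closed_segment_eq_real_ivl)

text \<open>Cauchy's formula at 0 with the horizontal sides cut at the imaginary axis, because the
  two halves are estimated differently. It is used with two values of \<open>A\<close>, and the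
  three segments in the right half-plane are common to both.\<close>

lemma Cauchy_rectangle_0:
  assumes S: "open S" "convex S" and f: "f holomorphic_on S"
    and A: "A > 0" "R > 0" and sub: "cbox (Complex (-A) (-R)) (Complex R R) \<subseteq> S"
  defines "h \<equiv> (\<lambda>z. f z / z)"
  shows "continuous_on (cbox (Complex (-A) (-R)) (Complex R R) - {0}) h"
    and "2 * of_real pi * \<i> * f 0 =
      seg_integral (Complex (-A) (-R)) (Complex 0 (-R)) h + seg_integral (Complex 0 (-R)) (Complex R (-R)) h
      + seg_integral (Complex R (-R)) (Complex R R) h + seg_integral (Complex R R) (Complex 0 R) h
      + seg_integral (Complex 0 R) (Complex (-A) R) h + seg_integral (Complex (-A) R) (Complex (-A) (-R)) h"
proof -
  let ?B = "cbox (Complex (-A) (-R)) (Complex R R)"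
  show cont: "continuous_on (?B - {0}) h"
    unfolding h_def by (intro continuous_intros continuous_on_subset[OF holomorphic_on_imp_continuous_on[OF f]]) (use sub in auto)
  have c: "continuous_on (closed_segment a b) h" if "closed_segment a b \<subseteq> ?B - {0}" for a b
    by (rule continuous_on_subset[OF cont that])
  let ?a = "Complex (-A) (-R)" and ?p = "Complex 0 (-R)" and ?q = "Complex R (-R)"
    and ?r = "Complex R R" and ?s = "Complex 0 R" and ?b = "Complex (-A) R"
  have cs: "continuous_on (closed_segment ?a ?q) h" "continuous_on (closed_segment ?q ?r) h" 
      "continuous_on (closed_segment ?r ?b) h" "continuous_on (closed_segment ?b ?a) h"
    by (rule c; use A in \<open>auto simp: horizontal_segment vertical_segment in_cbox_complex_iff\<close>)+
  have "(h has_contour_integral (2 * of_real pi * \<i> * winding_number (rectpath ?a ?r) 0 * f 0)) (rectpath ?a ?r)"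
  proof -
    have "((\<lambda>w. f w / (w - 0)) has_contour_integral (2 * pi * \<i> * winding_number (rectpath ?a ?r) 0 * f 0)) (rectpath ?a ?r)"
    proof (rule Cauchy_integral_formula_convex_simple[OF S(2) f])
      show "0 \<in> interior S"
        using sub A by (auto simp: interior_open[OF S(1)] in_cbox_complex_iff subset_iff)
      have "path_image (rectpath ?a ?r) = ?B - box ?a ?r"
        using A by (intro path_image_rectpath_cbox_minus_box) auto
      then show "path_image (rectpath ?a ?r) \<subseteq> S - {0}"
        using sub A by (auto simp: in_box_complex_iff)
    qed auto
    then show ?thesis by (simp add: h_def)
  qed
  moreover have "winding_number (rectpath ?a ?r) 0 = 1"
    using A by (intro winding_number_rectpath) (auto simp: in_box_complex_iff)
  ultimately have "2 * of_real pi * \<i> * f 0 = contour_integral (rectpath ?a ?r) h"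
    using contour_integral_unique by fastforce
  also have "\<dots> = seg_integral ?a ?q h + seg_integral ?q ?r h + seg_integral ?r ?b h + seg_integral ?b ?a h"
    unfolding rectpath_def Let_def using cs by (simp add: contour_integrable_continuous_linepath)
  also have "seg_integral ?a ?q h = seg_integral ?a ?p h + seg_integral ?p ?q h"
    by (rule contour_integral_split_linepath[OF cs(1)]) (use A in \<open>auto simp: horizontal_segment\<close>)
  also have "seg_integral ?r ?b h = seg_integral ?r ?s h + seg_integral ?s ?b h"
    by (rule contour_integral_split_linepath[OF cs(3)]) (use A in \<open>auto simp: horizontal_segment\<close>)
  finally show "2 * of_real pi * \<i> * f 0 = seg_integral ?a ?p h + seg_integral ?p ?q h
      + seg_integral ?q ?r h + seg_integral ?r ?s h + seg_integral ?s ?b h + seg_integral ?b ?a h"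
    by (simp add: add_ac)
qed

definition newman_kernel :: "real \<Rightarrow> real \<Rightarrow> complex \<Rightarrow> complex" where
  "newman_kernel U R z = exp (of_real U * z) * (1 + z\<^sup>2 / of_real (R\<^sup>2))"

text \<open>The kernel vanishes at the points \<open>\<plusminus>\<i>R\<close>, which compensates the blow-up of
  \<open>G - F\<close> and \<open>F\<close> near the imaginary axis.\<close>
lemma newman_kernel_horizontal:
  assumes R: "R > 0" and z: "\<bar>Im z\<bar> = R" "\<bar>Re z\<bar> \<le> R"
  shows "cmod (newman_kernel U R z / z) \<le> exp (U * Re z) * (3 * \<bar>Re z\<bar> / R\<^sup>2)"
proof -
  have I2: "(Im z)\<^sup>2 = R\<^sup>2" using z(1) by (metis power2_abs)
  have "of_real (R\<^sup>2) + z\<^sup>2 = of_real (Re z) * (of_real (Re z) + 2 * \<i> * of_real (Im z))"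
    unfolding I2[symmetric] by (simp add: complex_eq_iff power2_eq_square)
  then have "cmod (of_real (R\<^sup>2) + z\<^sup>2) = \<bar>Re z\<bar> * cmod (of_real (Re z) + 2 * \<i> * of_real (Im z))"
    by (simp add: norm_mult)
  also have "cmod (of_real (Re z) + 2 * \<i> * of_real (Im z)) \<le> \<bar>Re z\<bar> + 2 * R"
    by (rule order.trans[OF norm_triangle_ineq]) (simp add: norm_mult z(1))
  also have "\<dots> \<le> 3 * R" using z by simp
  finally have num: "cmod (of_real (R\<^sup>2) + z\<^sup>2) \<le> \<bar>Re z\<bar> * (3 * R)" by (simp add: mult_left_mono)
  have "1 + z\<^sup>2 / of_real (R\<^sup>2) = (of_real (R\<^sup>2) + z\<^sup>2) / of_real (R\<^sup>2)"
    using R by (simp add: field_simps)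
  then have "cmod (newman_kernel U R z / z) = exp (U * Re z) * (cmod (of_real (R\<^sup>2) + z\<^sup>2) / R\<^sup>2 / cmod z)"
    by (simp add: newman_kernel_def norm_mult norm_divide norm_power)
  also have "cmod (of_real (R\<^sup>2) + z\<^sup>2) / R\<^sup>2 / cmod z \<le> \<bar>Re z\<bar> * (3 * R) / R\<^sup>2 / R"
    using num R z abs_Im_le_cmod[of z] by (intro frac_le divide_right_mono) auto
  also have "\<dots> = 3 * \<bar>Re z\<bar> / R\<^sup>2" using R by (simp add: field_simps)
  finally show ?thesis by simp
qed

lemma newman_kernel_vertical:
  assumes R: "R > 0" and z: "\<bar>Im z\<bar> \<le> R" "\<bar>Re z\<bar> \<le> R" "Re z \<noteq> 0"
  shows "cmod (newman_kernel U R z / z) \<le> exp (U * Re z) * (3 / \<bar>Re z\<bar>)"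
proof -
  have "(cmod z)\<^sup>2 = (Re z)\<^sup>2 + (Im z)\<^sup>2" by (simp add: cmod_power2)
  also have "\<dots> \<le> R\<^sup>2 + R\<^sup>2" using z R by (intro add_mono abs_le_square_iff[THEN iffD1]) auto
  finally have "(cmod z)\<^sup>2 / R\<^sup>2 \<le> 2" using R by (simp add: field_simps)
  then have "cmod (1 + z\<^sup>2 / of_real (R\<^sup>2)) \<le> 3"
    by (intro order.trans[OF norm_triangle_ineq]) (simp add: norm_divide norm_power)
  then have "cmod (1 + z\<^sup>2 / of_real (R\<^sup>2)) / cmod z \<le> 3 / \<bar>Re z\<bar>"
    using z abs_Re_le_cmod[of z] by (intro frac_le) auto
  then have "exp (U * Re z) * (cmod (1 + z\<^sup>2 / of_real (R\<^sup>2)) / cmod z) \<le> exp (U * Re z) * (3 / \<bar>Re z\<bar>)"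
    by (rule mult_left_mono) simp
  then show ?thesis by (simp add: newman_kernel_def norm_mult norm_divide)
qed

text \<open>\<open>F\<close> is entire, so its rectangle may extend to \<open>-R\<close>, whereas
  that of \<open>G\<close> stops at \<open>-\<delta>\<close>. On the common right half only
  \<open>G - F\<close> enters. There, and for \<open>F\<close> on the left, the kernel cancels the
  factor \<open>exp (- U * Re z)\<close>, leaving the integrand at most
  \<open>3 * B / R\<^sup>2\<close> on a path of length \<open>4 * R\<close>, hence
  \<open>12 * B / R\<close> each time. The integral of \<open>G\<close> on the left gives the terms
  with \<open>K\<close>. Division by \<open>2 * pi \<ge> 6\<close> yields the stated
  constants.\<close>

lemma newman_contour_bound:
  fixes G F :: "complex \<Rightarrow> complex" and R U B K \<delta> :: real
  assumes S: "open S" "convex S" and G: "G holomorphic_on S" and F: "F holomorphic_on UNIV"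
    and sub: "cbox (Complex (-\<delta>) (-R)) (Complex R R) \<subseteq> S"
    and R: "R \<ge> 1" and \<delta>: "0 < \<delta>" "\<delta> \<le> 1" and B: "B \<ge> 0" and K: "K \<ge> 0" and U: "U \<ge> 0"
    and right: "\<And>z. Re z > 0 \<Longrightarrow> \<bar>Im z\<bar> \<le> R \<Longrightarrow> cmod (G z - F z) \<le> B * exp (- U * Re z) / Re z"
    and left: "\<And>z. Re z < 0 \<Longrightarrow> cmod (F z) \<le> B * exp (- U * Re z) / (- Re z)"
    and mid: "\<And>z. -\<delta> \<le> Re z \<Longrightarrow> Re z \<le> 0 \<Longrightarrow> \<bar>Im z\<bar> \<le> R \<Longrightarrow> cmod (G z) \<le> K"
  shows "cmod (G 0 - F 0) \<le> 4 * B / R + K * \<delta>\<^sup>2 / R\<^sup>2 + K * R * exp (- U * \<delta>) / \<delta>"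
proof -
  define k where "k = newman_kernel U R"
  have R0: "R > 0" using R by simp
  have k0: "k 0 = 1" by (simp add: k_def newman_kernel_def)
  have holk: "k holomorphic_on A" for A
    unfolding k_def newman_kernel_def by (intro holomorphic_intros) (use R0 in auto)
  define g where "g = (\<lambda>z. G z * k z / z)"
  define f where "f = (\<lambda>z. F z * k z / z)"
  let ?p = "Complex 0 (-R)" and ?q = "Complex R (-R)" and ?r = "Complex R R" and ?s = "Complex 0 R"
  let ?a = "Complex (-\<delta>) (-R)" and ?b = "Complex (-\<delta>) R" and ?c = "Complex (-R) (-R)" and ?d = "Complex (-R) R"
  have Gk: "(\<lambda>z. G z * k z) holomorphic_on S" and Fk: "(\<lambda>z. F z * k z) holomorphic_on UNIV"
    by (intro holomorphic_intros holk G F)+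
  note g = Cauchy_rectangle_0[OF S Gk \<delta>(1) R0 sub, folded g_def]
  note f = Cauchy_rectangle_0[OF open_UNIV convex_UNIV Fk R0 R0 subset_UNIV, folded f_def]
  have contg: "continuous_on (closed_segment x y) g" if "closed_segment x y \<subseteq> cbox ?a ?r - {0}" for x y
    by (rule continuous_on_subset[OF g(1) that])
  have contf: "continuous_on (closed_segment x y) f" if "closed_segment x y \<subseteq> cbox ?c ?r - {0}" for x y
    by (rule continuous_on_subset[OF f(1) that])
  have seg_bound: "cmod (seg_integral x y h) \<le> E" 
    if "continuous_on (closed_segment x y) h" "0 \<le> M" "\<And>z. z \<in> closed_segment x y \<Longrightarrow> cmod (h z) \<le> M"
       "cmod (y - x) = l" "M * l = E" for x y h M l E
    using contour_integral_bound_linepath[OF contour_integrable_continuous_linepath[OF that(1)] that(2,3)] that(4,5) by simp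
  have hor: "cmod (seg_integral (Complex a y) (Complex b y) h) \<le> E"
    if "continuous_on (closed_segment (Complex a y) (Complex b y)) h" "0 \<le> M"
       "\<And>z. Im z = y \<Longrightarrow> min a b \<le> Re z \<Longrightarrow> Re z \<le> max a b \<Longrightarrow> cmod (h z) \<le> M"
       "\<bar>b - a\<bar> = l" "M * l = E" for a b y h M l E
  proof (rule seg_bound[OF that(1,2) _ _ that(5)])
    show "cmod (Complex b y - Complex a y) = l" using that(4) by (simp add: cmod_def)
    fix z assume "z \<in> closed_segment (Complex a y) (Complex b y)"
    then show "cmod (h z) \<le> M" unfolding horizontal_segment using that(3) by blast
  qed
  have ver: "cmod (seg_integral (Complex x a) (Complex x b) h) \<le> E"
    if "continuous_on (closed_segment (Complex x a) (Complex x b)) h" "0 \<le> M"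
       "\<And>z. Re z = x \<Longrightarrow> min a b \<le> Im z \<Longrightarrow> Im z \<le> max a b \<Longrightarrow> cmod (h z) \<le> M"
       "\<bar>b - a\<bar> = l" "M * l = E" for a b x h M l E
  proof (rule seg_bound[OF that(1,2) _ _ that(5)])
    show "cmod (Complex x b - Complex x a) = l" using that(4) by (simp add: cmod_def)
    fix z assume "z \<in> closed_segment (Complex x a) (Complex x b)"
    then show "cmod (h z) \<le> M" unfolding vertical_segment using that(3) by blast
  qed
  note segs = horizontal_segment vertical_segment in_cbox_complex_iff
  have kh: "cmod (k z / z) \<le> exp (U * Re z) * (3 * \<bar>Re z\<bar> / R\<^sup>2)" if "\<bar>Im z\<bar> = R" "\<bar>Re z\<bar> \<le> R" for z
    unfolding k_def by (rule newman_kernel_horizontal[OF R0 that])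
  have kv: "cmod (k z / z) \<le> exp (U * Re z) * (3 / \<bar>Re z\<bar>)" if "\<bar>Im z\<bar> \<le> R" "\<bar>Re z\<bar> \<le> R" "Re z \<noteq> 0" for z
    unfolding k_def by (rule newman_kernel_vertical[OF R0 that])

  have right_h: "cmod (g z - f z) \<le> 3 * B / R\<^sup>2" if z: "\<bar>Im z\<bar> = R" "0 \<le> Re z" "Re z \<le> R" for z
  \<comment> \<open>On the axis the hypothesis \<open>right\<close> is silent, but \<open>z\<close>
    is then one of the two zeros of the kernel.\<close>
  proof (cases "Re z = 0")
    case True
    then have "k z / z = 0" using kh[of z] z R0 by simp
    then have "g z = 0" "f z = 0" by (auto simp: g_def f_def)
    then show ?thesis using B by simp
  next
    case False
    have "g z - f z = (G z - F z) * (k z / z)" by (simp add: g_def f_def diff_divide_distrib algebra_simps)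
    then have "cmod (g z - f z) = cmod (G z - F z) * cmod (k z / z)" by (simp only: norm_mult)
    also have "\<dots> \<le> (B * exp (- U * Re z) / Re z) * (exp (U * Re z) * (3 * \<bar>Re z\<bar> / R\<^sup>2))"
      using z False by (intro mult_mono right kh) (auto intro!: divide_nonneg_nonneg mult_nonneg_nonneg B)
    also have "\<dots> = (exp (- U * Re z) * exp (U * Re z)) * (3 * B / R\<^sup>2)"
      using z False by simp
    also have "exp (- U * Re z) * exp (U * Re z) = 1" by (simp flip: exp_add)
    finally show ?thesis by simp
  qed
  have right_v: "cmod (g z - f z) \<le> 3 * B / R\<^sup>2" if z: "\<bar>Im z\<bar> \<le> R" "Re z = R" for z
  proof -
    have "g z - f z = (G z - F z) * (k z / z)" by (simp add: g_def f_def diff_divide_distrib algebra_simps)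
    then have "cmod (g z - f z) = cmod (G z - F z) * cmod (k z / z)" by (simp only: norm_mult)
    also have "\<dots> \<le> (B * exp (- U * Re z) / Re z) * (exp (U * Re z) * (3 / \<bar>Re z\<bar>))"
      using z R0 by (intro mult_mono right kv) (auto intro!: divide_nonneg_nonneg mult_nonneg_nonneg B)
    also have "\<dots> = (exp (- U * Re z) * exp (U * Re z)) * (3 * B / R\<^sup>2)"
      using z R0 by (simp add: power2_eq_square)
    also have "exp (- U * Re z) * exp (U * Re z) = 1" by (simp flip: exp_add)
    finally show ?thesis by simp
  qed
  have left_h: "cmod (f z) \<le> 3 * B / R\<^sup>2" if z: "\<bar>Im z\<bar> = R" "-R \<le> Re z" "Re z \<le> 0" for z
  proof (cases "Re z = 0")
    case True
    then have "k z / z = 0" using kh[of z] z R0 by simp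
    then have "f z = 0" by (auto simp: f_def)
    then show ?thesis using B by simp
  next
    case False
    have "cmod (f z) = cmod (F z) * cmod (k z / z)" by (simp add: f_def norm_mult norm_divide)
    also have "\<dots> \<le> (B * exp (- U * Re z) / (- Re z)) * (exp (U * Re z) * (3 * \<bar>Re z\<bar> / R\<^sup>2))"
    proof (intro mult_mono left kh)
      show "0 \<le> B * exp (- U * Re z) / (- Re z)"
        using z False B by (intro divide_nonneg_nonneg) auto
    qed (use z False in auto)
    also have "\<dots> = (exp (- U * Re z) * exp (U * Re z)) * (3 * B / R\<^sup>2)"
      using z False by simp
    also have "exp (- U * Re z) * exp (U * Re z) = 1" by (simp flip: exp_add)
    finally show ?thesis by simp
  qed
  have left_v: "cmod (f z) \<le> 3 * B / R\<^sup>2" if z: "\<bar>Im z\<bar> \<le> R" "Re z = -R" for z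
  proof -
    have "cmod (f z) = cmod (F z) * cmod (k z / z)" by (simp add: f_def norm_mult norm_divide)
    also have "\<dots> \<le> (B * exp (- U * Re z) / (- Re z)) * (exp (U * Re z) * (3 / \<bar>Re z\<bar>))"
      using z R0 by (intro mult_mono left kv) (auto intro!: divide_nonneg_nonneg mult_nonneg_nonneg B)
    also have "\<dots> = (exp (- U * Re z) * exp (U * Re z)) * (3 * B / R\<^sup>2)"
      using z R0 by (simp add: power2_eq_square)
    also have "exp (- U * Re z) * exp (U * Re z) = 1" by (simp flip: exp_add)
    finally show ?thesis by simp
  qed
  have mid_h: "cmod (g z) \<le> 3 * K * \<delta> / R\<^sup>2" if z: "\<bar>Im z\<bar> = R" "-\<delta> \<le> Re z" "Re z \<le> 0" for z
  proof -
    have "\<bar>Re z\<bar> \<le> \<delta>" using z by linarith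
    have "cmod (k z / z) \<le> exp (U * Re z) * (3 * \<bar>Re z\<bar> / R\<^sup>2)"
      by (rule kh) (use z R \<delta> in linarith)+
    also have "\<dots> \<le> 1 * (3 * \<delta> / R\<^sup>2)"
    proof (rule mult_mono)
      show "exp (U * Re z) \<le> 1" using U z by (simp add: mult_nonneg_nonpos)
      show "3 * \<bar>Re z\<bar> / R\<^sup>2 \<le> 3 * \<delta> / R\<^sup>2"
        using \<open>\<bar>Re z\<bar> \<le> \<delta>\<close> by (intro divide_right_mono) auto
    qed auto
    finally have k: "cmod (k z / z) \<le> 3 * \<delta> / R\<^sup>2" by simp
    have "cmod (G z) \<le> K" by (rule mid) (use z in linarith)+
    then have "cmod (G z) * cmod (k z / z) \<le> K * (3 * \<delta> / R\<^sup>2)"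
      using k K by (intro mult_mono) simp_all
    then show ?thesis by (simp add: g_def norm_mult norm_divide mult_ac)
  qed
  have mid_v: "cmod (g z) \<le> 3 * K * exp (- U * \<delta>) / \<delta>" if z: "\<bar>Im z\<bar> \<le> R" "Re z = -\<delta>" for z
  proof -
    have "cmod (k z / z) \<le> exp (U * Re z) * (3 / \<bar>Re z\<bar>)"
      by (rule kv) (use z R \<delta> in linarith)+
    then have k: "cmod (k z / z) \<le> exp (- U * \<delta>) * (3 / \<delta>)"
      using z \<delta> by simp
    have "cmod (G z) \<le> K" by (rule mid) (use z \<delta> in linarith)+
    then have "cmod (G z) * cmod (k z / z) \<le> K * (exp (- U * \<delta>) * (3 / \<delta>))"
      using k K by (intro mult_mono) simp_all
    then show ?thesis by (simp add: g_def norm_mult norm_divide mult_ac)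
  qed

  have i1: "cmod (seg_integral ?p ?q (\<lambda>z. g z - f z)) \<le> 3 * (B / R)"
  proof (rule hor[where M = "3 * B / R\<^sup>2" and l = "R"])
    fix z assume "Im z = (-R)" "min 0 R \<le> Re z" "Re z \<le> max 0 R"
    then show "cmod (g z - f z) \<le> 3 * B / R\<^sup>2"
      using R0 \<delta> by (intro right_h) auto
  next
    show "continuous_on (closed_segment ?p ?q) (\<lambda>z. g z - f z)"
      by (rule continuous_on_diff[OF contg contf]; use R0 \<delta> in \<open>auto simp: segs\<close>)
    show "0 \<le> 3 * B / R\<^sup>2" using R0 B K \<delta> by simp
    show "\<bar>R - (0)\<bar> = R" using R0 \<delta> by simp
    show "3 * B / R\<^sup>2 * (R) = 3 * (B / R)" using R0 \<delta> by (simp add: power2_eq_square)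
  qed
  have i2: "cmod (seg_integral ?q ?r (\<lambda>z. g z - f z)) \<le> 6 * (B / R)"
  proof (rule ver[where M = "3 * B / R\<^sup>2" and l = "2 * R"])
    fix z assume "Re z = R" "min (-R) R \<le> Im z" "Im z \<le> max (-R) R"
    then show "cmod (g z - f z) \<le> 3 * B / R\<^sup>2"
      using R0 \<delta> by (intro right_v) auto
  next
    show "continuous_on (closed_segment ?q ?r) (\<lambda>z. g z - f z)"
      by (rule continuous_on_diff[OF contg contf]; use R0 \<delta> in \<open>auto simp: segs\<close>)
    show "0 \<le> 3 * B / R\<^sup>2" using R0 B K \<delta> by simp
    show "\<bar>R - (-R)\<bar> = 2 * R" using R0 \<delta> by simp
    show "3 * B / R\<^sup>2 * (2 * R) = 6 * (B / R)" using R0 \<delta> by (simp add: power2_eq_square)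
  qed
  have i3: "cmod (seg_integral ?r ?s (\<lambda>z. g z - f z)) \<le> 3 * (B / R)"
  proof (rule hor[where M = "3 * B / R\<^sup>2" and l = "R"])
    fix z assume "Im z = R" "min R 0 \<le> Re z" "Re z \<le> max R 0"
    then show "cmod (g z - f z) \<le> 3 * B / R\<^sup>2"
      using R0 \<delta> by (intro right_h) auto
  next
    show "continuous_on (closed_segment ?r ?s) (\<lambda>z. g z - f z)"
      by (rule continuous_on_diff[OF contg contf]; use R0 \<delta> in \<open>auto simp: segs\<close>)
    show "0 \<le> 3 * B / R\<^sup>2" using R0 B K \<delta> by simp
    show "\<bar>0 - (R)\<bar> = R" using R0 \<delta> by simp
    show "3 * B / R\<^sup>2 * (R) = 3 * (B / R)" using R0 \<delta> by (simp add: power2_eq_square)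
  qed
  have j1: "cmod (seg_integral ?c ?p f) \<le> 3 * (B / R)"
  proof (rule hor[where M = "3 * B / R\<^sup>2" and l = "R"])
    fix z assume "Im z = (-R)" "min (-R) 0 \<le> Re z" "Re z \<le> max (-R) 0"
    then show "cmod (f z) \<le> 3 * B / R\<^sup>2"
      using R0 \<delta> by (intro left_h) auto
  next
    show "continuous_on (closed_segment ?c ?p) f"
      by (rule contf; use R0 \<delta> in \<open>auto simp: segs\<close>)
    show "0 \<le> 3 * B / R\<^sup>2" using R0 B K \<delta> by simp
    show "\<bar>0 - (-R)\<bar> = R" using R0 \<delta> by simp
    show "3 * B / R\<^sup>2 * (R) = 3 * (B / R)" using R0 \<delta> by (simp add: power2_eq_square)
  qed
  have j2: "cmod (seg_integral ?s ?d f) \<le> 3 * (B / R)"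
  proof (rule hor[where M = "3 * B / R\<^sup>2" and l = "R"])
    fix z assume "Im z = R" "min 0 (-R) \<le> Re z" "Re z \<le> max 0 (-R)"
    then show "cmod (f z) \<le> 3 * B / R\<^sup>2"
      using R0 \<delta> by (intro left_h) auto
  next
    show "continuous_on (closed_segment ?s ?d) f"
      by (rule contf; use R0 \<delta> in \<open>auto simp: segs\<close>)
    show "0 \<le> 3 * B / R\<^sup>2" using R0 B K \<delta> by simp
    show "\<bar>-R - (0)\<bar> = R" using R0 \<delta> by simp
    show "3 * B / R\<^sup>2 * (R) = 3 * (B / R)" using R0 \<delta> by (simp add: power2_eq_square)
  qed
  have j3: "cmod (seg_integral ?d ?c f) \<le> 6 * (B / R)"
  proof (rule ver[where M = "3 * B / R\<^sup>2" and l = "2 * R"])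
    fix z assume "Re z = (-R)" "min R (-R) \<le> Im z" "Im z \<le> max R (-R)"
    then show "cmod (f z) \<le> 3 * B / R\<^sup>2"
      using R0 \<delta> by (intro left_v) auto
  next
    show "continuous_on (closed_segment ?d ?c) f"
      by (rule contf; use R0 \<delta> in \<open>auto simp: segs\<close>)
    show "0 \<le> 3 * B / R\<^sup>2" using R0 B K \<delta> by simp
    show "\<bar>-R - (R)\<bar> = 2 * R" using R0 \<delta> by simp
    show "3 * B / R\<^sup>2 * (2 * R) = 6 * (B / R)" using R0 \<delta> by (simp add: power2_eq_square)
  qed
  have k1: "cmod (seg_integral ?a ?p g) \<le> 3 * (K * \<delta>\<^sup>2 / R\<^sup>2)"
  proof (rule hor[where M = "3 * K * \<delta> / R\<^sup>2" and l = "\<delta>"])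
    fix z assume "Im z = (-R)" "min (-\<delta>) 0 \<le> Re z" "Re z \<le> max (-\<delta>) 0"
    then show "cmod (g z) \<le> 3 * K * \<delta> / R\<^sup>2"
      using R0 \<delta> by (intro mid_h) auto
  next
    show "continuous_on (closed_segment ?a ?p) g"
      by (rule contg; use R0 \<delta> in \<open>auto simp: segs\<close>)
    show "0 \<le> 3 * K * \<delta> / R\<^sup>2" using R0 B K \<delta> by simp
    show "\<bar>0 - (-\<delta>)\<bar> = \<delta>" using R0 \<delta> by simp
    show "3 * K * \<delta> / R\<^sup>2 * (\<delta>) = 3 * (K * \<delta>\<^sup>2 / R\<^sup>2)" using R0 \<delta> by (simp add: power2_eq_square)
  qed
  have k2: "cmod (seg_integral ?s ?b g) \<le> 3 * (K * \<delta>\<^sup>2 / R\<^sup>2)"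
  proof (rule hor[where M = "3 * K * \<delta> / R\<^sup>2" and l = "\<delta>"])
    fix z assume "Im z = R" "min 0 (-\<delta>) \<le> Re z" "Re z \<le> max 0 (-\<delta>)"
    then show "cmod (g z) \<le> 3 * K * \<delta> / R\<^sup>2"
      using R0 \<delta> by (intro mid_h) auto
  next
    show "continuous_on (closed_segment ?s ?b) g"
      by (rule contg; use R0 \<delta> in \<open>auto simp: segs\<close>)
    show "0 \<le> 3 * K * \<delta> / R\<^sup>2" using R0 B K \<delta> by simp
    show "\<bar>-\<delta> - (0)\<bar> = \<delta>" using R0 \<delta> by simp
    show "3 * K * \<delta> / R\<^sup>2 * (\<delta>) = 3 * (K * \<delta>\<^sup>2 / R\<^sup>2)" using R0 \<delta> by (simp add: power2_eq_square)
  qed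
  have k3: "cmod (seg_integral ?b ?a g) \<le> 6 * (K * R * exp (- U * \<delta>) / \<delta>)"
  proof (rule ver[where M = "3 * K * exp (- U * \<delta>) / \<delta>" and l = "2 * R"])
    fix z assume "Re z = (-\<delta>)" "min R (-R) \<le> Im z" "Im z \<le> max R (-R)"
    then show "cmod (g z) \<le> 3 * K * exp (- U * \<delta>) / \<delta>"
      using R0 \<delta> by (intro mid_v) auto
  next
    show "continuous_on (closed_segment ?b ?a) g"
      by (rule contg; use R0 \<delta> in \<open>auto simp: segs\<close>)
    show "0 \<le> 3 * K * exp (- U * \<delta>) / \<delta>" using R0 B K \<delta> by simp
    show "\<bar>-R - (R)\<bar> = 2 * R" using R0 \<delta> by simp
    show "3 * K * exp (- U * \<delta>) / \<delta> * (2 * R) = 6 * (K * R * exp (- U * \<delta>) / \<delta>)" using R0 \<delta> by (simp add: power2_eq_square)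
  qed

  have d: "seg_integral x y (\<lambda>z. g z - f z) = seg_integral x y g - seg_integral x y f"
    if "closed_segment x y \<subseteq> cbox ?a ?r - {0}" "closed_segment x y \<subseteq> cbox ?c ?r - {0}" for x y
    by (rule contour_integral_diff[OF contour_integrable_continuous_linepath[OF contg[OF that(1)]]
          contour_integrable_continuous_linepath[OF contf[OF that(2)]]])
  have d1: "seg_integral ?p ?q (\<lambda>z. g z - f z) = seg_integral ?p ?q g - seg_integral ?p ?q f"
    by (rule d; use R0 \<delta> in \<open>auto simp: segs\<close>)
  have d2: "seg_integral ?q ?r (\<lambda>z. g z - f z) = seg_integral ?q ?r g - seg_integral ?q ?r f"
    by (rule d; use R0 \<delta> in \<open>auto simp: segs\<close>)
  have d3: "seg_integral ?r ?s (\<lambda>z. g z - f z) = seg_integral ?r ?s g - seg_integral ?r ?s f"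
    by (rule d; use R0 \<delta> in \<open>auto simp: segs\<close>)
  note gG = g(2)[unfolded k0 mult_1_right] and fF = f(2)[unfolded k0 mult_1_right]
  have rearrange: "A1 + A2 + A3 + A4 + A5 + A6 - (B1 + A2' + A3' + A4' + B5 + B6)
      = (A2 - A2') + (A3 - A3') + (A4 - A4') + (A1 + A5 + A6) - (B1 + B5 + B6)"
    for A1 A2 A3 A4 A5 A6 B1 A2' A3' A4' B5 B6 :: complex
    by (simp only: diff_conv_add_uminus minus_add_distrib minus_minus add_ac)
  have nine: "cmod (x1 + x2 + x3 + (x4 + x5 + x6) - (x7 + x8 + x9)) \<le> E"
    if "cmod x1 \<le> 3 * X" "cmod x2 \<le> 6 * X" "cmod x3 \<le> 3 * X" "cmod x4 \<le> 3 * Y" "cmod x5 \<le> 3 * Y"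
      "cmod x6 \<le> 6 * Z" "cmod x7 \<le> 3 * X" "cmod x8 \<le> 3 * X" "cmod x9 \<le> 6 * X" "6 * (4 * X + Y + Z) \<le> E"
    for x1 x2 x3 x4 x5 x6 x7 x8 x9 X Y Z E
  proof -
    have tri: "cmod (x + y + z) \<le> cmod x + cmod y + cmod z" for x y z
      by (rule order.trans[OF norm_triangle_ineq add_right_mono[OF norm_triangle_ineq]])
    have "cmod (x1 + x2 + x3 + (x4 + x5 + x6) - (x7 + x8 + x9))
        \<le> cmod (x1 + x2 + x3) + cmod (x4 + x5 + x6) + cmod (x7 + x8 + x9)"
      by (rule order.trans[OF norm_triangle_ineq4 add_right_mono[OF norm_triangle_ineq]])
    moreover have "cmod (x1 + x2 + x3) \<le> 12 * X" using tri[of x1 x2 x3] that(1-3) by simp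
    moreover have "cmod (x4 + x5 + x6) \<le> 6 * Y + 6 * Z" using tri[of x4 x5 x6] that(4-6) by simp
    moreover have "cmod (x7 + x8 + x9) \<le> 12 * X" using tri[of x7 x8 x9] that(7-9) by simp
    ultimately show ?thesis using that(10) by argo
  qed
  have "2 * of_real pi * \<i> * (G 0 - F 0) = 2 * of_real pi * \<i> * G 0 - 2 * of_real pi * \<i> * F 0"
    by (rule right_diff_distrib)
  also note arg_cong2[where f = minus, OF gG fF]
  also note rearrange
  also note d1[symmetric]
  also note d2[symmetric]
  also note d3[symmetric]
  finally have "cmod (2 * of_real pi * \<i> * (G 0 - F 0)) \<le> 6 * (4 * B / R + K * \<delta>\<^sup>2 / R\<^sup>2 + K * R * exp (- U * \<delta>) / \<delta>)"
    by (simp only:) (rule nine[OF i1 i2 i3 k1 k2 k3 j1 j2 j3], simp)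
  then have "2 * pi * cmod (G 0 - F 0) \<le> 6 * (4 * B / R + K * \<delta>\<^sup>2 / R\<^sup>2 + K * R * exp (- U * \<delta>) / \<delta>)"
    by (simp only: norm_mult norm_of_real norm_ii norm_numeral abs_of_pos[OF pi_gt_zero] mult_1_right)
  moreover have "6 * cmod (G 0 - F 0) \<le> 2 * pi * cmod (G 0 - F 0)"
    using pi_gt3 by (intro mult_right_mono) auto
  ultimately have "6 * cmod (G 0 - F 0) \<le> 6 * (4 * B / R + K * \<delta>\<^sup>2 / R\<^sup>2 + K * R * exp (- U * \<delta>) / \<delta>)"
    by (rule order.trans[rotated])
  then show ?thesis by (simp only: mult_le_cancel_left_pos[OF zero_less_numeral])
qed

section \<open>The Chebyshev function and its Laplace transform\<close>

definition psi :: "nat \<Rightarrow> real" where "psi n = (\<Sum>k\<le>n. mangoldt k)"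

lemma psi_0 [simp]: "psi 0 = 0"
  by (simp add: psi_def)

lemma psi_Suc: "psi (Suc n) = psi n + mangoldt (Suc n)"
  by (simp add: psi_def)

lemma psi_nonneg: "psi n \<ge> 0"
  unfolding psi_def by (intro sum_nonneg mangoldt_nonneg)

lemma psi_mono: "m \<le> n \<Longrightarrow> psi m \<le> psi n"
  unfolding psi_def by (intro sum_mono2) (auto intro: mangoldt_nonneg)

text \<open>Each \<open>d\<close> has \<open>n div d\<close> multiples up to \<open>n\<close>. Used
  both for Chebyshev's bound and for the summatory function of the theorem.\<close>

lemma sum_divisors_sum:
  fixes f :: "nat \<Rightarrow> real"
  shows "(\<Sum>k\<in>{1..n}. \<Sum>d | d dvd k. f d) = (\<Sum>d\<in>{1..n}. f d * real (n div d))"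
proof -
  have "(\<Sum>k\<in>{1..n}. \<Sum>d | d dvd k. f d) = (\<Sum>k\<in>{1..n}. \<Sum>d\<in>{1..n}. if d dvd k then f d else 0)"
  proof (rule sum.cong)
    fix k assume k: "k \<in> {1..n}"
    have "{d. d dvd k} = {d \<in> {1..n}. d dvd k}"
    proof (intro set_eqI iffI)
      fix d assume "d \<in> {d. d dvd k}"
      then have "d dvd k" by simp
      then have "0 < d" "d \<le> k" using k by (auto intro: dvd_pos_nat dvd_imp_le)
      then show "d \<in> {d \<in> {1..n}. d dvd k}" using k \<open>d dvd k\<close> by simp
    qed simp
    then show "(\<Sum>d | d dvd k. f d) = (\<Sum>d\<in>{1..n}. if d dvd k then f d else 0)"
      by (rule ssubst) (rule sum.inter_filter, simp)
  qed simp
  also have "\<dots> = (\<Sum>d\<in>{1..n}. \<Sum>k\<in>{1..n}. if d dvd k then f d else 0)"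
    by (rule sum.swap)
  also have "\<dots> = (\<Sum>d\<in>{1..n}. f d * real (n div d))"
  proof (rule sum.cong)
    fix d assume "d \<in> {1..n}"
    then have d: "d > 0" by auto
    have "{1..n} \<inter> {k. d dvd k} = (\<lambda>j. d * j) ` {1..n div d}"
    proof (intro set_eqI iffI)
      fix k assume "k \<in> {1..n} \<inter> {k. d dvd k}"
      then obtain j where j: "k = d * j" "1 \<le> k" "k \<le> n" by auto
      then have "1 \<le> j" "j \<le> n div d"
        using d by (auto simp: less_eq_div_iff_mult_less_eq mult.commute Suc_le_eq)
      then show "k \<in> (\<lambda>j. d * j) ` {1..n div d}" using j(1) by auto
    next
      fix k assume "k \<in> (\<lambda>j. d * j) ` {1..n div d}"
      then obtain j where "k = d * j" "j \<in> {1..n div d}" by (rule imageE)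
      then have j: "k = d * j" "1 \<le> j" "j \<le> n div d" by simp_all
      then have "k \<le> n" using d by (simp add: less_eq_div_iff_mult_less_eq mult.commute)
      then show "k \<in> {1..n} \<inter> {k. d dvd k}" using j d by simp
    qed
    moreover have "inj_on (\<lambda>j. d * j) {1..n div d}" using d by (auto intro: inj_onI)
    ultimately have "card ({1..n} \<inter> {k. d dvd k}) = n div d" by (simp add: card_image)
    then show "(\<Sum>k\<in>{1..n}. if d dvd k then f d else 0) = f d * real (n div d)"
      by (simp add: sum.If_cases)
  qed simp
  finally show ?thesis .
qed

lemma ln_fact_eq_sum_mangoldt: "ln (fact n) = (\<Sum>d\<in>{1..n}. mangoldt d * real (n div d))"
proof -
  have "(fact n :: real) = (\<Prod>k\<in>{1..n}. real k)" by (simp only: fact_prod of_nat_prod)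
  then have "ln (fact n :: real) = ln (\<Prod>k\<in>{1..n}. real k)" by (rule arg_cong)
  also have "\<dots> = (\<Sum>k\<in>{1..n}. ln (real k))" by (rule ln_prod) auto
  also have "\<dots> = (\<Sum>k\<in>{1..n}. \<Sum>d | d dvd k. mangoldt d)"
  proof (rule sum.cong)
    fix k assume "k \<in> {1..n}"
    then have "k \<noteq> 0" by simp
    from mangoldt_sum[OF this, where ?'a = real] show "ln (real k) = (\<Sum>d | d dvd k. mangoldt d)"
      by (simp only: of_real_eq_id id_apply)
  qed simp
  finally show ?thesis by (simp only: sum_divisors_sum)
qed

text \<open>Chebyshev's argument with \<open>n! / (m!)^2\<close>, \<open>m = n div 2\<close>. In the
  logarithm the coefficient \<open>n div d - 2 * (m div d)\<close> is never negative and is at least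
  1 for \<open>m < d \<le> n\<close>, so \<open>psi n - psi m\<close> is at most that logarithm,
  hence at most \<open>2 * n\<close>. The induction closes because
  \<open>4 * m \<le> 2 * n\<close>.\<close>

lemma psi_le: "psi n \<le> 4 * real n"
proof (induction n rule: less_induct)
  case (less n)
  show ?case
  proof (cases "n = 0")
    case False
    define m where "m = n div 2"
    have m: "m < n" "2 * m \<le> n" "n \<le> 2 * m + 1" using False by (auto simp: m_def)
    have "2 * ln (fact m) = (\<Sum>d\<in>{1..m}. mangoldt d * (2 * real (m div d)))"
      by (simp add: ln_fact_eq_sum_mangoldt sum_distrib_left mult.left_commute)
    also have "\<dots> = (\<Sum>d\<in>{1..n}. mangoldt d * (2 * real (m div d)))"
      using m by (intro sum.mono_neutral_left) auto
    finally have "ln (fact n) - 2 * ln (fact m) = (\<Sum>d\<in>{1..n}. mangoldt d * (real (n div d) - 2 * real (m div d)))"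
      by (simp only: ln_fact_eq_sum_mangoldt[of n] right_diff_distrib sum_subtractf)
    moreover have "(\<Sum>d\<in>{1..n}. mangoldt d * (if d > m then 1 else 0))
        \<le> (\<Sum>d\<in>{1..n}. mangoldt d * (real (n div d) - 2 * real (m div d)))"
    proof (intro sum_mono mult_left_mono mangoldt_nonneg)
      fix d assume d: "d \<in> {1..n}"
      have "m div d * d \<le> m" by simp
      then have "2 * (m div d) * d \<le> n" using m(2) by linarith
      then have "2 * (m div d) \<le> n div d" using d by (simp add: less_eq_div_iff_mult_less_eq)
      moreover have "n div d \<ge> 1" using d by (simp add: less_eq_div_iff_mult_less_eq)
      ultimately show "(if d > m then 1 else 0) \<le> real (n div d) - 2 * real (m div d)"
        by auto
    qed
    moreover have "(\<Sum>d\<in>{1..n}. mangoldt d * (if d > m then 1 else 0)) = psi n - psi m"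
    proof -
      have "psi n - psi m = (\<Sum>d\<in>{..n} - {..m}. mangoldt d)"
        unfolding psi_def using m by (subst sum_diff) auto
      also have "\<dots> = (\<Sum>d\<in>{1..n}. mangoldt d * (if d > m then 1 else 0))"
        by (rule sum.mono_neutral_cong_left) (auto simp: Suc_le_eq)
      finally show ?thesis by simp
    qed
    moreover have "ln (fact n) - 2 * ln (fact m) \<le> 2 * real n"
    proof -
      have "(fact (2 * m) :: real) = fact m * fact m * real (2 * m choose m)"
        using arg_cong[OF binomial_fact_lemma[of m "2 * m"], of real] by simp
      also have "real (2 * m choose m) \<le> 2 ^ (2 * m)"
        using binomial_le_pow2[of "2 * m" m] by (metis of_nat_le_iff of_nat_numeral of_nat_power)
      finally have f2m: "fact (2 * m) \<le> fact m * fact m * (2::real) ^ (2 * m)" by (simp add: mult_left_mono)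
      \<comment> \<open>The factor \<open>n\<close> is forced for odd \<open>n\<close>, where
        \<open>n! = n * (2m)!\<close>. Its logarithm takes one of the two available multiples of
        \<open>n\<close>; the other pays for \<open>2 ^ (2 * m)\<close>.\<close>
      have "(fact n :: real) \<le> real n * fact (2 * m)"
      proof (cases "n = 2 * m")
        case True
        then show ?thesis using False by (simp add: mult_le_cancel_right1)
      next
        case odd: False
        then have "n = Suc (2 * m)" using m by linarith
        then show ?thesis by (simp only: fact_Suc)
      qed
      also have "\<dots> \<le> real n * (fact m * fact m * 2 ^ (2 * m))"
        using f2m by (intro mult_left_mono) auto
      finally have "ln (fact n) \<le> ln (real n * (fact m * fact m * 2 ^ (2 * m)))"
        by (subst ln_le_cancel_iff) (use False in auto)
      also have "\<dots> = ln (real n) + (2 * ln (fact m) + real (2 * m) * ln 2)"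
        using False by (simp add: ln_mult ln_realpow)
      also have "real (2 * m) * ln 2 \<le> real n * 1"
        using m ln_2_less_1 by (intro mult_mono) auto
      also have "ln (real n) \<le> real n" by (rule less_imp_le, rule ln_less_self) (use False in simp)
      finally show ?thesis by simp
    qed
    moreover have "psi m \<le> 4 * real m" by (rule less.IH[OF m(1)])
    moreover have "4 * real m \<le> 2 * real n" using m(2) by linarith
    ultimately show ?thesis by linarith
  qed simp
qed

text \<open>One unit piece of the integral of \<open>(\<psi>(x) - x) * x powr (- z - 2)\<close> over
  \<open>x \<ge> 1\<close>. Up to the right endpoint \<psi> is constant on the interval, so
  \<open>psi (Suc n)\<close> can stand for \<open>\<psi>(x)\<close>.\<close>

definition psi_int :: "nat \<Rightarrow> complex \<Rightarrow> complex" where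
  "psi_int n z = integral {real (Suc n)..real (Suc n) + 1}
     (\<lambda>x. of_real (psi (Suc n) - x) * of_real x powr (- z - 2))"

lemma of_real_powr_eq_exp: "x > 0 \<Longrightarrow> of_real x powr w = exp (w * complex_of_real (ln x))"
  by (simp add: powr_def Ln_of_real)

lemma of_real_powr_has_vector_derivative:
  assumes "x > 0"
  shows "((\<lambda>x. of_real x powr w) has_vector_derivative w * of_real x powr (w - 1 :: complex)) (at x within A)"
proof -
  have "complex_of_real x \<notin> \<real>\<^sub>\<le>\<^sub>0" using assms by auto
  then have "((\<lambda>z. z powr w) has_field_derivative w * of_real x powr (w - 1)) (at (of_real x))"
    by (rule has_field_derivative_powr)
  then show ?thesis
    using has_vector_derivative_real_field has_vector_derivative_at_within by blast
qed

lemma psi_int_continuous: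
  "continuous_on {real (Suc n)..real (Suc n) + 1} (\<lambda>x. of_real (psi (Suc n) - x) * of_real x powr (w::complex))"
proof (rule continuous_on_cong[THEN iffD1])
  show "continuous_on {real (Suc n)..real (Suc n) + 1} (\<lambda>x. of_real (psi (Suc n) - x) * exp (w * of_real (ln x)))"
    by (intro continuous_intros) auto
qed (auto simp: of_real_powr_eq_exp)

lemma psi_int_holomorphic: "psi_int n holomorphic_on UNIV"
proof -
  let ?I = "cbox (real (Suc n)) (real (Suc n) + 1)"
  let ?f = "\<lambda>(z::complex) (x::real). of_real (psi (Suc n) - x) * exp ((- z - 2) * of_real (ln x))"
  have "(\<lambda>z. integral ?I (?f z)) holomorphic_on UNIV"
  proof (rule leibniz_rule_holomorphic)
    fix z and x assume "x \<in> ?I"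
    show "((\<lambda>z. ?f z x) has_field_derivative ?f z x * (- of_real (ln x))) (at z within UNIV)"
      by (auto intro!: derivative_eq_intros)
  next
    show "?f z integrable_on ?I" for z
      by (intro integrable_continuous continuous_intros) auto
    show "continuous_on (UNIV \<times> ?I) (\<lambda>(z, x). ?f z x * (- of_real (ln x)))"
      unfolding case_prod_unfold by (intro continuous_intros) auto
  qed auto
  also have "(\<lambda>z. integral ?I (?f z)) = psi_int n"
    unfolding psi_int_def box_real
    by (intro ext integral_cong) (auto simp: of_real_powr_eq_exp)
  finally show ?thesis .
qed

text \<open>By Chebyshev the integrand is at most \<open>4 * x powr (- Re z - 1)\<close>. The
  integral of this is kept as an exact difference, so that sums over \<open>n\<close> telescope, and
  it serves both signs of \<open>Re z\<close>.\<close>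

lemma psi_int_bound:
  assumes "Re z \<noteq> 0"
  shows "cmod (psi_int n z) \<le> 4 * ((real (Suc n) powr (- Re z) - real (Suc (Suc n)) powr (- Re z)) / Re z)"
proof -
  let ?a = "real (Suc n)"
  let ?g = "\<lambda>x. 4 * x powr (- Re z - 1)"
  have g: "(?g has_integral (4 * ((?a + 1) powr (- Re z) / (- Re z)) - 4 * (?a powr (- Re z) / (- Re z)))) {?a..?a + 1}"
    by (rule fundamental_theorem_of_calculus)
      (use assms in \<open>auto intro!: derivative_eq_intros simp: has_real_derivative_iff_has_vector_derivative[symmetric]\<close>)
  have "cmod (psi_int n z) \<le> integral {?a..?a + 1} ?g"
    unfolding psi_int_def
  proof (rule integral_norm_bound_integral)
    show "(\<lambda>x. of_real (psi (Suc n) - x) * of_real x powr (- z - 2)) integrable_on {?a..?a + 1}"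
      by (rule integrable_continuous_real[OF psi_int_continuous])
    show "?g integrable_on {?a..?a + 1}" using g by blast
    fix x assume x: "x \<in> {?a..?a + 1}"
    have "\<bar>psi (Suc n) - x\<bar> \<le> 4 * x"
      using psi_le[of "Suc n"] psi_nonneg[of "Suc n"] x by auto
    moreover have x0: "x > 0" using x by auto
    ultimately have "\<bar>psi (Suc n) - x\<bar> * cmod (of_real x powr (- z - 2)) \<le> 4 * x * x powr (- Re z - 2)"
      by (intro mult_mono) (simp_all add: norm_of_real_powr)
    then have "cmod (of_real (psi (Suc n) - x) * of_real x powr (- z - 2)) \<le> 4 * x * x powr (- Re z - 2)"
      by (simp only: norm_mult norm_of_real)
    also have "\<dots> = 4 * (x powr 1 * x powr (- Re z - 2))" using x0 by simp
    also have "x powr 1 * x powr (- Re z - 2) = x powr (- Re z - 1)"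
      unfolding powr_add[symmetric] by (rule arg_cong[where f = "(powr) x"]) simp
    finally show "cmod (of_real (psi (Suc n) - x) * of_real x powr (- z - 2)) \<le> 4 * x powr (- Re z - 1)" .
  qed
  also have "\<dots> = 4 * ((?a + 1) powr (- Re z) / (- Re z)) - 4 * (?a powr (- Re z) / (- Re z))"
    using g by (rule integral_unique)
  also have "\<dots> = 4 * ((?a powr (- Re z) - real (Suc (Suc n)) powr (- Re z)) / Re z)"
  proof -
    have "4 * (Y / (- r)) - 4 * (X / (- r)) = 4 * ((X - Y) / r)" for X Y r :: real
      by (simp add: diff_divide_distrib)
    moreover have "?a + 1 = real (Suc (Suc n))" by simp
    ultimately show ?thesis by (simp only:)
  qed
  finally show ?thesis .
qed

lemma sum_psi_int_bound:
  assumes "Re z \<noteq> 0" "M \<le> N"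
  shows "cmod (\<Sum>n\<in>{M..<N}. psi_int n z) \<le> 4 * ((real (Suc M) powr (- Re z) - real (Suc N) powr (- Re z)) / Re z)"
proof -
  have "cmod (\<Sum>n\<in>{M..<N}. psi_int n z)
     \<le> (\<Sum>n\<in>{M..<N}. 4 * ((real (Suc n) powr (- Re z) - real (Suc (Suc n)) powr (- Re z)) / Re z))"
    by (intro sum_norm_le psi_int_bound assms)
  also have "\<dots> = 4 * ((real (Suc M) powr (- Re z) - real (Suc N) powr (- Re z)) / Re z)"
    using sum_Suc_diff'[OF assms(2), of "\<lambda>n. - (real (Suc n) powr (- Re z))"]
    unfolding sum_distrib_left[symmetric] sum_divide_distrib[symmetric] by simp
  finally show ?thesis .
qed

lemma psi_int_eq:
  assumes "z \<noteq> 0" "z \<noteq> -1"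
  shows "psi_int n z = of_real (psi (Suc n)) * (of_nat (Suc n) powr (-z-1) - of_nat (Suc (Suc n)) powr (-z-1)) / (z + 1)
     - (of_nat (Suc n) powr (-z) - of_nat (Suc (Suc n)) powr (-z)) / z"
proof -
  let ?a = "real (Suc n)"
  define h where "h = (\<lambda>x::real. - of_real (psi (Suc n)) / (z + 1) * of_real x powr (-z-1) + 1 / z * of_real x powr (-z))"
  have z1: "z + 1 \<noteq> 0" using assms(2) by (simp add: add_eq_0_iff2)
  have "((\<lambda>x. of_real (psi (Suc n) - x) * of_real x powr (- z - 2)) has_integral h (?a + 1) - h ?a) {?a..?a + 1}"
  proof (rule fundamental_theorem_of_calculus)
    fix x assume x: "x \<in> {?a..?a + 1}"
    then have x0: "x > 0" by auto
    have "(h has_vector_derivative 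
        (- of_real (psi (Suc n)) / (z + 1) * ((-z-1) * of_real x powr (-z-1-1)) + 1 / z * ((-z) * of_real x powr (-z-1)))) (at x within {?a..?a + 1})"
      unfolding h_def
      by (intro has_vector_derivative_add has_vector_derivative_mult_right of_real_powr_has_vector_derivative x0)
    also have "- of_real (psi (Suc n)) / (z + 1) * ((-z-1) * of_real x powr (-z-1-1)) = of_real (psi (Suc n)) * of_real x powr (-z-2)"
    proof -
      have "-z-1 = - (z + 1)" by simp
      then show ?thesis using z1 by (simp add: field_simps)
    qed
    also have "1 / z * ((-z) * of_real x powr (-z-1)) = - (of_real x powr (-z-1))"
      using assms by simp
    also have "of_real x powr (-z-1) = of_real x * of_real x powr (-z-2)"
    proof -
      have "-z-1 = 1 + (-z-2)" by simp
      then have "of_real x powr (-z-1) = of_real x powr 1 * of_real x powr (-z-2)" by (simp only: powr_add)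
      then show ?thesis using x0 by simp
    qed
    finally show "(h has_vector_derivative of_real (psi (Suc n) - x) * of_real x powr (- z - 2)) (at x within {?a..?a + 1})"
      by (simp add: algebra_simps)
  qed auto
  then have "psi_int n z = h (?a + 1) - h ?a"
    unfolding psi_int_def by (rule integral_unique)
  moreover have "complex_of_real (?a + 1) = of_nat (Suc (Suc n))" "complex_of_real ?a = of_nat (Suc n)" by auto
  ultimately show ?thesis unfolding h_def by (simp only:) (simp add: diff_divide_distrib right_diff_distrib)
qed

text \<open>The value at the point where the contour argument is evaluated, treated apart from
  \<open>psi_int_eq\<close> because the antiderivative of \<open>1 / x\<close> is a
  logarithm.\<close>

lemma psi_int_0: "psi_int n 0 = of_real (psi (Suc n) * (1 / real (Suc n) - 1 / real (Suc (Suc n))) - (ln (real (Suc (Suc n))) - ln (real (Suc n))))"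
proof -
  let ?a = "real (Suc n)"
  let ?h = "\<lambda>x. - psi (Suc n) / x - ln x"
  have "((\<lambda>x. (psi (Suc n) - x) / x\<^sup>2) has_integral ?h (?a + 1) - ?h ?a) {?a..?a + 1}"
  proof (rule fundamental_theorem_of_calculus)
    fix x assume x: "x \<in> {?a..?a + 1}"
    then show "(?h has_vector_derivative (psi (Suc n) - x) / x\<^sup>2) (at x within {?a..?a + 1})"
      unfolding has_real_derivative_iff_has_vector_derivative[symmetric]
      by (auto intro!: derivative_eq_intros simp: power2_eq_square field_simps)
  qed auto
  then have "((\<lambda>x. complex_of_real ((psi (Suc n) - x) / x\<^sup>2)) has_integral of_real (?h (?a + 1) - ?h ?a)) {?a..?a + 1}"
    by (rule has_integral_of_real)
  moreover have "complex_of_real ((psi (Suc n) - x) / x\<^sup>2) = of_real (psi (Suc n) - x) * of_real x powr (- 0 - 2)"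
    if "x \<in> {?a..?a + 1}" for x
  proof -
    have "complex_of_real x powr (- 0 - 2) = of_real (x powr (-2))"
      using that powr_of_real[of x "-2"] by simp
    also have "x powr (-2) = 1 / x\<^sup>2" using that by (simp add: powr_minus_divide)
    finally show ?thesis by simp
  qed
  ultimately have "((\<lambda>x. of_real (psi (Suc n) - x) * of_real x powr (- 0 - 2)) has_integral complex_of_real (?h (?a + 1) - ?h ?a)) {?a..?a + 1}"
    by (rule has_integral_eq[rotated])
  then have "psi_int n 0 = of_real (?h (?a + 1) - ?h ?a)"
    unfolding psi_int_def by (rule integral_unique)
  also have "?h (?a + 1) - ?h ?a = psi (Suc n) * (1 / real (Suc n) - 1 / real (Suc (Suc n))) - (ln (real (Suc (Suc n))) - ln (real (Suc n)))"
    by (simp add: algebra_simps)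
  finally show ?thesis .
qed

text \<open>For \<open>Re z > 0\<close> this is \<open>lser (1 + z) / (1 + z) - 1 / z\<close>. In
  terms of \<open>zreg\<close> the pole at \<open>z = 0\<close> has cancelled, so the expression
  makes sense to the left of the imaginary axis wherever \<open>zreg (1 + z)\<close> is
  nonzero.\<close>

definition psi_laplace :: "complex \<Rightarrow> complex" where
  "psi_laplace z = - (deriv zreg (1 + z) / zreg (1 + z) + 1) / (1 + z)"

lemma lser_eq:
  assumes "Re s > 1"
  shows "lser s = 1 / (s - 1) - deriv zreg s / zreg s"
proof -
  have s1: "s - 1 \<noteq> 0" using assms by auto
  have nz: "zreg s \<noteq> 0" by (rule zreg_nonzero[OF assms])
  have "(zreg has_field_derivative deriv zreg s) (at s)"
    using assms by (intro zreg_field_derivative) auto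
  then have "(zt has_field_derivative (deriv zreg s * (s - 1) - zreg s * 1) / ((s - 1) * (s - 1))) (at s)"
    unfolding zt_def using s1 by (auto intro!: derivative_eq_intros)
  then have "- lser s * zt s = (deriv zreg s * (s - 1) - zreg s * 1) / ((s - 1) * (s - 1))"
    using zt_has_field_derivative[OF assms] DERIV_unique by blast
  then have "- lser s * (zreg s / (s - 1)) = (deriv zreg s * (s - 1) - zreg s) / ((s - 1) * (s - 1))"
    by (simp add: zt_def)
  then have "- lser s * zreg s * (s - 1) = deriv zreg s * (s - 1) - zreg s"
    using s1 by (simp add: divide_simps mult.assoc split: if_splits)
  then have "lser s * (zreg s * (s - 1)) = zreg s - deriv zreg s * (s - 1)" by algebra
  then have "lser s = (zreg s - deriv zreg s * (s - 1)) / (zreg s * (s - 1))"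
    using s1 nz by (simp add: eq_divide_eq)
  then show ?thesis using s1 nz by (simp add: diff_divide_distrib)
qed

lemma sum_psi_powr_by_parts:
  "(\<Sum>n<N. of_real (psi (Suc n)) * (of_nat (Suc n) powr w - of_nat (Suc (Suc n)) powr w))
     = (\<Sum>n<N. mangoldt (Suc n) * of_nat (Suc n) powr w) - of_real (psi N) * of_nat (Suc N) powr (w :: complex)"
proof (induction N)
  case (Suc N)
  have "complex_of_real (psi (Suc N)) = of_real (psi N) + mangoldt (Suc N)"
    by (simp add: psi_Suc)
  with Suc show ?case by (simp only: sum.lessThan_Suc) (simp add: algebra_simps)
qed simp

text \<open>Summation by parts turns the integrals into partial sums of \<open>lser (1 + z)\<close>;
  Chebyshev's bound makes the boundary term with \<open>psi N\<close> vanish in the limit.\<close>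

lemma psi_int_sums:
  assumes z: "Re z > 0"
  shows "(\<lambda>n. psi_int n z) sums psi_laplace z"
proof -
  have z0: "z \<noteq> 0" and z1: "z + 1 \<noteq> 0" using z by (auto simp: complex_eq_iff)
  have lim1: "(\<lambda>N. \<Sum>n<N. mangoldt (Suc n) * of_nat (Suc n) powr (-z-1)) \<longlonglongrightarrow> lser (1 + z)"
  proof -
    have "- (1 + z) = -z-1" by simp
    then show ?thesis using lser_sums[of "1 + z"] z by (simp only: sums_def) simp
  qed
  have lim2: "(\<lambda>N. of_real (psi N) * of_nat (Suc N) powr (-z-1)) \<longlonglongrightarrow> 0"
  proof (rule Lim_null_comparison)
    show "eventually (\<lambda>N. cmod (of_real (psi N) * of_nat (Suc N) powr (-z-1)) \<le> 4 * real N * real (Suc N) powr (- Re z - 1)) sequentially"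
      using psi_le psi_nonneg by (intro always_eventually allI)
        (auto simp: norm_mult norm_of_nat_powr simp del: of_nat_Suc intro!: mult_right_mono)
    show "(\<lambda>N. 4 * real N * real (Suc N) powr (- Re z - 1)) \<longlonglongrightarrow> 0"
      using z by real_asymp
  qed
  have lim3: "(\<lambda>N. of_nat (Suc N) powr (-z)) \<longlonglongrightarrow> 0"
  proof (rule tendsto_norm_zero_cancel)
    have "(\<lambda>N. real (Suc N) powr (- Re z)) \<longlonglongrightarrow> 0" using z by real_asymp
    then show "(\<lambda>N. cmod (of_nat (Suc N) powr (-z))) \<longlonglongrightarrow> 0"
      by (simp add: norm_of_nat_powr del: of_nat_Suc)
  qed
  have tele: "(\<Sum>n<N. of_nat (Suc n) powr (-z) - of_nat (Suc (Suc n)) powr (-z)) = 1 - of_nat (Suc N) powr (-z)" for N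
    by (induction N) simp_all
  have "(\<Sum>n<N. psi_int n z) = ((\<Sum>n<N. mangoldt (Suc n) * of_nat (Suc n) powr (-z-1)) - of_real (psi N) * of_nat (Suc N) powr (-z-1)) / (z + 1)
      - (1 - of_nat (Suc N) powr (-z)) / z" for N
  proof -
    have "z \<noteq> -1" using z by auto
    then have "(\<Sum>n<N. psi_int n z) = (\<Sum>n<N. of_real (psi (Suc n)) * (of_nat (Suc n) powr (-z-1) - of_nat (Suc (Suc n)) powr (-z-1))) / (z + 1)
      - (\<Sum>n<N. of_nat (Suc n) powr (-z) - of_nat (Suc (Suc n)) powr (-z)) / z"
      using z0 by (simp only: psi_int_eq sum_divide_distrib sum_subtractf[symmetric] not_False_eq_True)
    then show ?thesis by (simp only: sum_psi_powr_by_parts tele)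
  qed
  moreover have "(\<lambda>N. ((\<Sum>n<N. mangoldt (Suc n) * of_nat (Suc n) powr (-z-1)) - of_real (psi N) * of_nat (Suc N) powr (-z-1)) / (z + 1)
      - (1 - of_nat (Suc N) powr (-z)) / z) \<longlonglongrightarrow> (lser (1 + z) - 0) / (z + 1) - (1 - 0) / z"
    by (intro tendsto_intros lim1 lim2 lim3 z0 z1)
  moreover have "(lser (1 + z) - 0) / (z + 1) - (1 - 0) / z = psi_laplace z"
  proof -
    have "lser (1 + z) = 1 / z - deriv zreg (1 + z) / zreg (1 + z)"
      using lser_eq[of "1 + z"] z by simp
    moreover have "(1 / z - D - 0) / (z + 1) - (1 - 0) / z = - (D + 1) / (1 + z)" for D
      using z0 z1 by (simp add: divide_simps add.commute[of 1 z]) (simp add: algebra_simps)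
    ultimately show ?thesis by (simp only: psi_laplace_def)
  qed
  ultimately show ?thesis unfolding sums_def by simp
qed

section \<open>Mean values of the Chebyshev function\<close>

text \<open>The power of \<open>Suc N\<close> equals \<open>exp (- U * Re z)\<close> for
  \<open>U = ln (Suc N)\<close>, the shape required by \<open>newman_contour_bound\<close>.\<close>

lemma psi_laplace_remainder_right:
  assumes z: "Re z > 0"
  shows "cmod (psi_laplace z - (\<Sum>n<N. psi_int n z)) \<le> 4 * real (Suc N) powr (- Re z) / Re z"
proof (rule Lim_norm_ubound[where net = sequentially])
  show "(\<lambda>M. (\<Sum>n<M. psi_int n z) - (\<Sum>n<N. psi_int n z)) \<longlonglongrightarrow> psi_laplace z - (\<Sum>n<N. psi_int n z)"
    using psi_int_sums[OF z] unfolding sums_def by (intro tendsto_intros)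
  show "\<forall>\<^sub>F M in sequentially. cmod ((\<Sum>n<M. psi_int n z) - (\<Sum>n<N. psi_int n z)) \<le> 4 * real (Suc N) powr (- Re z) / Re z"
    using eventually_ge_at_top[of N]
  proof eventually_elim
    case (elim M)
    have "(\<Sum>n<M. psi_int n z) - (\<Sum>n<N. psi_int n z) = (\<Sum>n\<in>{N..<M}. psi_int n z)"
      using elim by (simp add: lessThan_minus_lessThan sum_diff_nat_ivl lessThan_atLeast0)
    then have "cmod ((\<Sum>n<M. psi_int n z) - (\<Sum>n<N. psi_int n z))
        \<le> 4 * ((real (Suc N) powr (- Re z) - real (Suc M) powr (- Re z)) / Re z)"
      using sum_psi_int_bound[of z N M] z elim by simp
    also have "\<dots> \<le> 4 * (real (Suc N) powr (- Re z) / Re z)"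
      using z by (intro mult_left_mono divide_right_mono) auto
    finally show ?case by simp
  qed
qed simp

lemma sum_psi_int_bound_left:
  assumes z: "Re z < 0"
  shows "cmod (\<Sum>n<N. psi_int n z) \<le> 4 * real (Suc N) powr (- Re z) / (- Re z)"
proof -
  have "cmod (\<Sum>n\<in>{0..<N}. psi_int n z) \<le> 4 * ((real (Suc 0) powr (- Re z) - real (Suc N) powr (- Re z)) / Re z)"
    by (rule sum_psi_int_bound) (use z in auto)
  also have "\<dots> = 4 * ((real (Suc N) powr (- Re z) - 1) / (- Re z))"
    using z by (simp add: field_simps)
  also have "\<dots> \<le> 4 * (real (Suc N) powr (- Re z) / (- Re z))"
    using z by (intro mult_left_mono divide_right_mono) auto
  finally show ?thesis by (simp add: lessThan_atLeast0)
qed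

lemma psi_laplace_holomorphic:
  assumes "\<And>z. z \<in> A \<Longrightarrow> Re z > - 1/40 \<and> zreg (1 + z) \<noteq> 0"
  shows "psi_laplace holomorphic_on A"
proof -
  have sub: "(\<lambda>z. 1 + z) ` A \<subseteq> zdom"
  proof safe
    fix z assume "z \<in> A"
    then have "Re z > - 1/40" using assms by blast
    then show "Re (1 + z) > 1 - 1/40" by simp
  qed
  have h: "(\<lambda>z. 1 + z) holomorphic_on A" by (intro holomorphic_intros)
  have "zreg \<circ> (\<lambda>z. 1 + z) holomorphic_on A" "deriv zreg \<circ> (\<lambda>z. 1 + z) holomorphic_on A"
    by (rule holomorphic_on_compose_gen[OF h _ sub] zreg_holomorphic holomorphic_deriv open_zdom)+
  then have "(\<lambda>z. zreg (1 + z)) holomorphic_on A" "(\<lambda>z. deriv zreg (1 + z)) holomorphic_on A"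
    by (simp_all add: o_def)
  moreover have "1 + z \<noteq> 0" if "z \<in> A" for z
    using assms[OF that] by (auto simp: complex_eq_iff)
  ultimately show ?thesis
    unfolding psi_laplace_def by (intro holomorphic_intros) (use assms in auto)
qed

text \<open>The tenth power is the one needed below: there \<open>U\<close> is at most a multiple of
  \<open>y\<^sup>2\<close>, and \<open>U ^ 5\<close> has to be absorbed by
  \<open>exp y\<close>.\<close>

lemma power_le_exp: "y \<ge> 0 \<Longrightarrow> y ^ 10 \<le> 10 ^ 10 * exp (y::real)"
proof -
  assume y: "y \<ge> 0"
  have "(y / 10) ^ 10 \<le> (1 + y / real 10) ^ 10" using y by (intro power_mono) auto
  also have "\<dots> \<le> exp y" using y by (intro exp_ge_one_plus_x_over_n_power_n) auto
  finally show ?thesis by (simp add: power_divide field_simps)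
qed

lemma psi_int_sum_asymp:
  "\<exists>C>0. \<forall>N\<ge>2. cmod (psi_laplace 0 - (\<Sum>n<N. psi_int n 0)) \<le> C / (ln (real (Suc N)))\<^sup>2"
proof -
  obtain \<epsilon> K where \<epsilon>: "\<epsilon> > 0" "\<epsilon> \<le> 1/100" and K: "K > 0"
    and zf: "\<And>s. Re s \<ge> 1 - \<epsilon> * (\<bar>Im s\<bar> + 2) powr (-1/4) \<Longrightarrow> zreg s \<noteq> 0"
    and ld: "\<And>s. Re s \<ge> 1 - \<epsilon> * (\<bar>Im s\<bar> + 2) powr (-1/4) \<Longrightarrow> Re s \<le> 1 \<Longrightarrow>
       cmod (deriv zreg s / zreg s) \<le> K * (\<bar>Im s\<bar> + 2) powr (1/4)"
    using zero_free_region by blast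
  \<comment> \<open>The three summands match the three terms of \<open>newman_contour_bound\<close>,
    where \<open>B = 4\<close> is the Chebyshev constant.\<close>
  define C where "C = 16 + 2 * (K + 1) + 16 * (K + 1) / \<epsilon> * (10 ^ 10 * (16 / \<epsilon>\<^sup>2) ^ 5)"
  have "cmod (psi_laplace 0 - (\<Sum>n<N. psi_int n 0)) \<le> C / (ln (real (Suc N)))\<^sup>2" if N: "N \<ge> 2" for N
  proof -
    define U where "U = ln (real (Suc N))"
    have "exp 1 \<le> real (Suc N)" using exp_le N by linarith
    then have U: "U \<ge> 1" unfolding U_def by (subst ln_ge_iff) auto
    define R where "R = U\<^sup>2"
    have R: "R \<ge> 1" using U by (simp add: R_def)
    \<comment> \<open>\<open>R + 3\<close> bounds \<open>|Im z| + 2\<close> on the neighbourhood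
      \<open>S\<close> of the contour, which allows \<open>|Im z| < R + 1\<close>. Since
      \<open>R = U\<^sup>2\<close>, \<open>q\<close> is of order the square root of
      \<open>U\<close>.\<close>
    define q where "q = (R + 3) powr (1/4)"
    have q1: "q \<ge> 1" unfolding q_def using R by (intro ge_one_powr_ge_zero) auto
    have "q ^ 4 = R + 3"
      using R by (simp add: q_def powr_powr flip: powr_realpow)
    then have "(q\<^sup>2)\<^sup>2 \<le> (4 * U)\<^sup>2"
      using R by (simp add: R_def power2_eq_square power4_eq_xxxx)
    then have q2: "q\<^sup>2 \<le> 4 * U" by (rule power2_le_imp_le) (use U in simp)
    \<comment> \<open>Half the width of the zero-free region at the top of \<open>S\<close>, so that
      the closed rectangle fits into the open set \<open>S\<close>, which reaches to
      \<open>- 2 * \<delta>\<close>.\<close>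
    define \<delta> where "\<delta> = \<epsilon> / (2 * q)"
    have \<delta>: "\<delta> > 0" using \<epsilon> q1 by (simp add: \<delta>_def)
    have q\<delta>: "q * \<delta> = \<epsilon> / 2" using q1 by (simp add: \<delta>_def)
    have "\<delta> * 1 \<le> \<delta> * q" using q1 \<delta> by (intro mult_left_mono) auto
    then have \<delta>1: "\<delta> \<le> 1/200" using q\<delta> \<epsilon> by (simp add: mult.commute)
    have qinv: "(R + 3) powr (-1/4) = 1 / q"
      unfolding q_def using powr_minus_divide[of "R + 3" "1/4"] by simp
    have reg: "Re (1 + z) \<ge> 1 - \<epsilon> * (\<bar>Im (1 + z)\<bar> + 2) powr (-1/4)"
      if "Re z \<ge> - (2 * \<delta>)" "\<bar>Im z\<bar> \<le> R + 1" for z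
    proof -
      have "(R + 3) powr (-1/4) \<le> (\<bar>Im z\<bar> + 2) powr (-1/4)"
        using that by (intro powr_mono2') auto
      then have "\<epsilon> * (1 / q) \<le> \<epsilon> * (\<bar>Im z\<bar> + 2) powr (-1/4)"
        unfolding qinv using \<epsilon> by (intro mult_left_mono) auto
      moreover have "\<epsilon> * (1 / q) = 2 * \<delta>" by (simp add: \<delta>_def)
      ultimately show ?thesis using that by simp
    qed
    define S where "S = {z. Re z > - (2 * \<delta>)} \<inter> {z. Im z > - (R + 1)} \<inter> {z. Im z < R + 1}"
    define K' where "K' = 2 * (K + 1) * q"
    have "cmod (psi_laplace 0 - (\<Sum>n<N. psi_int n 0)) \<le> 4 * 4 / R + K' * \<delta>\<^sup>2 / R\<^sup>2 + K' * R * exp (- U * \<delta>) / \<delta>"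
    proof (rule newman_contour_bound[where S = S])
      show "open S" unfolding S_def
        by (intro open_Int open_halfspace_Re_gt open_halfspace_Im_gt open_halfspace_Im_lt)
      show "convex S" unfolding S_def
        by (intro convex_Int convex_halfspace_Re_gt convex_halfspace_Im_gt convex_halfspace_Im_lt)
      show "psi_laplace holomorphic_on S"
      proof (rule psi_laplace_holomorphic)
        fix z assume "z \<in> S"
        then have z: "Re z > - (2 * \<delta>)" "\<bar>Im z\<bar> < R + 1" by (auto simp: S_def)
        then show "Re z > - 1/40 \<and> zreg (1 + z) \<noteq> 0"
          using zf[OF reg[of z]] \<delta>1 by auto
      qed
      show "(\<lambda>z. \<Sum>n<N. psi_int n z) holomorphic_on UNIV"
        by (intro holomorphic_intros psi_int_holomorphic)
      show "cbox (Complex (- \<delta>) (- R)) (Complex R R) \<subseteq> S"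
        using \<delta> by (auto simp: S_def in_cbox_complex_iff)
      have X: "real (Suc N) powr (- r) = exp (- U * r)" for r
        by (simp add: powr_def U_def mult.commute)
      show "cmod (psi_laplace z - (\<Sum>n<N. psi_int n z)) \<le> 4 * exp (- U * Re z) / Re z" if "Re z > 0" for z
        using psi_laplace_remainder_right[OF that, of N] unfolding X .
      show "cmod (\<Sum>n<N. psi_int n z) \<le> 4 * exp (- U * Re z) / (- Re z)" if "Re z < 0" for z
        using sum_psi_int_bound_left[OF that, of N] unfolding X .
      show "cmod (psi_laplace z) \<le> K'" if z: "- \<delta> \<le> Re z" "Re z \<le> 0" "\<bar>Im z\<bar> \<le> R" for z
      proof -
        have "(\<bar>Im z\<bar> + 2) powr (1/4) \<le> q"
          unfolding q_def using z by (intro powr_mono2) auto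
        then have "K * (\<bar>Im z\<bar> + 2) powr (1/4) \<le> K * q" using K by (intro mult_left_mono) auto
        moreover have "cmod (deriv zreg (1 + z) / zreg (1 + z)) \<le> K * (\<bar>Im (1 + z)\<bar> + 2) powr (1/4)"
          by (rule ld[OF reg]) (use z \<delta> in auto)
        ultimately have "cmod (deriv zreg (1 + z) / zreg (1 + z)) \<le> K * q" by simp
        then have "cmod (deriv zreg (1 + z) / zreg (1 + z) + 1) \<le> K * q + 1"
          using norm_triangle_ineq[of "deriv zreg (1 + z) / zreg (1 + z)" 1] by simp
        moreover have "K * q + 1 \<le> (K + 1) * q" using q1 by (simp add: algebra_simps)
        ultimately have num: "cmod (deriv zreg (1 + z) / zreg (1 + z) + 1) \<le> (K + 1) * q" by simp
        have den: "1/2 \<le> cmod (1 + z)"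
          using abs_Re_le_cmod[of "1 + z"] z \<delta>1 by simp
        have "cmod (psi_laplace z) \<le> (K + 1) * q / (1/2)"
          unfolding psi_laplace_def norm_divide norm_minus_cancel
          by (rule frac_le) (use num den K q1 in auto)
        then show ?thesis by (simp add: K'_def algebra_simps)
      qed
    qed (use R \<delta> \<delta>1 K q1 U in \<open>auto simp: K'_def\<close>)
    also have "K' * \<delta>\<^sup>2 / R\<^sup>2 \<le> 2 * (K + 1) / R"
    proof -
      have "K' * \<delta>\<^sup>2 = 2 * (K + 1) * ((q * \<delta>) * \<delta>)" by (simp add: K'_def power2_eq_square)
      also have "\<dots> \<le> 2 * (K + 1) * (1 * 1)"
        using K \<epsilon> \<delta> \<delta>1 q1 q\<delta> by (intro mult_left_mono mult_mono) auto
      finally have "K' * \<delta>\<^sup>2 \<le> 2 * (K + 1)" by simp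
      moreover have "R \<le> R\<^sup>2" using R by (simp add: power2_eq_square)
      ultimately show ?thesis using K R by (intro frac_le) auto
    qed
    also have "K' * R * exp (- U * \<delta>) / \<delta> \<le> 16 * (K + 1) / \<epsilon> * (10 ^ 10 * (16 / \<epsilon>\<^sup>2) ^ 5) / R"
    proof -
      define y where "y = U * \<delta>"
      have y: "y > 0" using U \<delta> by (simp add: y_def)
      \<comment> \<open>\<open>U * \<delta>\<close> is at least a multiple of the square root of
        \<open>U\<close>, so its exponential beats every power of \<open>U\<close>. The fifth power
        is required: the edge term is of order \<open>U ^ 3 * exp (- y)\<close>, and another
        \<open>U\<^sup>2 = R\<close> is needed for the target \<open>1 / R\<close>.\<close>
      have y2: "U \<le> 16 / \<epsilon>\<^sup>2 * y\<^sup>2"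
      proof -
        have "U * q\<^sup>2 \<le> U * (4 * U)" using q2 U by (intro mult_left_mono) auto
        then have "U \<le> 4 * U\<^sup>2 / q\<^sup>2" using q1 by (simp add: field_simps power2_eq_square)
        also have "\<dots> = 16 / \<epsilon>\<^sup>2 * y\<^sup>2" using q1 \<epsilon> by (simp add: y_def \<delta>_def power2_eq_square field_simps)
        finally show ?thesis .
      qed
      have "U ^ 5 \<le> (16 / \<epsilon>\<^sup>2 * y\<^sup>2) ^ 5" using y2 U by (intro power_mono) auto
      also have "\<dots> = (16 / \<epsilon>\<^sup>2) ^ 5 * y ^ 10" unfolding power_mult_distrib by (simp flip: power_mult)
      also have "\<dots> \<le> (16 / \<epsilon>\<^sup>2) ^ 5 * (10 ^ 10 * exp y)"
        using y by (intro mult_left_mono power_le_exp) auto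
      finally have "U ^ 5 * exp (- y) \<le> (16 / \<epsilon>\<^sup>2) ^ 5 * (10 ^ 10 * exp y) * exp (- y)"
        by (rule mult_right_mono) simp
      also have "\<dots> = 10 ^ 10 * (16 / \<epsilon>\<^sup>2) ^ 5 * (exp y * exp (- y))" by simp
      also have "exp y * exp (- y) = 1" by (simp flip: exp_add)
      finally have e: "U ^ 5 * exp (- y) \<le> 10 ^ 10 * (16 / \<epsilon>\<^sup>2) ^ 5" by simp
      have "K' * R * exp (- U * \<delta>) / \<delta> = 4 * (K + 1) / \<epsilon> * (q\<^sup>2 * R * exp (- y))"
        using q1 \<epsilon> by (simp add: K'_def y_def \<delta>_def power2_eq_square)
      also have "\<dots> \<le> 4 * (K + 1) / \<epsilon> * (4 * U * R * exp (- y))"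
        using q2 K \<epsilon> R by (intro mult_left_mono mult_right_mono) auto
      also have "\<dots> = 16 * (K + 1) / \<epsilon> * (U ^ 5 * exp (- y)) / R"
        using U by (simp add: R_def power2_eq_square power_numeral_reduce)
      also have "\<dots> \<le> 16 * (K + 1) / \<epsilon> * (10 ^ 10 * (16 / \<epsilon>\<^sup>2) ^ 5) / R"
        using e K \<epsilon> R by (intro divide_right_mono mult_left_mono) auto
      finally show ?thesis .
    qed
    finally have "cmod (psi_laplace 0 - (\<Sum>n<N. psi_int n 0)) \<le> C / R"
      by (simp add: C_def add_divide_distrib)
    then show ?thesis by (simp add: R_def U_def)
  qed
  moreover have "C > 0" using K \<epsilon> by (auto simp: C_def intro!: add_pos_nonneg)
  ultimately show ?thesis by blast
qed

text \<open>The integral of \<open>(\<psi>(x) - x) / x^2\<close> over \<open>[1, N]\<close>,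
  evaluated on unit intervals by \<open>psi_int_0\<close>.\<close>

definition psi_mean :: "nat \<Rightarrow> real" where
  "psi_mean N = (\<Sum>m\<in>{1..<N}. psi m * (1 / real m - 1 / real (Suc m)) - (ln (real (Suc m)) - ln (real m)))"

lemma psi_mean_asymp: "\<exists>C>0. \<exists>g. \<forall>N\<ge>3. \<bar>psi_mean N - g\<bar> \<le> C / (ln (real N))\<^sup>2"
proof -
  obtain C where C: "C > 0" "\<And>N. N \<ge> 2 \<Longrightarrow> cmod (psi_laplace 0 - (\<Sum>n<N. psi_int n 0)) \<le> C / (ln (real (Suc N)))\<^sup>2"
    using psi_int_sum_asymp by blast
  have "\<bar>psi_mean N - Re (psi_laplace 0)\<bar> \<le> C / (ln (real N))\<^sup>2" if "N \<ge> 3" for N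
  proof -
    define M where "M = N - 1"
    have M: "N = Suc M" "M \<ge> 2" using that by (auto simp: M_def)
    have "(\<Sum>n<M. psi_int n 0) = of_real (psi_mean N)"
      unfolding psi_mean_def M(1) One_nat_def sum.shift_bounds_Suc_ivl
      by (simp only: psi_int_0 of_real_sum lessThan_atLeast0)
    then have "Re (psi_laplace 0 - (\<Sum>n<M. psi_int n 0)) = Re (psi_laplace 0) - psi_mean N" by simp
    then show ?thesis
      using order.trans[OF abs_Re_le_cmod C(2)[OF M(2)]] by (simp add: M(1) abs_minus_commute)
  qed
  then show ?thesis using C(1) by blast
qed

section \<open>Differences of mean values and monotonicity\<close>

lemma sum_inverse_diff:
  assumes "1 \<le> a" "a \<le> b"
  shows "(\<Sum>m\<in>{a..<b}. 1 / real m - 1 / real (Suc m)) = 1 / real a - 1 / real b"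
    and "(\<Sum>m\<in>{a..<b}. ln (real (Suc m)) - ln (real m)) = ln (real b) - ln (real a)"
  using sum_Suc_diff'[OF assms(2), of "\<lambda>m. - (1 / real m)"] sum_Suc_diff'[OF assms(2), of "\<lambda>m. ln (real m)"]
  by simp_all

lemma psi_mean_diff:
  assumes "1 \<le> a" "a \<le> b"
  shows "psi_mean b - psi_mean a = (\<Sum>m\<in>{a..<b}. psi m * (1 / real m - 1 / real (Suc m))) - (ln (real b) - ln (real a))"
proof -
  have "psi_mean b - psi_mean a = (\<Sum>m\<in>{a..<b}. psi m * (1 / real m - 1 / real (Suc m)) - (ln (real (Suc m)) - ln (real m)))"
    unfolding psi_mean_def using assms by (intro sum_diff_nat_ivl)
  then show ?thesis by (simp only: sum_subtractf[of "\<lambda>m. psi m * _ m"] sum_subtractf sum_inverse_diff(2)[OF assms, unfolded sum_subtractf])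
qed

lemma psi_mean_diff_ge:
  assumes "1 \<le> a" "a \<le> b"
  shows "psi_mean b - psi_mean a \<ge> psi a * (1 / real a - 1 / real b) - (ln (real b) - ln (real a))"
proof -
  have "(\<Sum>m\<in>{a..<b}. psi a * (1 / real m - 1 / real (Suc m))) \<le> (\<Sum>m\<in>{a..<b}. psi m * (1 / real m - 1 / real (Suc m)))"
    using assms by (intro sum_mono mult_right_mono psi_mono) (auto simp: frac_le)
  then show ?thesis
    using psi_mean_diff[OF assms] sum_inverse_diff(1)[OF assms] by (simp add: sum_distrib_left[symmetric])
qed

lemma psi_mean_diff_le:
  assumes "1 \<le> a" "a \<le> b"
  shows "psi_mean b - psi_mean a \<le> psi b * (1 / real a - 1 / real b) - (ln (real b) - ln (real a))"
proof -
  have "(\<Sum>m\<in>{a..<b}. psi m * (1 / real m - 1 / real (Suc m))) \<le> (\<Sum>m\<in>{a..<b}. psi b * (1 / real m - 1 / real (Suc m)))"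
    using assms by (intro sum_mono mult_right_mono psi_mono) (auto simp: frac_le)
  then show ?thesis
    using psi_mean_diff[OF assms] sum_inverse_diff(1)[OF assms] by (simp add: sum_distrib_left[symmetric])
qed

section \<open>The prime number theorem and sums of two primes\<close>

text \<open>Over a window of \<open>k\<close> integers next to \<open>N\<close>, monotonicity
  compares \<open>psi N\<close> times \<open>k / N^2\<close>, roughly, with \<open>k / N\<close>
  plus a change of the mean of order \<open>1 / L\<^sup>2\<close>. Dividing by
  \<open>k / N^2\<close> leaves \<open>N\<close>, an error of order \<open>k\<close> from the window
  and one of order \<open>N^2 / (k * L^2)\<close> from the mean. Both are of order
  \<open>N / L\<close> for \<open>k\<close> near \<open>x = N / L\<close>; a window to the right
  gives the upper bound, one to the left the lower.\<close>

lemma psi_asymp_large: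
  assumes C: "C > 0" and D: "\<And>N. N \<ge> 3 \<Longrightarrow> \<bar>psi_mean N - g\<bar> \<le> C / (ln (real N))\<^sup>2" and N: "N \<ge> 9"
  shows "\<bar>psi N - real N\<bar> \<le> (2 + 20 * C) * (real N / ln (real N))"
proof -
  define L where "L = ln (real N)"
  have "exp 1 \<le> real N" using exp_le N by linarith
  then have L1: "L \<ge> 1" unfolding L_def using N by (subst ln_ge_iff) auto
  define x where "x = real N / L"
  have "L < real N" unfolding L_def by (rule ln_less_self) (use N in simp)
  then have x1: "x \<ge> 1" using L1 by (simp add: x_def)
  have xN: "x \<le> real N" using L1 N by (simp add: x_def divide_le_eq)
  have upper: "psi N - real N \<le> (2 + 20 * C) * x"
  proof -
    define k where "k = nat \<lceil>x\<rceil>"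
    have k: "real k \<ge> x" "real k \<le> x + 1" "k \<ge> 1" using x1 by (auto simp: k_def) linarith+
    have "psi_mean (N + k) - psi_mean N \<le> C / L\<^sup>2 + C / L\<^sup>2"
    proof -
      have "C / (ln (real (N + k)))\<^sup>2 \<le> C / L\<^sup>2"
        unfolding L_def using C N L1 by (intro divide_left_mono power_mono mult_pos_pos) (auto simp: L_def)
      then show ?thesis using D[of N] D[of "N + k"] N unfolding L_def by linarith
    qed
    moreover have "psi_mean (N + k) - psi_mean N \<ge> psi N * (1 / real N - 1 / real (N + k)) - (ln (real (N + k)) - ln (real N))"
      by (rule psi_mean_diff_ge) (use N in auto)
    moreover have "ln (real (N + k)) - ln (real N) \<le> real k / real N"
      using ln_diff_le[of "real (N + k)" "real N"] N by simp
    ultimately have "psi N * (1 / real N - 1 / real (N + k)) \<le> real k / real N + 2 * C / L\<^sup>2" by simp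
    moreover have "1 / real N - 1 / real (N + k) = real k / (real N * real (N + k))"
      using N by (simp add: divide_simps)
    ultimately have "psi N * (real k / (real N * real (N + k))) * (real N * real (N + k) / real k)
        \<le> (real k / real N + 2 * C / L\<^sup>2) * (real N * real (N + k) / real k)"
      by (intro mult_right_mono) auto
    also have "psi N * (real k / (real N * real (N + k))) * (real N * real (N + k) / real k) = psi N"
      using N k by simp
    also have "(real k / real N + 2 * C / L\<^sup>2) * (real N * real (N + k) / real k)
       = real (N + k) + 2 * C * (real (N + k) / L) * (x / real k)"
      using N k L1 by (simp add: x_def field_simps power2_eq_square)
    also have "2 * C * (real (N + k) / L) * (x / real k) \<le> 2 * C * (3 * x) * 1"
    proof (intro mult_mono mult_nonneg_nonneg)
      have "real (N + k) \<le> 3 * real N" using k x1 xN by simp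
      then have "real (N + k) / L \<le> 3 * real N / L" using L1 by (intro divide_right_mono) auto
      then show "real (N + k) / L \<le> 3 * x" by (simp add: x_def)
    qed (use C k x1 L1 in auto)
    finally have "psi N - real N \<le> real k + 6 * C * x" by simp
    moreover have "C * x \<ge> 0" using C x1 by simp
    ultimately show ?thesis using k x1 by (simp add: algebra_simps)
  qed
  have lower: "real N - psi N \<le> (2 + 20 * C) * x"
  proof -
    \<comment> \<open>A quarter of \<open>x\<close>, so that \<open>k \<le> N / 2\<close>: the left
      end \<open>M\<close> stays so large that \<open>M * M \<ge> N\<close>, hence
      \<open>ln M\<close> is at least half of \<open>ln N\<close>.\<close>
    define k where "k = nat \<lceil>x / 4\<rceil>"
    have k: "real k \<ge> x / 4" "real k \<le> x / 4 + 1" "k \<ge> 1" using x1 by (auto simp: k_def) linarith+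
    have "real k \<le> real N / 2" using k(2) xN N by simp
    then have k2: "2 * k \<le> N" by linarith
    define M where "M = N - k"
    have M: "N = M + k" "2 * M \<ge> N" "M \<ge> 3" using k2 N by (auto simp: M_def)
    have "L / 2 \<le> ln (real M)"
    proof -
      have "N * N \<le> (2 * M) * (2 * M)" using M(2) by (intro mult_mono) auto
      moreover have "4 * N \<le> N * N" using N by (intro mult_right_mono) auto
      ultimately have "4 * N \<le> 4 * (M * M)" by linarith
      then have "N \<le> M * M" by linarith
      then have "real N \<le> real M * real M" by (metis of_nat_le_iff of_nat_mult)
      then have "L \<le> ln (real M * real M)" unfolding L_def using N M by (subst ln_le_cancel_iff) auto
      also have "\<dots> = 2 * ln (real M)" using M by (simp add: ln_mult)
      finally show ?thesis by simp
    qed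
    then have "C / (ln (real M))\<^sup>2 \<le> C / (L / 2)\<^sup>2"
      using C L1 by (intro divide_left_mono power_mono mult_pos_pos zero_less_power) auto
    also have "C / (L / 2)\<^sup>2 = 4 * (C / L\<^sup>2)" by (simp add: power_divide)
    finally have "psi_mean N - psi_mean M \<ge> - 5 * (C / L\<^sup>2)"
      using D[of N] D[OF M(3)] N unfolding L_def by linarith
    moreover have "psi_mean N - psi_mean M \<le> psi N * (1 / real M - 1 / real N) - (ln (real N) - ln (real M))"
      by (rule psi_mean_diff_le) (use M in auto)
    moreover have "ln (real M) - ln (real N) \<le> - real k / real N"
      using ln_diff_le[of "real M" "real N"] M by simp
    ultimately have "real k / real N - 5 * (C / L\<^sup>2) \<le> psi N * (1 / real M - 1 / real N)" by simp
    moreover have "1 / real M - 1 / real N = real k / (real N * real M)"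
      using M N by (simp add: divide_simps)
    ultimately have "(real k / real N - 5 * (C / L\<^sup>2)) * (real N * real M / real k)
        \<le> psi N * (real k / (real N * real M)) * (real N * real M / real k)"
      by (intro mult_right_mono) auto
    also have "\<dots> = psi N"
      using N k M(3) by simp
    also have "(real k / real N - 5 * (C / L\<^sup>2)) * (real N * real M / real k)
       = real M - 5 * C * (real M / L) * (x / real k)"
      using N k L1 by (simp add: x_def field_simps power2_eq_square)
    finally have "real M - 5 * C * (real M / L) * (x / real k) \<le> psi N" .
    moreover have "5 * C * (real M / L) * (x / real k) \<le> 5 * C * x * 4"
    proof (intro mult_mono mult_nonneg_nonneg)
      show "real M / L \<le> x" unfolding x_def using M L1 by (intro divide_right_mono) auto
      show "x / real k \<le> 4" using k by (simp add: divide_le_eq)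
    qed (use C k x1 L1 in auto)
    ultimately have "real N - psi N \<le> real k + 20 * C * x" using M(1) by simp
    then show ?thesis using k x1 by (simp add: algebra_simps)
  qed
  from upper lower show ?thesis by (simp add: x_def L_def abs_le_iff)
qed

lemma psi_asymp: "\<exists>C>0. \<forall>N\<ge>2. \<bar>psi N - real N\<bar> \<le> C * (real N / ln (real N))"
proof -
  obtain C g where C: "C > 0" "\<And>N. N \<ge> 3 \<Longrightarrow> \<bar>psi_mean N - g\<bar> \<le> C / (ln (real N))\<^sup>2"
    using psi_mean_asymp by blast
  \<comment> \<open>The extra 40 covers \<open>N < 9\<close>, where the error is at most
    \<open>5 * N\<close> and \<open>ln N\<close> at most 8.\<close>
  have "\<bar>psi N - real N\<bar> \<le> (40 + 20 * C) * (real N / ln (real N))" if N: "N \<ge> 2" for N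
  proof (cases "N \<ge> 9")
    case True
    have "0 \<le> real N / ln (real N)" using N by simp
    then have "(2 + 20 * C) * (real N / ln (real N)) \<le> (40 + 20 * C) * (real N / ln (real N))"
      by (intro mult_right_mono) auto
    then show ?thesis using psi_asymp_large[OF C True] by linarith
  next
    case False
    have ln: "0 < ln (real N)" "ln (real N) \<le> 8"
      using N False less_imp_le[OF ln_less_self[of "real N"]] by auto
    have "\<bar>psi N - real N\<bar> \<le> 5 * real N" using psi_le[of N] psi_nonneg[of N] by simp
    also have "\<dots> \<le> 40 * (real N / ln (real N))"
      using ln mult_left_mono[OF ln(2), of "real N"] by (simp add: field_simps)
    also have "\<dots> \<le> (40 + 20 * C) * (real N / ln (real N))"
      using C(1) ln by (intro mult_right_mono) auto
    finally show ?thesis .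
  qed
  then show ?thesis using C(1) by (intro exI[of _ "40 + 20 * C"]) auto
qed

text \<open>In the convolution \<psi> occurs at every \<open>N - m\<close>, so one error for all
  \<open>k \<le> N\<close> is needed. Below the square root of \<open>N\<close> the trivial bound
  \<open>5 * k\<close> is good enough; above it \<open>ln k\<close> is at least half of
  \<open>ln N\<close>.\<close>

lemma psi_asymp_uniform:
  "\<exists>C>0. \<forall>N\<ge>2. \<forall>k\<le>N. \<bar>psi k - real k\<bar> \<le> C * (real N / ln (real N))"
proof -
  obtain C where C: "C > 0" "\<And>N. N \<ge> 2 \<Longrightarrow> \<bar>psi N - real N\<bar> \<le> C * (real N / ln (real N))"
    using psi_asymp by blast
  have "\<bar>psi k - real k\<bar> \<le> (2 * C + 10) * (real N / ln (real N))" if N: "N \<ge> 2" "k \<le> N" for N k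
  proof -
    have ln: "ln (real N) > 0" using N by simp
    show ?thesis
    proof (cases "k * k \<le> N")
      case True
      have s: "real k \<le> sqrt (real N)"
        by (rule real_le_rsqrt) (use True in \<open>metis of_nat_le_iff of_nat_mult power2_eq_square\<close>)
      have "ln (real N) = 2 * ln (sqrt (real N))" using N by (simp add: ln_sqrt)
      also have "\<dots> \<le> 2 * sqrt (real N)" using N by (intro mult_left_mono less_imp_le[OF ln_less_self]) auto
      finally have "real k * ln (real N) \<le> sqrt (real N) * (2 * sqrt (real N))"
        using s ln by (intro mult_mono) auto
      also have "\<dots> = 2 * (sqrt (real N) * sqrt (real N))" by (simp only: mult.left_commute)
      finally have "real k * ln (real N) \<le> 2 * real N" by simp
      then have "5 * real k \<le> 10 * (real N / ln (real N))" using ln by (simp add: field_simps)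
      moreover have "\<bar>psi k - real k\<bar> \<le> 5 * real k" using psi_le[of k] psi_nonneg[of k] by simp
      moreover have "10 * (real N / ln (real N)) \<le> (2 * C + 10) * (real N / ln (real N))"
        using C(1) ln by (intro mult_right_mono) auto
      ultimately show ?thesis by linarith
    next
      case False
      then have k: "k \<ge> 2" using N by (cases k; cases "k - 1") auto
      have "ln (real N) \<le> ln (real k * real k)"
        using False N k by (subst ln_le_cancel_iff) (auto simp flip: of_nat_mult)
      also have "\<dots> = 2 * ln (real k)" using k by (simp add: ln_mult)
      finally have l: "ln (real N) / 2 \<le> ln (real k)" by simp
      have "\<bar>psi k - real k\<bar> \<le> C * (real k / ln (real k))" by (rule C(2)[OF k])
      also have "\<dots> \<le> C * (real N / (ln (real N) / 2))"
        using l ln N C(1) by (intro mult_left_mono frac_le) auto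
      also have "\<dots> = 2 * C * (real N / ln (real N))" by simp
      also have "\<dots> \<le> (2 * C + 10) * (real N / ln (real N))"
        using ln by (intro mult_right_mono) auto
      finally show ?thesis .
    qed
  qed
  then show ?thesis using C(1) by (intro exI[of _ "2 * C + 10"]) auto
qed

section \<open>The convolution of the von Mangoldt function with \<open>psi\<close>\<close>

definition psi_conv :: "nat \<Rightarrow> real" where
  "psi_conv N = (\<Sum>m\<le>N. mangoldt m * psi (N - m))"

text \<open>The weight \<open>N - m\<close> counts the \<open>j\<close> with
  \<open>m \<le> j < N\<close>.\<close>

lemma sum_mangoldt_weighted: "(\<Sum>m\<le>N. mangoldt m * real (N - m)) = (\<Sum>j<N. psi j)"
proof (induction N)
  case (Suc N)
  have "(\<Sum>m\<le>Suc N. mangoldt m * real (Suc N - m)) = (\<Sum>m\<le>N. mangoldt m * real (N - m) + mangoldt m)"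
    by (simp add: of_nat_diff) (intro sum.cong refl, simp add: of_nat_diff algebra_simps)
  then show ?case by (simp only: sum.distrib Suc.IH psi_def sum.lessThan_Suc)
qed simp

text \<open>The prime number theorem is applied twice: replacing \<open>psi (N - m)\<close> by
  \<open>N - m\<close> costs \<open>psi N * E \<le> 4 * N * E\<close>; what is left is the sum of
  \<open>psi j\<close> over \<open>j < N\<close>, where replacing \<open>psi j\<close> by
  \<open>j\<close> costs \<open>N * E\<close>.\<close>

lemma psi_conv_asymp: "\<exists>C>0. \<forall>N\<ge>2. \<bar>psi_conv N - (real N)\<^sup>2 / 2\<bar> \<le> C * ((real N)\<^sup>2 / ln (real N))"
proof -
  obtain C where C: "C > 0" "\<And>N k. N \<ge> 2 \<Longrightarrow> k \<le> N \<Longrightarrow> \<bar>psi k - real k\<bar> \<le> C * (real N / ln (real N))"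
    using psi_asymp_uniform by blast
  have "\<bar>psi_conv N - (real N)\<^sup>2 / 2\<bar> \<le> (5 * C + 1) * ((real N)\<^sup>2 / ln (real N))" if N: "N \<ge> 2" for N
  proof -
    define E where "E = C * (real N / ln (real N))"
    have ln: "ln (real N) > 0" using N by simp
    have E: "E \<ge> 0" using C(1) ln by (simp add: E_def)
    have "\<bar>psi_conv N - (\<Sum>m\<le>N. mangoldt m * real (N - m))\<bar> = \<bar>\<Sum>m\<le>N. mangoldt m * (psi (N - m) - real (N - m))\<bar>"
      by (simp only: psi_conv_def right_diff_distrib sum_subtractf)
    also have "\<dots> \<le> (\<Sum>m\<le>N. mangoldt m * E)"
    proof (intro order.trans[OF sum_abs] sum_mono)
      fix m assume "m \<in> {..N}"
      have "mangoldt m * \<bar>psi (N - m) - real (N - m)\<bar> \<le> mangoldt m * E"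
        unfolding E_def by (intro mult_left_mono C(2)[OF N] mangoldt_nonneg) simp
      then show "\<bar>mangoldt m * (psi (N - m) - real (N - m))\<bar> \<le> mangoldt m * E"
        by (simp only: abs_mult abs_mangoldt)
    qed
    also have "\<dots> = psi N * E" by (simp add: psi_def sum_distrib_right)
    also have "\<dots> \<le> 4 * real N * E" using E by (intro mult_right_mono psi_le)
    finally have 1: "\<bar>psi_conv N - (\<Sum>j<N. psi j)\<bar> \<le> 4 * real N * E" by (simp only: sum_mangoldt_weighted)
    have "\<bar>(\<Sum>j<N. psi j) - (\<Sum>j<N. real j)\<bar> \<le> (\<Sum>j<N. \<bar>psi j - real j\<bar>)"
      unfolding sum_subtractf[symmetric] by (rule sum_abs)
    also have "\<dots> \<le> (\<Sum>j<N. E)"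
      using C(2)[OF N] by (intro sum_mono) (auto simp: E_def)
    finally have 2: "\<bar>(\<Sum>j<N. psi j) - (\<Sum>j<N. real j)\<bar> \<le> real N * E" by simp
    have 3: "(\<Sum>j<N. real j) = (real N)\<^sup>2 / 2 - real N / 2"
      by (induction N) (simp_all add: power2_eq_square field_simps)
    have "ln (real N) \<le> real N" by (rule less_imp_le[OF ln_less_self]) (use N in simp)
    then have "real N * ln (real N) \<le> real N * real N" by (intro mult_left_mono) auto
    then have 4: "real N \<le> (real N)\<^sup>2 / ln (real N)" using ln by (simp add: field_simps power2_eq_square)
    define X where "X = (real N)\<^sup>2 / ln (real N)"
    have "real N * E = C * X" by (simp add: E_def X_def power2_eq_square)
    then have "\<bar>psi_conv N - (\<Sum>j<N. psi j)\<bar> \<le> 4 * (C * X)" "\<bar>(\<Sum>j<N. psi j) - (\<Sum>j<N. real j)\<bar> \<le> C * X"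
      using 1 2 by (simp_all add: mult.assoc)
    with 3 4[folded X_def] have "\<bar>psi_conv N - (real N)\<^sup>2 / 2\<bar> \<le> 5 * (C * X) + X" by linarith
    then show ?thesis unfolding X_def[symmetric] by (simp add: distrib_right)
  qed
  then show ?thesis using C(1) by (intro exI[of _ "5 * C + 1"]) auto
qed

section \<open>From prime powers to odd primes\<close>

definition theta_odd :: "nat \<Rightarrow> real" where
  "theta_odd N = (\<Sum>k\<le>N. if prime k \<and> odd k then ln (real k) else 0)"

lemma odd_prime_le_mangoldt: "(if prime k \<and> odd k then ln (real k) else 0) \<le> mangoldt k"
  by (auto simp: mangoldt_nonneg)

lemma theta_odd_le_psi: "theta_odd N \<le> psi N"
  unfolding theta_odd_def psi_def by (intro sum_mono odd_prime_le_mangoldt)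

text \<open>Such an \<open>m = p ^ k\<close> has \<open>p * p \<le> N\<close>: either
  \<open>k \<ge> 2\<close>, or \<open>m = 2\<close>, which is covered by \<open>N \<ge> 4\<close>.
  Moreover \<open>k \<le> 2 * ln N\<close> because \<open>ln 2 \<ge> 1/2\<close>. So
  \<open>m\<close> is determined by a base and an exponent from short ranges.\<close>

lemma card_other_primepows:
  assumes "N \<ge> 4"
  shows "real (card {m. m \<le> N \<and> primepow m \<and> \<not> (prime m \<and> odd m)}) \<le> (sqrt (real N) + 1) * (2 * ln (real N) + 1)"
proof -
  define s where "s = nat \<lfloor>sqrt (real N)\<rfloor>"
  define l where "l = nat \<lfloor>2 * ln (real N)\<rfloor>"
  have lnN: "ln (real N) \<ge> 0" using assms by simp
  have "{m. m \<le> N \<and> primepow m \<and> \<not> (prime m \<and> odd m)} \<subseteq> (\<lambda>(a, k). a ^ k) ` ({..s} \<times> {..l})"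
  proof
    fix m assume "m \<in> {m. m \<le> N \<and> primepow m \<and> \<not> (prime m \<and> odd m)}"
    then have m: "m \<le> N" "primepow m" "\<not> (prime m \<and> odd m)" by auto
    from m(2) obtain p k where pk: "prime p" "k > 0" "m = p ^ k" by (auto simp: primepow_def)
    have p2: "p \<ge> 2" using pk(1) by (rule prime_ge_2_nat)
    have "2 ^ k \<le> N" using power_mono[OF p2, of k] m(1) pk(3) by simp
    then have "2 ^ k \<le> real N" by (metis of_nat_le_iff of_nat_numeral of_nat_power)
    then have "ln (2 ^ k) \<le> ln (real N)" using assms by (subst ln_le_cancel_iff) auto
    then have "real k * ln 2 \<le> ln (real N)" by (simp add: ln_realpow)
    moreover have "real k * (1/2) \<le> real k * ln 2" using ln2_ge_two_thirds by (intro mult_left_mono) auto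
    ultimately have "real k \<le> 2 * ln (real N)" by simp
    then have kl: "k \<le> l" unfolding l_def by (rule le_nat_floor)
    have "p * p \<le> N"
    proof (cases "k = 1")
      case True
      then have "p = 2" using m(3) pk prime_odd_nat[of p] p2 by (cases "p = 2") auto
      then show ?thesis using assms by simp
    next
      case False
      then have "k \<ge> 2" using pk(2) by simp
      then have "p ^ 2 \<le> p ^ k" using p2 by (intro power_increasing) auto
      then show ?thesis using m(1) pk(3) by (simp add: power2_eq_square)
    qed
    then have "(real p)\<^sup>2 \<le> real N" by (metis of_nat_le_iff of_nat_mult power2_eq_square)
    then have "real p \<le> sqrt (real N)" by (rule real_le_rsqrt)
    then have "p \<le> s" unfolding s_def by (rule le_nat_floor)
    with kl pk(3) show "m \<in> (\<lambda>(a, k). a ^ k) ` ({..s} \<times> {..l})" by (auto intro!: image_eqI[of _ _ "(p, k)"])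
  qed
  then have "card {m. m \<le> N \<and> primepow m \<and> \<not> (prime m \<and> odd m)} \<le> card ((\<lambda>(a, k). a ^ k) ` ({..s} \<times> {..l}))"
    by (intro card_mono) auto
  also have "\<dots> \<le> card ({..s} \<times> {..l})" by (rule card_image_le) simp
  also have "\<dots> = (s + 1) * (l + 1)" by (simp add: card_cartesian_product)
  finally have "real (card {m. m \<le> N \<and> primepow m \<and> \<not> (prime m \<and> odd m)}) \<le> real ((s + 1) * (l + 1))"
    by (rule of_nat_mono)
  also have "\<dots> = (real s + 1) * (real l + 1)" by (simp add: algebra_simps)
  also have "\<dots> \<le> (sqrt (real N) + 1) * (2 * ln (real N) + 1)"
  proof (intro mult_mono add_mono order.refl)
    show "real s \<le> sqrt (real N)" unfolding s_def by (rule of_nat_floor) simp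
    show "real l \<le> 2 * ln (real N)" unfolding l_def by (rule of_nat_floor) (use lnN in simp)
  qed auto
  finally show ?thesis .
qed

lemma psi_minus_theta_odd:
  assumes "N \<ge> 4"
  shows "psi N - theta_odd N \<le> (sqrt (real N) + 1) * (2 * ln (real N) + 1) * ln (real N)"
proof -
  let ?B = "{m. m \<le> N \<and> primepow m \<and> \<not> (prime m \<and> odd m)}"
  have lnN: "ln (real N) \<ge> 0" using assms by simp
  have "psi N - theta_odd N = (\<Sum>m\<le>N. mangoldt m - (if prime m \<and> odd m then ln (real m) else 0))"
    by (simp only: psi_def theta_odd_def sum_subtractf)
  also have "\<dots> = (\<Sum>m\<in>?B. mangoldt m)"
    by (rule sum.mono_neutral_cong_right) (auto simp: mangoldt_def)
  also have "\<dots> \<le> (\<Sum>m\<in>?B. ln (real N))"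
  proof (rule sum_mono)
    fix m assume "m \<in> ?B"
    then have m: "m > 0" "m \<le> N" using primepow_gt_0_nat by auto
    have "mangoldt m \<le> ln (real m)" by (rule mangoldt_le) (use m in simp)
    also have "\<dots> \<le> ln (real N)" using m by simp
    finally show "mangoldt m \<le> ln (real N)" .
  qed
  also have "\<dots> = real (card ?B) * ln (real N)" by simp
  also have "\<dots> \<le> (sqrt (real N) + 1) * (2 * ln (real N) + 1) * ln (real N)"
    by (intro mult_right_mono card_other_primepows assms lnN)
  finally show ?thesis .
qed

definition theta_conv :: "nat \<Rightarrow> real" where
  "theta_conv N = (\<Sum>m\<le>N. (if prime m \<and> odd m then ln (real m) else 0) * theta_odd (N - m))"

lemma psi_diff_theta_odd_mono: "k \<le> N \<Longrightarrow> psi k - theta_odd k \<le> psi N - theta_odd N"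
  unfolding psi_def theta_odd_def sum_subtractf[symmetric]
  using odd_prime_le_mangoldt by (intro sum_mono2) (simp_all add: le_diff_eq)

text \<open>The two factors are exchanged one at a time. Each exchange costs at most
  \<open>psi N\<close> times the total weight \<open>r\<close> of the discarded prime
  powers.\<close>

lemma psi_conv_minus_theta_conv:
  "psi_conv N - theta_conv N \<le> 8 * real N * (psi N - theta_odd N)"
proof -
  let ?w = "\<lambda>m. if prime m \<and> odd m then ln (real m) else 0"
  define r where "r = psi N - theta_odd N"
  have r: "r \<ge> 0" using theta_odd_le_psi by (simp add: r_def)
  have "psi_conv N - theta_conv N = (\<Sum>m\<le>N. mangoldt m * psi (N - m) - ?w m * theta_odd (N - m))"
    by (simp only: psi_conv_def theta_conv_def sum_subtractf)
  also have "\<dots> \<le> (\<Sum>m\<le>N. (mangoldt m - ?w m) * psi N + mangoldt m * r)"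
  proof (rule sum_mono)
    fix m assume "m \<in> {..N}"
    have "mangoldt m * psi (N - m) - ?w m * theta_odd (N - m)
      = (mangoldt m - ?w m) * psi (N - m) + ?w m * (psi (N - m) - theta_odd (N - m))"
      by (simp add: algebra_simps)
    also have "\<dots> \<le> (mangoldt m - ?w m) * psi N + mangoldt m * r"
    proof (intro add_mono mult_mono psi_mono odd_prime_le_mangoldt mult_left_mono)
      show "0 \<le> mangoldt m - ?w m" using odd_prime_le_mangoldt[of m] by simp
      show "psi (N - m) - theta_odd (N - m) \<le> r" unfolding r_def by (rule psi_diff_theta_odd_mono) simp
    qed (auto simp: mangoldt_nonneg psi_nonneg theta_odd_le_psi)
    finally show "mangoldt m * psi (N - m) - ?w m * theta_odd (N - m) \<le> (mangoldt m - ?w m) * psi N + mangoldt m * r" .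
  qed
  also have "\<dots> = (psi N - theta_odd N) * psi N + psi N * r"
    by (simp only: sum.distrib sum_distrib_right[symmetric] sum_subtractf psi_def theta_odd_def)
  also have "\<dots> = psi N * (2 * r)" by (simp add: r_def algebra_simps)
  also have "\<dots> \<le> 4 * real N * (2 * r)" using r by (intro mult_right_mono psi_le) auto
  finally show ?thesis by (simp add: r_def mult_ac)
qed

section \<open>From weighted to unweighted counts of pairs\<close>

definition goldbach_pairs :: "nat \<Rightarrow> nat" where
  "goldbach_pairs N = card {(p, q). prime p \<and> odd p \<and> prime q \<and> odd q \<and> p + q \<le> N}"

lemma goldbach_pairs_eq:
  "real (goldbach_pairs N) = (\<Sum>m\<le>N. \<Sum>k\<le>N - m. if prime m \<and> odd m \<and> prime k \<and> odd k then 1 else 0)"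
proof -
  let ?T = "Sigma {..N} (\<lambda>m. {..N - m})"
  let ?A = "{(p, q). prime p \<and> odd p \<and> prime q \<and> odd q \<and> p + q \<le> N}"
  have "?A = ?T \<inter> {(p, q). prime p \<and> odd p \<and> prime q \<and> odd q}" by auto
  then have "real (card ?A) = (\<Sum>x\<in>?T. if x \<in> {(p, q). prime p \<and> odd p \<and> prime q \<and> odd q} then 1 else 0)"
    by (simp add: sum.If_cases)
  also have "\<dots> = (\<Sum>m\<le>N. \<Sum>k\<le>N - m. if prime m \<and> odd m \<and> prime k \<and> odd k then 1 else 0)"
    by (subst sum.Sigma) (auto intro!: sum.cong)
  finally show ?thesis by (simp add: goldbach_pairs_def)
qed

lemma goldbach_pairs_le_square: "real (goldbach_pairs N) \<le> (real N)\<^sup>2"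
proof -
  have "{(p, q). prime p \<and> odd p \<and> prime q \<and> odd q \<and> p + q \<le> N} \<subseteq> {1..N} \<times> {1..N}"
    using prime_gt_0_nat by (fastforce simp: Suc_le_eq)
  then have "goldbach_pairs N \<le> card ({1..N} \<times> {1..N})"
    unfolding goldbach_pairs_def by (rule card_mono[rotated]) simp
  then have "goldbach_pairs N \<le> N * N" by (simp add: card_cartesian_product)
  then show ?thesis by (metis of_nat_le_iff of_nat_mult power2_eq_square)
qed

lemma theta_conv_le_goldbach_pairs: "theta_conv N \<le> real (goldbach_pairs N) * (ln (real N))\<^sup>2"
proof -
  have "theta_conv N = (\<Sum>m\<le>N. \<Sum>k\<le>N - m. (if prime m \<and> odd m then ln (real m) else 0) * (if prime k \<and> odd k then ln (real k) else 0))"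
    by (simp only: theta_conv_def theta_odd_def sum_distrib_left)
  also have "\<dots> \<le> (\<Sum>m\<le>N. \<Sum>k\<le>N - m. (if prime m \<and> odd m \<and> prime k \<and> odd k then 1 else 0) * (ln (real N))\<^sup>2)"
  proof (intro sum_mono)
    fix m k assume mk: "m \<in> {..N}" "k \<in> {..N - m}"
    have "ln (real m) * ln (real k) \<le> (ln (real N))\<^sup>2" if "prime m" "prime k"
      unfolding power2_eq_square using that mk prime_gt_1_nat[of m] prime_gt_1_nat[of k]
      by (intro mult_mono) auto
    then show "(if prime m \<and> odd m then ln (real m) else 0) * (if prime k \<and> odd k then ln (real k) else 0)
       \<le> (if prime m \<and> odd m \<and> prime k \<and> odd k then 1 else 0) * (ln (real N))\<^sup>2" by auto
  qed
  also have "\<dots> = real (goldbach_pairs N) * (ln (real N))\<^sup>2"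
    by (simp only: goldbach_pairs_eq sum_distrib_right)
  finally show ?thesis .
qed

text \<open>Pairs with a member up to \<open>y\<close> are counted without using primality; for
  every other pair the product of the weights is at least \<open>(ln y)\<^sup>2\<close>.\<close>

lemma goldbach_pairs_upper:
  assumes "y \<ge> 2"
  shows "real (goldbach_pairs N) \<le> 2 * (real y + 1) * (real N + 1) + psi_conv N / (ln (real y))\<^sup>2"
proof -
  have lny: "ln (real y) > 0" using assms by simp
  have "real (goldbach_pairs N) \<le> (\<Sum>m\<le>N. \<Sum>k\<le>N - m. (if m \<le> y then 1 else 0) + (if k \<le> y then 1 else 0) + mangoldt m * mangoldt k / (ln (real y))\<^sup>2)"
    unfolding goldbach_pairs_eq
  proof (intro sum_mono)
    fix m k
    have "1 \<le> mangoldt m * mangoldt k / (ln (real y))\<^sup>2" if "prime m" "prime k" "m > y" "k > y"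
    proof -
      have "(ln (real y))\<^sup>2 \<le> ln (real m) * ln (real k)"
        unfolding power2_eq_square using that assms by (intro mult_mono) auto
      then show ?thesis using that lny by (simp add: le_divide_eq)
    qed
    moreover have "0 \<le> mangoldt m * mangoldt k / (ln (real y))\<^sup>2" by (simp add: mangoldt_nonneg)
    ultimately show "(if prime m \<and> odd m \<and> prime k \<and> odd k then 1 else 0)
      \<le> (if m \<le> y then 1 else 0) + (if k \<le> y then 1 else 0) + mangoldt m * mangoldt k / (ln (real y))\<^sup>2"
      by auto
  qed
  also have "\<dots> = (\<Sum>m\<le>N. \<Sum>k\<le>N - m. if m \<le> y then 1 else 0) + (\<Sum>m\<le>N. \<Sum>k\<le>N - m. if k \<le> y then 1 else 0)
      + psi_conv N / (ln (real y))\<^sup>2"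
    by (simp only: sum.distrib psi_conv_def psi_def sum_distrib_left sum_divide_distrib)
  also have "(\<Sum>m\<le>N. \<Sum>k\<le>N - m. if m \<le> y then 1 else 0 :: real) \<le> (real y + 1) * (real N + 1)"
  proof -
    have "(\<Sum>m\<le>N. \<Sum>k\<le>N - m. if m \<le> y then 1 else 0 :: real) \<le> (\<Sum>m\<le>N. if m \<le> y then real N + 1 else 0)"
      by (intro sum_mono) auto
    also have "\<dots> = real (card ({..N} \<inter> {m. m \<le> y})) * (real N + 1)"
      by (simp add: sum.If_cases)
    also have "card ({..N} \<inter> {m. m \<le> y}) \<le> card {..y}" by (intro card_mono) auto
    then have "real (card ({..N} \<inter> {m. m \<le> y})) * (real N + 1) \<le> (real y + 1) * (real N + 1)"
      by (intro mult_right_mono) auto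
    finally show ?thesis .
  qed
  also have "(\<Sum>m\<le>N. \<Sum>k\<le>N - m. if k \<le> y then 1 else 0 :: real) \<le> (real y + 1) * (real N + 1)"
  proof -
    have "(\<Sum>k\<le>N - m. if k \<le> y then 1 else 0 :: real) \<le> real y + 1" for m
    proof -
      have "card ({..N - m} \<inter> {k. k \<le> y}) \<le> card {..y}" by (intro card_mono) auto
      then show ?thesis by (simp add: sum.If_cases)
    qed
    then have "(\<Sum>m\<le>N. \<Sum>k\<le>N - m. if k \<le> y then 1 else 0 :: real) \<le> (\<Sum>m\<le>N. real y + 1)"
      by (intro sum_mono)
    then show ?thesis by (simp add: algebra_simps)
  qed
  finally show ?thesis by (simp add: algebra_simps)
qed

lemma goldbach_pairs_asymp:
  "\<exists>C>0. \<forall>\<^sub>F N in sequentially. \<bar>real (goldbach_pairs N) - (real N)\<^sup>2 / (2 * (ln (real N))\<^sup>2)\<bar>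
     \<le> C * ((real N)\<^sup>2 * ln (ln (real N)) / ln (real N) ^ 3)"
proof -
  obtain C where C: "C > 0" "\<And>N. N \<ge> 2 \<Longrightarrow> \<bar>psi_conv N - (real N)\<^sup>2 / 2\<bar> \<le> C * ((real N)\<^sup>2 / ln (real N))"
    using psi_conv_asymp by blast
  \<comment> \<open>With \<open>x = ln N\<close> this is the loss in the upper bound, as the cut-off
    \<open>y\<close> satisfies \<open>ln y \<ge> x - 3 * ln x\<close>. The leading term of the
    difference is \<open>3 * ln x / x ^ 3\<close>, the source of the double logarithm; the lower
    bound loses only a multiple of \<open>1 / x ^ 3\<close>.\<close>
  have "(\<lambda>x::real. (1/2 + C / x) / (x - 3 * ln x)\<^sup>2 - 1 / (2 * x\<^sup>2)) \<in> O(\<lambda>x. ln x / x ^ 3)"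
    by real_asymp
  then obtain C' where C': "C' > 0" "\<forall>\<^sub>F x::real in at_top.
      norm ((1/2 + C / x) / (x - 3 * ln x)\<^sup>2 - 1 / (2 * x\<^sup>2)) \<le> C' * norm (ln x / x ^ 3)"
    by (rule landau_o.bigE)
  have lim: "filterlim (\<lambda>N. ln (real N)) at_top sequentially" by real_asymp
  have ev_x: "\<forall>\<^sub>F x::real in at_top. ln x \<ge> 1 \<and> x \<ge> 1 \<and> x - 3 * ln x > 0"
    by (intro eventually_conj; real_asymp)
  \<comment> \<open>The first condition keeps the cut-off above 1; the second lets the contribution
    of the discarded prime powers disappear in \<open>N / ln N\<close>.\<close>
  have ev1: "\<forall>\<^sub>F N::nat in sequentially. real N / ln (real N) ^ 3 > 1 \<and>
     (sqrt (real N) + 1) * (2 * ln (real N) + 1) * ln (real N) \<le> real N / ln (real N)"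
    by (intro eventually_conj; real_asymp)
  have "\<forall>\<^sub>F N in sequentially. \<bar>real (goldbach_pairs N) - (real N)\<^sup>2 / (2 * (ln (real N))\<^sup>2)\<bar>
     \<le> (12 + C' + C + 8) * ((real N)\<^sup>2 * ln (ln (real N)) / ln (real N) ^ 3)"
    using ev1 eventually_compose_filterlim[OF ev_x lim] eventually_compose_filterlim[OF C'(2) lim] eventually_ge_at_top[of 4]
  proof eventually_elim
    case (elim N)
    define L where "L = ln (real N)"
    define X where "X = (real N)\<^sup>2 * ln L / L ^ 3"
    have L: "L \<ge> 1" "ln L \<ge> 1" "L - 3 * ln L > 0" using elim unfolding L_def by auto
    have N: "N \<ge> 4" by fact
    have big: "real N / L ^ 3 > 1" using elim unfolding L_def by auto
    have X0: "(real N)\<^sup>2 / L ^ 3 \<le> X"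
      unfolding X_def using L by (intro divide_right_mono) (auto simp: mult_le_cancel_left1)
    have pc: "\<bar>psi_conv N - (real N)\<^sup>2 / 2\<bar> \<le> C * ((real N)\<^sup>2 / L)"
      using C(2)[of N] N by (simp add: L_def)
    have lower: "(real N)\<^sup>2 / (2 * L\<^sup>2) - real (goldbach_pairs N) \<le> (C + 8) * X"
    proof -
      have "psi N - theta_odd N \<le> real N / L"
        using psi_minus_theta_odd[OF N] elim unfolding L_def by linarith
      then have "8 * real N * (psi N - theta_odd N) \<le> 8 * real N * (real N / L)"
        by (intro mult_left_mono) auto
      also have "\<dots> = 8 * ((real N)\<^sup>2 / L)" by (simp add: power2_eq_square)
      finally have "(real N)\<^sup>2 / 2 - (C + 8) * ((real N)\<^sup>2 / L) \<le> theta_conv N"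
        using psi_conv_minus_theta_conv[of N] pc unfolding distrib_right by linarith
      also have "\<dots> \<le> real (goldbach_pairs N) * L\<^sup>2"
        unfolding L_def by (rule theta_conv_le_goldbach_pairs)
      finally have "((real N)\<^sup>2 / 2 - (C + 8) * ((real N)\<^sup>2 / L)) / L\<^sup>2 \<le> real (goldbach_pairs N)"
        using L by (simp add: divide_le_eq)
      moreover have "((real N)\<^sup>2 / 2 - (C + 8) * ((real N)\<^sup>2 / L)) / L\<^sup>2
          = (real N)\<^sup>2 / (2 * L\<^sup>2) - (C + 8) * ((real N)\<^sup>2 / L ^ 3)"
        using L by (simp add: diff_divide_distrib power2_eq_square power3_eq_cube)
      moreover have "(C + 8) * ((real N)\<^sup>2 / L ^ 3) \<le> (C + 8) * X"
        using X0 C(1) by (intro mult_left_mono) auto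
      ultimately show ?thesis by linarith
    qed
    have upper: "real (goldbach_pairs N) - (real N)\<^sup>2 / (2 * L\<^sup>2) \<le> (12 + C') * X"
    proof -
      define y where "y = nat \<lceil>real N / L ^ 3\<rceil>"
      have y: "real y \<ge> real N / L ^ 3" "real y \<le> real N / L ^ 3 + 1" using big by (auto simp: y_def)
      have y2: "y \<ge> 2" using y(1) big by linarith
      have lny: "ln (real y) \<ge> L - 3 * ln L"
      proof -
        have "L - 3 * ln L = ln (real N / L ^ 3)" using L N by (simp add: ln_div ln_realpow L_def)
        also have "\<dots> \<le> ln (real y)" using y(1) big y2 by (subst ln_le_cancel_iff) auto
        finally show ?thesis .
      qed
      have "2 * (real y + 1) * (real N + 1) \<le> 12 * ((real N)\<^sup>2 / L ^ 3)"
      proof -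
        have "real y + 1 \<le> 3 * (real N / L ^ 3)" using y(2) big by linarith
        moreover have "real N + 1 \<le> 2 * real N" using N by simp
        ultimately have "(real y + 1) * (real N + 1) \<le> (3 * (real N / L ^ 3)) * (2 * real N)"
          by (intro mult_mono) auto
        moreover have "2 * ((3 * (real N / L ^ 3)) * (2 * real N)) = 12 * ((real N)\<^sup>2 / L ^ 3)"
          by (simp add: power2_eq_square)
        ultimately show ?thesis unfolding mult.assoc[of 2] by linarith
      qed
      moreover have "psi_conv N / (ln (real y))\<^sup>2 \<le> (real N)\<^sup>2 / (2 * L\<^sup>2) + C' * X"
      proof -
        have "psi_conv N / (ln (real y))\<^sup>2 \<le> (real N)\<^sup>2 * (1/2 + C / L) / (L - 3 * ln L)\<^sup>2"
        proof (intro frac_le power_mono)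
          show "psi_conv N \<le> (real N)\<^sup>2 * (1/2 + C / L)" using pc by (simp add: distrib_left abs_le_iff mult.commute)
          show "0 \<le> (real N)\<^sup>2 * (1/2 + C / L)" using C(1) L by simp
        qed (use L lny in auto)
        also have "\<dots> = (real N)\<^sup>2 * ((1/2 + C / L) / (L - 3 * ln L)\<^sup>2)" by simp
        also have "\<dots> \<le> (real N)\<^sup>2 * (1 / (2 * L\<^sup>2) + C' * (ln L / L ^ 3))"
        proof (intro mult_left_mono)
          have "norm ((1/2 + C / L) / (L - 3 * ln L)\<^sup>2 - 1 / (2 * L\<^sup>2)) \<le> C' * norm (ln L / L ^ 3)"
            using elim unfolding L_def by blast
          moreover have "norm (ln L / L ^ 3) = ln L / L ^ 3" using L by simp
          ultimately show "(1/2 + C / L) / (L - 3 * ln L)\<^sup>2 \<le> 1 / (2 * L\<^sup>2) + C' * (ln L / L ^ 3)"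
            unfolding real_norm_def by linarith
        qed simp
        also have "\<dots> = (real N)\<^sup>2 / (2 * L\<^sup>2) + C' * X"
          by (simp add: X_def distrib_left)
        finally show ?thesis .
      qed
      moreover have "12 * ((real N)\<^sup>2 / L ^ 3) \<le> 12 * X" using X0 by simp
      ultimately show ?thesis
        using goldbach_pairs_upper[OF y2, of N] unfolding distrib_right by linarith
    qed
    have "X \<ge> 0" using L by (simp add: X_def)
    then have "(12 + C') * X \<ge> 0" "(C + 8) * X \<ge> 0" using C(1) C'(1) by auto
    then have "\<bar>real (goldbach_pairs N) - (real N)\<^sup>2 / (2 * L\<^sup>2)\<bar> \<le> (12 + C') * X + (C + 8) * X"
      using lower upper by linarith
    then show ?case unfolding X_def L_def by (simp only: distrib_right add.assoc)
  qed
  then show ?thesis using C(1) C'(1) by (intro exI[of _ "12 + C' + C + 8"]) auto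
qed

section \<open>Partial sums of the inverse squares and the shifted main term\<close>

lemma sum_inverse_squares_tail:
  assumes "1 \<le> K" "K \<le> N"
  shows "(\<Sum>k\<in>{Suc K..N}. 1 / (real k)\<^sup>2) \<le> 1 / real K"
proof -
  have "(\<Sum>k\<in>{Suc K..N}. 1 / (real k)\<^sup>2) \<le> 1 / real K - 1 / real N"
    using assms(2)
  proof (induction N rule: dec_induct)
    case (step n)
    have "1 / (real (Suc n))\<^sup>2 \<le> 1 / (real n * real (Suc n))"
      using step assms(1) by (intro divide_left_mono) (auto simp: power2_eq_square)
    also have "\<dots> = 1 / real n - 1 / real (Suc n)"
      using step assms(1) by (simp add: divide_simps)
    finally show ?case using step by simp
  qed simp
  also have "\<dots> \<le> 1 / real K" by simp
  finally show ?thesis .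
qed

lemma sum_inverse_squares_approx:
  assumes "1 \<le> K"
  shows "(\<Sum>k\<in>{1..K}. 1 / (real k)\<^sup>2) \<le> pi\<^sup>2 / 6" "pi\<^sup>2 / 6 - (\<Sum>k\<in>{1..K}. 1 / (real k)\<^sup>2) \<le> 1 / real K"
proof -
  have shift: "(\<Sum>n<N. 1 / (real n + 1)\<^sup>2) = (\<Sum>k\<in>{1..N}. 1 / (real k)\<^sup>2)" for N
    by (induction N) (auto simp: add.commute)
  have lim: "(\<lambda>N. \<Sum>k\<in>{1..N}. 1 / (real k)\<^sup>2) \<longlonglongrightarrow> pi\<^sup>2 / 6"
  proof -
    have "(\<lambda>n. 1 / (real n + 1)\<^sup>2) sums (pi\<^sup>2 / 6)"
      using inverse_squares_sums by (simp add: add.commute)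
    then show ?thesis unfolding sums_def shift .
  qed
  have split: "(\<Sum>k\<in>{1..N}. 1 / (real k)\<^sup>2) = (\<Sum>k\<in>{1..K}. 1 / (real k)\<^sup>2) + (\<Sum>k\<in>{Suc K..N}. 1 / (real k)\<^sup>2)"
    if "N \<ge> K" for N
  proof -
    have "{1..N} = {1..K} \<union> {Suc K..N}" using that by auto
    then show ?thesis by (simp add: sum.union_disjoint)
  qed
  show "(\<Sum>k\<in>{1..K}. 1 / (real k)\<^sup>2) \<le> pi\<^sup>2 / 6"
  proof (rule tendsto_lowerbound[OF lim])
    show "\<forall>\<^sub>F N in sequentially. (\<Sum>k\<in>{1..K}. 1 / (real k)\<^sup>2) \<le> (\<Sum>k\<in>{1..N}. 1 / (real k)\<^sup>2)"
      using eventually_ge_at_top[of K]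
    proof eventually_elim
      case (elim N)
      show ?case unfolding split[OF elim] by (simp add: sum_nonneg)
    qed
  qed simp
  have "pi\<^sup>2 / 6 \<le> (\<Sum>k\<in>{1..K}. 1 / (real k)\<^sup>2) + 1 / real K"
  proof (rule tendsto_upperbound[OF lim])
    show "\<forall>\<^sub>F N in sequentially. (\<Sum>k\<in>{1..N}. 1 / (real k)\<^sup>2) \<le> (\<Sum>k\<in>{1..K}. 1 / (real k)\<^sup>2) + 1 / real K"
      using eventually_ge_at_top[of K]
    proof eventually_elim
      case (elim N)
      show ?case unfolding split[OF elim] using sum_inverse_squares_tail[OF assms elim] by simp
    qed
  qed simp
  then show "pi\<^sup>2 / 6 - (\<Sum>k\<in>{1..K}. 1 / (real k)\<^sup>2) \<le> 1 / real K" by simp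
qed

text \<open>Here \<open>u\<close> will be \<open>2 * M / k\<close>, \<open>n\<close> its integer
  part, \<open>l = ln n\<close> and \<open>L = ln M\<close>. In units of
  \<open>E = u\<^sup>2 * ln L / L ^ 3\<close>, the given error costs \<open>16 * C\<close>, the
  passage from \<open>n\<close> to \<open>u\<close> costs 4, and the passage from \<open>l\<close>
  to \<open>L\<close> costs 18. The last one uses \<open>|L - l| \<le> 3 * ln L\<close> and is where
  arguments much smaller than \<open>M\<close> are paid for.\<close>

lemma pairs_main_term_shift:
  fixes u n l L S C :: real
  assumes S: "\<bar>S - n\<^sup>2 / (2 * l\<^sup>2)\<bar> \<le> C * (n\<^sup>2 * ln l / l ^ 3)" and C: "C \<ge> 0"
    and n: "u - 1 \<le> n" "n \<le> u" "n \<ge> 0" and L: "L \<ge> 2" "ln L \<ge> 1" "L \<le> u"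
    and l: "L / 2 \<le> l" "L - 3 * ln L \<le> l" "l \<le> L + 1"
  shows "\<bar>S - u\<^sup>2 / (2 * L\<^sup>2)\<bar> \<le> (16 * C + 22) * (u\<^sup>2 * (ln L / L ^ 3))"
proof -
  define E where "E = u\<^sup>2 * (ln L / L ^ 3)"
  have l1: "l \<ge> 1" "l \<le> 2 * L" using l L by auto
  have 1: "C * (n\<^sup>2 * ln l / l ^ 3) \<le> 16 * C * E"
  proof -
    have "ln l \<le> ln (2 * L)" using l1 L by (subst ln_le_cancel_iff) auto
    also have "\<dots> = ln 2 + ln L" using L by (simp add: ln_mult)
    also have "\<dots> \<le> 2 * ln L" using ln_2_less_1 L by linarith
    finally have "n\<^sup>2 * ln l / l ^ 3 \<le> u\<^sup>2 * (2 * ln L) / (L / 2) ^ 3"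
      using n L l l1 by (intro frac_le mult_mono power_mono) auto
    also have "\<dots> = 16 * E" by (simp add: E_def power_divide)
    finally show ?thesis using C mult_left_mono[of _ _ C] by fastforce
  qed
  have 2: "\<bar>n\<^sup>2 / (2 * l\<^sup>2) - u\<^sup>2 / (2 * l\<^sup>2)\<bar> \<le> 4 * E"
  proof -
    have "n\<^sup>2 \<le> u\<^sup>2" using n by (intro power_mono) auto
    then have "\<bar>n\<^sup>2 - u\<^sup>2\<bar> = (u - n) * (u + n)" by (simp add: power2_eq_square algebra_simps)
    also have "\<dots> \<le> 1 * (2 * u)" using n L by (intro mult_mono) auto
    finally have "\<bar>n\<^sup>2 - u\<^sup>2\<bar> / (2 * l\<^sup>2) \<le> 2 * u / (2 * (L / 2)\<^sup>2)"
      using l L by (intro frac_le mult_left_mono power_mono) auto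
    also have "\<dots> = 4 * (u * (1 / L\<^sup>2))" by (simp add: power_divide)
    also have "u * (1 / L\<^sup>2) \<le> u * (u / L ^ 3)"
      using L by (intro mult_left_mono) (auto simp: power2_eq_square power3_eq_cube divide_simps)
    also have "u * (u / L ^ 3) = u\<^sup>2 * (1 / L ^ 3)" by (simp add: power2_eq_square)
    also have "u\<^sup>2 * (1 / L ^ 3) \<le> E" unfolding E_def using L by (intro mult_left_mono divide_right_mono) auto
    finally show ?thesis using l1 by (simp add: diff_divide_distrib[symmetric])
  qed
  have 3: "\<bar>u\<^sup>2 / (2 * l\<^sup>2) - u\<^sup>2 / (2 * L\<^sup>2)\<bar> \<le> 18 * E"
  proof -
    have "u\<^sup>2 / (2 * l\<^sup>2) - u\<^sup>2 / (2 * L\<^sup>2) = u\<^sup>2 / 2 * ((L - l) * (L + l) / (l\<^sup>2 * L\<^sup>2))"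
      using l1 L by (simp add: divide_simps power2_eq_square) (simp add: algebra_simps)
    then have "\<bar>u\<^sup>2 / (2 * l\<^sup>2) - u\<^sup>2 / (2 * L\<^sup>2)\<bar> = u\<^sup>2 / 2 * (\<bar>L - l\<bar> * (L + l) / (l\<^sup>2 * L\<^sup>2))"
      using l1 L by (simp add: abs_mult)
    also have "\<bar>L - l\<bar> * (L + l) / (l\<^sup>2 * L\<^sup>2) \<le> (3 * ln L) * (3 * L) / ((L / 2)\<^sup>2 * L\<^sup>2)"
      using l l1 L by (intro frac_le mult_mono power_mono) auto
    also have "u\<^sup>2 / 2 * ((3 * ln L) * (3 * L) / ((L / 2)\<^sup>2 * L\<^sup>2)) = 18 * E"
      using L by (simp add: E_def power2_eq_square power3_eq_cube)
    finally show ?thesis by (simp add: mult_left_mono)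
  qed
  have "\<bar>S - u\<^sup>2 / (2 * L\<^sup>2)\<bar> \<le> 16 * C * E + 4 * E + 18 * E"
    using S 1 2 3 by linarith
  then show ?thesis unfolding E_def[symmetric] by (simp add: algebra_simps)
qed

section \<open>The summatory function\<close>

lemma real_nat_div_bounds: "real (n div k) \<le> real n / real k" "real n / real k - 1 \<le> real (n div k)"
  using of_int_floor_le[of "real n / real k"] real_of_int_floor_ge_diff_one[of "real n / real k"]
  by (simp_all add: floor_divide_of_nat_eq)

lemma goldbach_pairs_eq_sum: "goldbach_pairs N = (\<Sum>d\<in>{1..N}. goldbach_reps d)"
proof -
  let ?A = "\<lambda>d. {(p, q). prime p \<and> odd p \<and> prime q \<and> odd q \<and> p + q = (d::nat)}"
  have fin: "finite (?A d)" for d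
    by (rule finite_subset[of _ "{..d} \<times> {..d}"]) auto
  have "{(p, q). prime p \<and> odd p \<and> prime q \<and> odd q \<and> p + q \<le> N} = (\<Union>d\<in>{1..N}. ?A d)"
    using prime_gt_0_nat by (fastforce simp: Suc_le_eq)
  moreover have "card (\<Union>d\<in>{1..N}. ?A d) = (\<Sum>d\<in>{1..N}. card (?A d))"
    using fin by (intro card_UN_disjoint) auto
  ultimately show ?thesis by (simp only: goldbach_pairs_def goldbach_reps_def)
qed

lemma multiplier_interval:
  fixes d n :: nat
  assumes "d > 0"
  shows "{1..n} \<inter> {k. d * k \<le> n} = {1..n div d}"
proof -
  have "d * k \<le> n \<longleftrightarrow> k \<le> n div d" for k
    using assms by (simp add: less_eq_div_iff_mult_less_eq mult.commute)
  moreover have "k \<le> n" if "k \<le> n div d" for k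
    using that div_le_dividend by (rule order.trans)
  ultimately show ?thesis by auto
qed

lemma goldbach_summatory_eq:
  "real (goldbach_summatory M) = (\<Sum>k\<in>{1..2 * M}. real (goldbach_pairs (2 * M div k)))"
proof -
  let ?X = "2 * M"
  have "real (goldbach_summatory M) = (\<Sum>m\<in>{1..?X}. \<Sum>d | d dvd m. real (goldbach_reps d))"
    unfolding goldbach_summatory_altdef goldbach_divisor_sum_def by (simp only: of_nat_sum)
  also have "\<dots> = (\<Sum>d\<in>{1..?X}. real (goldbach_reps d) * real (?X div d))"
    by (rule sum_divisors_sum)
  also have "\<dots> = (\<Sum>d\<in>{1..?X}. \<Sum>k\<in>{1..?X}. if d * k \<le> ?X then real (goldbach_reps d) else 0)"
  proof (rule sum.cong)
    fix d assume "d \<in> {1..?X}"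
    then have "{1..?X} \<inter> {k. d * k \<le> ?X} = {1..?X div d}" by (intro multiplier_interval) simp
    then show "real (goldbach_reps d) * real (?X div d) = (\<Sum>k\<in>{1..?X}. if d * k \<le> ?X then real (goldbach_reps d) else 0)"
      by (simp add: sum.If_cases)
  qed simp
  also have "\<dots> = (\<Sum>k\<in>{1..?X}. \<Sum>d\<in>{1..?X}. if d * k \<le> ?X then real (goldbach_reps d) else 0)"
    by (rule sum.swap)
  also have "\<dots> = (\<Sum>k\<in>{1..?X}. real (goldbach_pairs (?X div k)))"
  proof (rule sum.cong)
    fix k assume "k \<in> {1..?X}"
    then have "{1..?X} \<inter> {d. k * d \<le> ?X} = {1..?X div k}" by (intro multiplier_interval) simp
    then have "{1..?X} \<inter> {d. d * k \<le> ?X} = {1..?X div k}" by (simp only: mult.commute)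
    then show "(\<Sum>d\<in>{1..?X}. if d * k \<le> ?X then real (goldbach_reps d) else 0) = real (goldbach_pairs (?X div k))"
      by (simp add: sum.If_cases goldbach_pairs_eq_sum)
  qed simp
  finally show ?thesis .
qed

text \<open>With \<open>X = 2 * M\<close>, the terms \<open>k \<le> K\<close> give
  \<open>X\<^sup>2 / (2 * L\<^sup>2)\<close> times a partial sum of \<open>1 / k\<^sup>2\<close>;
  completing it to \<open>pi\<^sup>2 / 6\<close> produces the main term at a cost of
  \<open>X\<^sup>2 / (2 * K)\<close>. The terms \<open>k > K\<close> cost at most
  \<open>X\<^sup>2 / K\<close>, and together these are \<open>6 * M\<^sup>2 / K\<close>. The factor
  12 is \<open>4 * 3\<close>, where 3 bounds the partial sum.\<close>

lemma goldbach_summatory_error: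
  assumes M: "M > 0" and C: "C \<ge> 0" and K: "1 \<le> K" "K \<le> 2 * M"
    and E: "\<And>k. 1 \<le> k \<Longrightarrow> k \<le> K \<Longrightarrow>
      \<bar>real (goldbach_pairs (2 * M div k)) - (2 * real M / real k)\<^sup>2 / (2 * L\<^sup>2)\<bar> \<le> C * ((2 * real M / real k)\<^sup>2 * e)"
    and e: "e \<ge> 0" and L: "L \<ge> 1"
  shows "\<bar>real (goldbach_summatory M) - pi\<^sup>2 * (real M)\<^sup>2 / (3 * L\<^sup>2)\<bar>
      \<le> 12 * C * (real M)\<^sup>2 * e + 6 * (real M)\<^sup>2 / real K"
proof -
  define X where "X = 2 * real M"
  define S where "S = (\<lambda>k. real (goldbach_pairs (2 * M div k)))"
  define Z where "Z = (\<Sum>k\<in>{1..K}. 1 / (real k)\<^sup>2)"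
  have Z: "Z \<le> pi\<^sup>2 / 6" "pi\<^sup>2 / 6 - Z \<le> 1 / real K" unfolding Z_def by (rule sum_inverse_squares_approx[OF K(1)])+
  have "pi\<^sup>2 \<le> 4\<^sup>2" using pi_less_4 pi_gt_zero by (intro power_mono) auto
  then have Z3: "Z \<le> 3" using Z(1) by simp
  have "{1..2 * M} = {1..K} \<union> {Suc K..2 * M}" using K by auto
  then have split: "real (goldbach_summatory M) = (\<Sum>k\<in>{1..K}. S k) + (\<Sum>k\<in>{Suc K..2 * M}. S k)"
    unfolding goldbach_summatory_eq S_def by (simp add: sum.union_disjoint)
  have sq: "(X / real k)\<^sup>2 = X\<^sup>2 * (1 / (real k)\<^sup>2)" for k by (simp add: power_divide)
  have head: "\<bar>(\<Sum>k\<in>{1..K}. S k) - X\<^sup>2 / (2 * L\<^sup>2) * Z\<bar> \<le> C * X\<^sup>2 * e * 3"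
  proof -
    have "(\<Sum>k\<in>{1..K}. S k) - X\<^sup>2 / (2 * L\<^sup>2) * Z = (\<Sum>k\<in>{1..K}. S k - (X / real k)\<^sup>2 / (2 * L\<^sup>2))"
    proof -
      have "X\<^sup>2 / (2 * L\<^sup>2) * Z = (\<Sum>k\<in>{1..K}. (X / real k)\<^sup>2 / (2 * L\<^sup>2))"
        unfolding Z_def sum_distrib_left by (intro sum.cong) (simp_all add: power_divide)
      then show ?thesis by (simp only: sum_subtractf)
    qed
    also have "\<bar>\<dots>\<bar> \<le> (\<Sum>k\<in>{1..K}. C * ((X / real k)\<^sup>2 * e))"
      using E by (intro order.trans[OF sum_abs] sum_mono) (auto simp: S_def X_def)
    also have "\<dots> = C * X\<^sup>2 * e * Z"
      by (simp add: Z_def sum_distrib_left power_divide mult_ac)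
    also have "\<dots> \<le> C * X\<^sup>2 * e * 3" using C e by (intro mult_left_mono Z3) auto
    finally show ?thesis .
  qed
  have tail: "\<bar>\<Sum>k\<in>{Suc K..2 * M}. S k\<bar> \<le> X\<^sup>2 * (1 / real K)"
  proof -
    have "(\<Sum>k\<in>{Suc K..2 * M}. S k) \<le> (\<Sum>k\<in>{Suc K..2 * M}. X\<^sup>2 * (1 / (real k)\<^sup>2))"
    proof (rule sum_mono)
      fix k assume "k \<in> {Suc K..2 * M}"
      have "S k \<le> (real (2 * M div k))\<^sup>2" unfolding S_def by (rule goldbach_pairs_le_square)
      also have "\<dots> \<le> (X / real k)\<^sup>2"
        using real_nat_div_bounds(1)[of "2 * M" k] by (intro power_mono) (auto simp: X_def)
      finally show "S k \<le> X\<^sup>2 * (1 / (real k)\<^sup>2)" by (simp only: sq)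
    qed
    also have "\<dots> = X\<^sup>2 * (\<Sum>k\<in>{Suc K..2 * M}. 1 / (real k)\<^sup>2)" by (simp only: sum_distrib_left)
    also have "\<dots> \<le> X\<^sup>2 * (1 / real K)"
      by (intro mult_left_mono sum_inverse_squares_tail K) auto
    finally show ?thesis by (simp add: S_def sum_nonneg)
  qed
  have main: "\<bar>X\<^sup>2 / (2 * L\<^sup>2) * Z - X\<^sup>2 / (2 * L\<^sup>2) * (pi\<^sup>2 / 6)\<bar> \<le> X\<^sup>2 / 2 * (1 / real K)"
  proof -
    have "\<bar>X\<^sup>2 / (2 * L\<^sup>2) * Z - X\<^sup>2 / (2 * L\<^sup>2) * (pi\<^sup>2 / 6)\<bar> = X\<^sup>2 / (2 * L\<^sup>2) * (pi\<^sup>2 / 6 - Z)"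
      using Z(1) by (simp only: right_diff_distrib[symmetric] abs_mult) (simp add: abs_minus_commute)
    also have "\<dots> \<le> X\<^sup>2 / 2 * (1 / real K)"
      using Z L by (intro mult_mono divide_left_mono) auto
    finally show ?thesis .
  qed
  have "X\<^sup>2 / (2 * L\<^sup>2) * (pi\<^sup>2 / 6) = pi\<^sup>2 * (real M)\<^sup>2 / (3 * L\<^sup>2)"
    by (simp add: X_def power_mult_distrib)
  then have "\<bar>real (goldbach_summatory M) - pi\<^sup>2 * (real M)\<^sup>2 / (3 * L\<^sup>2)\<bar> \<le> C * X\<^sup>2 * e * 3 + X\<^sup>2 * (1 / real K) + X\<^sup>2 / 2 * (1 / real K)"
    using head tail main split by linarith
  also have "\<dots> = 12 * C * (real M)\<^sup>2 * e + 6 * (real M)\<^sup>2 / real K"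
    by (simp add: X_def power_mult_distrib)
  finally show ?thesis .
qed

text \<open>\<open>K\<close> near \<open>ln M ^ 3\<close> is large enough for
  \<open>M\<^sup>2 / K\<close> to fit into the error term, and small enough that every argument
  \<open>2 * M div k\<close> with \<open>k \<le> K\<close> keeps a logarithm within
  \<open>3 * ln L\<close> of \<open>ln M\<close>, up to 1 in the other direction.\<close>

lemma goldbach_summatory_asymp:
  "\<exists>C>0. \<forall>\<^sub>F M in sequentially.
     \<bar>real (goldbach_summatory M) - pi\<^sup>2 * (real M)\<^sup>2 / (3 * (ln (real M))\<^sup>2)\<bar>
       \<le> C * ((real M)\<^sup>2 * ln (ln (real M)) / ln (real M) ^ 3)"
proof -
  obtain C where C: "C > 0" and ev: "\<forall>\<^sub>F N in sequentially. \<bar>real (goldbach_pairs N) - (real N)\<^sup>2 / (2 * (ln (real N))\<^sup>2)\<bar>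
     \<le> C * ((real N)\<^sup>2 * ln (ln (real N)) / ln (real N) ^ 3)"
    using goldbach_pairs_asymp by blast
  from ev obtain N0 where N0: "\<And>N. N \<ge> N0 \<Longrightarrow> \<bar>real (goldbach_pairs N) - (real N)\<^sup>2 / (2 * (ln (real N))\<^sup>2)\<bar>
     \<le> C * ((real N)\<^sup>2 * ln (ln (real N)) / ln (real N) ^ 3)"
    by (auto simp: eventually_sequentially)
  \<comment> \<open>With \<open>D = M / ln M ^ 3\<close>, all arguments \<open>2 * M div k\<close>
    for \<open>k \<le> K\<close> are at least \<open>D\<close>; \<open>D \<ge> N0\<close> therefore
    makes the estimate for pairs available for all these \<open>k\<close> at once.\<close>
  have "\<forall>\<^sub>F M::nat in sequentially. ln (real M) \<ge> 2 \<and> ln (ln (real M)) \<ge> 1 \<and>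
      ln (real M) / 2 \<le> ln (real M) - 3 * ln (ln (real M)) \<and>
      real M / ln (real M) ^ 3 \<ge> max 1 (max (ln (real M)) (real N0))"
    by (simp only: max.bounded_iff) (intro eventually_conj; real_asymp)
  then have "\<forall>\<^sub>F M in sequentially.
     \<bar>real (goldbach_summatory M) - pi\<^sup>2 * (real M)\<^sup>2 / (3 * (ln (real M))\<^sup>2)\<bar>
       \<le> (12 * (16 * C + 22) + 12) * ((real M)\<^sup>2 * ln (ln (real M)) / ln (real M) ^ 3)"
    using eventually_gt_at_top[of 0]
  proof eventually_elim
    case (elim M)
    define L where "L = ln (real M)"
    define D where "D = real M / L ^ 3"
    have L: "L \<ge> 2" "ln L \<ge> 1" "L / 2 \<le> L - 3 * ln L" using elim by (auto simp: L_def)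
    have D: "D \<ge> 1" "D \<ge> L" "D \<ge> real N0" using elim by (auto simp: L_def D_def)
    have M: "M > 0" using elim by simp
    have L3: "L ^ 3 \<ge> 8" using power_mono[of 2 L 3] L by simp
    have "real M = D * L ^ 3" using L by (simp add: D_def)
    moreover have "1 * L ^ 3 \<le> D * L ^ 3" using D L by (intro mult_right_mono) auto
    ultimately have L3M: "L ^ 3 \<le> real M" by simp
    define K where "K = nat \<lfloor>L ^ 3\<rfloor>"
    have "0 \<le> L ^ 3" using L by simp
    then have "0 \<le> \<lfloor>L ^ 3\<rfloor>" by (simp only: zero_le_floor)
    then have "real K = of_int \<lfloor>L ^ 3\<rfloor>" by (simp only: K_def of_nat_nat)
    then have K: "real K \<le> L ^ 3" "real K \<ge> L ^ 3 - 1" by linarith+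
    have K1: "1 \<le> K" using K(2) L3 by simp
    have K2: "K \<le> 2 * M" using K(1) L3M by linarith
    have "\<bar>real (goldbach_summatory M) - pi\<^sup>2 * (real M)\<^sup>2 / (3 * L\<^sup>2)\<bar>
        \<le> 12 * (16 * C + 22) * (real M)\<^sup>2 * (ln L / L ^ 3) + 6 * (real M)\<^sup>2 / real K"
    proof (rule goldbach_summatory_error[OF M _ K1 K2])
      fix k :: nat assume k: "1 \<le> k" "k \<le> K"
      define n where "n = 2 * M div k"
      define u where "u = 2 * real M / real k"
      have "real k \<le> L ^ 3" using k K by linarith
      then have "2 * real M / L ^ 3 \<le> u" unfolding u_def using k L by (intro divide_left_mono) auto
      then have u: "2 * D \<le> u" by (simp add: D_def)
      have n: "u - 1 \<le> real n" "real n \<le> u"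
        using real_nat_div_bounds[where n = "2 * M" and k = k] by (simp_all add: n_def u_def)
      have nD: "real n \<ge> D" using n(1) u D by linarith
      have uM: "u \<le> 2 * real M" unfolding u_def using k by (simp add: divide_le_eq mult_le_cancel_left1)
      show "\<bar>real (goldbach_pairs n) - u\<^sup>2 / (2 * L\<^sup>2)\<bar> \<le> (16 * C + 22) * (u\<^sup>2 * (ln L / L ^ 3))"
      proof (rule pairs_main_term_shift)
        show "\<bar>real (goldbach_pairs n) - (real n)\<^sup>2 / (2 * (ln (real n))\<^sup>2)\<bar> \<le> C * ((real n)\<^sup>2 * ln (ln (real n)) / ln (real n) ^ 3)"
          by (rule N0) (use nD D in linarith)
        have "L - 3 * ln L = ln D" using L M by (simp add: D_def ln_div ln_realpow L_def)
        also have "\<dots> \<le> ln (real n)" using nD D by (subst ln_le_cancel_iff) auto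
        finally show "L - 3 * ln L \<le> ln (real n)" .
        then show "L / 2 \<le> ln (real n)" using L by linarith
        have "ln (real n) \<le> ln (2 * real M)" using nD D n uM M by (subst ln_le_cancel_iff) auto
        also have "\<dots> = ln 2 + L" using M by (simp add: ln_mult L_def)
        also have "\<dots> \<le> L + 1" using ln_2_less_1 by linarith
        finally show "ln (real n) \<le> L + 1" .
      qed (use C L n u D in auto)
    qed (use C L in auto)
    also have "6 * (real M)\<^sup>2 / real K \<le> 12 * ((real M)\<^sup>2 * (ln L / L ^ 3))"
    proof -
      have "L ^ 3 / 2 \<le> real K" using K(2) L3 by linarith
      then have "6 * (real M)\<^sup>2 / real K \<le> 6 * (real M)\<^sup>2 / (L ^ 3 / 2)"
        using L by (intro divide_left_mono) (auto intro!: mult_pos_pos simp: K1 Suc_le_lessD[OF K1[unfolded One_nat_def]])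
      also have "\<dots> = 12 * ((real M)\<^sup>2 * (1 / L ^ 3))" by simp
      also have "\<dots> \<le> 12 * ((real M)\<^sup>2 * (ln L / L ^ 3))"
        using L by (intro mult_left_mono divide_right_mono) auto
      finally show ?thesis .
    qed
    finally show ?case unfolding L_def[symmetric] by (simp add: algebra_simps)
  qed
  then show ?thesis using C by (intro exI[of _ "12 * (16 * C + 22) + 12"]) auto
qed

theorem theorem1:
  "\<exists>C :: real. \<forall>M :: nat. M \<ge> 3 \<longrightarrow>
     \<bar>real (goldbach_summatory M) - pi ^ 2 * real M ^ 2 / (3 * ln (real M) ^ 2)\<bar>
       \<le> C * (real M ^ 2 * ln (ln (real M)) / ln (real M) ^ 3)"
proof -
  define f where "f = (\<lambda>M. \<bar>real (goldbach_summatory M) - pi ^ 2 * real M ^ 2 / (3 * ln (real M) ^ 2)\<bar>)"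
  define g where "g = (\<lambda>M. real M ^ 2 * ln (ln (real M)) / ln (real M) ^ 3)"
  obtain C M0 where C: "C > 0" "\<And>M. M \<ge> M0 \<Longrightarrow> f M \<le> C * g M"
    using goldbach_summatory_asymp unfolding f_def g_def eventually_sequentially by blast
  \<comment> \<open>\<open>3 > e\<close> gives \<open>ln M > 1\<close>, so the iterated logarithm in
    the error term is positive.\<close>
  have g: "g M > 0" if "M \<ge> 3" for M
  proof -
    have "exp 1 < real M" using e_less_272 that by linarith
    then have "ln (exp 1) < ln (real M)" using that by (subst ln_less_cancel_iff) auto
    then have "ln (real M) > 1" by simp
    then show ?thesis using that by (simp add: g_def)
  qed
  \<comment> \<open>The finitely many \<open>M\<close> below \<open>M0\<close> are absorbed by
    adding all their quotients \<open>f m / g m\<close> to the constant.\<close>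
  have "f M \<le> (C + (\<Sum>m\<in>{3..<M0}. f m / g m)) * g M" if M: "M \<ge> 3" for M
  proof (cases "M \<ge> M0")
    case True
    have "0 \<le> (\<Sum>m\<in>{3..<M0}. f m / g m)"
      using g by (intro sum_nonneg) (auto simp: f_def less_imp_le)
    then have "C * g M \<le> (C + (\<Sum>m\<in>{3..<M0}. f m / g m)) * g M"
      using g[OF M] by (intro mult_right_mono) auto
    then show ?thesis using C(2)[OF True] by linarith
  next
    case False
    then have "f M / g M \<le> (\<Sum>m\<in>{3..<M0}. f m / g m)"
      using M g by (intro member_le_sum) (auto simp: f_def less_imp_le)
    then have "f M / g M \<le> C + (\<Sum>m\<in>{3..<M0}. f m / g m)" using C(1) by linarith
    then show ?thesis using g[OF M] by (simp add: divide_le_eq)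
  qed
  then show ?thesis unfolding f_def g_def by blast
qed

end
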